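(* Let $1\le p<\infty$ and $\omega\in\mathcal{E}$. Then the Bergman projection $P_\omega$ is a bounded operator from $L^p(\omega^{p/2})$ to $A^p(\omega^{p/2})$.
   Context: $\mathbb{D}$ is the open unit disk in $\mathbb{C}$, $dA=\frac{dx\,dy}{\pi}$ is normalized area measure, and $H(\mathbb{D})$ is the space of analytic functions on $\mathbb{D}$. A weight is a positive function $\omega\in L^1(\mathbb{D},dA)$. The notation $a\asymp b$ means that $C^{-1}b\le a\le Cb$ for some constant $C>0$ independent of the variables. Class $\mathcal{L}$: a positive function $\tau$ on $\mathbb{D}$ is in $\mathcal{L}$ if (A) there is a constant $c_1$ with $\tau(z)\le c_1(1-|z|)$ for all $z\in\mathbb{D}$, and (B) there is a constant $c_2$ with $|\tau(z)-\tau(\zeta)|\le c_2|z-\zeta|$ for all $z,\zeta\in\mathbb{D}$. Class $\mathcal{L}^*$: a weight $\omega$ is in $\mathcal{L}^*$ if $\omega=e^{-2\varphi}$ with $\varphi\in C^2(\mathbb{D})$, $\Delta\varphi>0$ ($\Delta$ is the classical Laplacian), and $(\Delta\varphi(z))^{-1/2}\asymp\tau(z)$ on $\mathbb{D}$ for some $\tau\in\mathcal{L}$, called the associated function of $\omega$. Class $\mathcal{E}$: a weight $\omega$ is in $\mathcal{E}$ if $\omega\in\mathcal{L}^*$ and its associated function $\tau$ satisfies: for each $m\ge1$ there are constants $b_m>0$ and $0<t_m<1/m$ such that $\tau(z)\le\tau(\xi)+t_m|z-\xi|$ for all $z,\xi\in\mathbb{D}$ with $|z-\xi|>b_m\tau(\xi)$.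 For $0<p<\infty$ and a weight $v$, $L^p(v)=L^p(\mathbb{D},v\,dA)$ and $A^p(v)=H(\mathbb{D})\cap L^p(v)$, with $\|f\|^p=\int_{\mathbb{D}}|f|^p v\,dA$; the same notation is used with $v=\omega^{p/2}$. $A^2(\omega)$ is a reproducing kernel Hilbert space with inner product $\langle f,g\rangle_\omega=\int_{\mathbb{D}}f\bar g\,\omega\,dA$; its reproducing kernel $K_z\in A^2(\omega)$ satisfies $f(z)=\langle f,K_z\rangle_\omega$ for all $f\in A^2(\omega)$, $z\in\mathbb{D}$. The Bergman projection is the integral operator $$P_\omega f(z)=\int_{\mathbb{D}}f(\xi)\,\overline{K_z(\xi)}\,\omega(\xi)\,dA(\xi),\qquad z\in\mathbb{D}.$$ *)

theory Defs
  imports "HOL-Analysis.Analysis"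
begin

abbreviation unit_disk :: "complex set" where
  "unit_disk \<equiv> ball 0 1"

definition dA :: "complex measure" where
  "dA = density (lebesgue_on unit_disk) (\<lambda>_. ennreal (1 / pi))"

definition comparable_on :: "'a set \<Rightarrow> ('a \<Rightarrow> real) \<Rightarrow> ('a \<Rightarrow> real) \<Rightarrow> bool" where
  "comparable_on S f g \<longleftrightarrow> (\<exists>C>0. \<forall>z\<in>S. inverse C * g z \<le> f z \<and> f z \<le> C * g z)"

text \<open>Functions are total on \<^typ>\<open>complex\<close>; only their values on the disk matter below.\<close>

definition weight :: "(complex \<Rightarrow> real) \<Rightarrow> bool" where
  "weight \<omega> \<longleftrightarrow> (\<forall>z\<in>unit_disk. 0 < \<omega> z) \<and> integrable dA \<omega>"

definition partial_deriv :: "complex \<Rightarrow> (complex \<Rightarrow> real) \<Rightarrow> complex \<Rightarrow> real" where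
  "partial_deriv b f z = frechet_derivative f (at z) b"

text \<open>\<open>C_on k S f\<close>: \<open>f\<close> is of class \<open>C\<^sup>k\<close>, in the real sense, on the open set \<open>S\<close>.
  The basis of \<^typ>\<open>complex\<close> is \<open>{1, \<i>}\<close>, so the directions \<open>b\<close> are the coordinates \<open>x\<close>, \<open>y\<close>.\<close>

primrec C_on :: "nat \<Rightarrow> complex set \<Rightarrow> (complex \<Rightarrow> real) \<Rightarrow> bool" where
  "C_on 0 S f \<longleftrightarrow> continuous_on S f"
| "C_on (Suc k) S f \<longleftrightarrow> f differentiable_on S \<and> (\<forall>b\<in>Basis. C_on k S (partial_deriv b f))"

definition laplacian :: "(complex \<Rightarrow> real) \<Rightarrow> complex \<Rightarrow> real" where
  "laplacian f z = (\<Sum>b\<in>Basis. partial_deriv b (partial_deriv b f) z)"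

definition class_L :: "(complex \<Rightarrow> real) set" where
  "class_L = {\<tau>. (\<forall>z\<in>unit_disk. 0 < \<tau> z) \<and>
     (\<exists>c1. \<forall>z\<in>unit_disk. \<tau> z \<le> c1 * (1 - norm z)) \<and>
     (\<exists>c2. \<forall>z\<in>unit_disk. \<forall>\<zeta>\<in>unit_disk. \<bar>\<tau> z - \<tau> \<zeta>\<bar> \<le> c2 * norm (z - \<zeta>))}"

definition associated_function :: "(complex \<Rightarrow> real) \<Rightarrow> (complex \<Rightarrow> real) \<Rightarrow> bool" where
  "associated_function \<omega> \<tau> \<longleftrightarrow> \<tau> \<in> class_L \<and>
     (\<exists>\<phi>. (\<forall>z\<in>unit_disk. \<omega> z = exp (- 2 * \<phi> z)) \<and> C_on 2 unit_disk \<phi> \<and>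
          (\<forall>z\<in>unit_disk. 0 < laplacian \<phi> z) \<and>
          comparable_on unit_disk (\<lambda>z. laplacian \<phi> z powr (- 1 / 2)) \<tau>)"

definition class_Lstar :: "(complex \<Rightarrow> real) set" where
  "class_Lstar = {\<omega>. weight \<omega> \<and> (\<exists>\<tau>. associated_function \<omega> \<tau>)}"

text \<open>The associated function is determined only up to comparability; membership in
  \<open>class_E\<close> asks for one choice of it with the additional property.\<close>

definition class_E :: "(complex \<Rightarrow> real) set" where
  "class_E = {\<omega> \<in> class_Lstar. \<exists>\<tau>. associated_function \<omega> \<tau> \<and>
     (\<forall>m::nat. 1 \<le> m \<longrightarrow> (\<exists>b t. 0 < b \<and> 0 < t \<and> t < 1 / real m \<and>
        (\<forall>z\<in>unit_disk. \<forall>\<xi>\<in>unit_disk.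
           b * \<tau> \<xi> < norm (z - \<xi>) \<longrightarrow> \<tau> z \<le> \<tau> \<xi> + t * norm (z - \<xi>))))}"

definition Lp_space :: "real \<Rightarrow> (complex \<Rightarrow> real) \<Rightarrow> (complex \<Rightarrow> complex) set" where
  "Lp_space p v = {f \<in> borel_measurable dA. integrable dA (\<lambda>z. norm (f z) powr p * v z)}"

definition Lp_norm :: "real \<Rightarrow> (complex \<Rightarrow> real) \<Rightarrow> (complex \<Rightarrow> complex) \<Rightarrow> real" where
  "Lp_norm p v f = (LINT z|dA. norm (f z) powr p * v z) powr (1 / p)"

definition Ap_space :: "real \<Rightarrow> (complex \<Rightarrow> real) \<Rightarrow> (complex \<Rightarrow> complex) set" where
  "Ap_space p v = {f. f holomorphic_on unit_disk} \<inter> Lp_space p v"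

definition A2_inner ::
    "(complex \<Rightarrow> real) \<Rightarrow> (complex \<Rightarrow> complex) \<Rightarrow> (complex \<Rightarrow> complex) \<Rightarrow> complex" where
  "A2_inner \<omega> f g = (LINT z|dA. f z * cnj (g z) * complex_of_real (\<omega> z))"

text \<open>On the disk the kernel is unique; its values elsewhere are arbitrary, hence \<open>SOME\<close>
  rather than \<open>THE\<close>.\<close>

definition bergman_kernel :: "(complex \<Rightarrow> real) \<Rightarrow> complex \<Rightarrow> complex \<Rightarrow> complex" where
  "bergman_kernel \<omega> z =
     (SOME K. K \<in> Ap_space 2 \<omega> \<and> (\<forall>f\<in>Ap_space 2 \<omega>. f z = A2_inner \<omega> f K))"

definition bergman_projection ::
    "(complex \<Rightarrow> real) \<Rightarrow> (complex \<Rightarrow> complex) \<Rightarrow> complex \<Rightarrow> complex" where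
  "bergman_projection \<omega> f z =
     (LINT \<xi>|dA. f \<xi> * cnj (bergman_kernel \<omega> z \<xi>) * complex_of_real (\<omega> \<xi>))"

text \<open>Linearity is required pointwise on the disk, where the functions of the target space live.\<close>

definition bounded_operator_Lp_Ap ::
    "real \<Rightarrow> (complex \<Rightarrow> real) \<Rightarrow> ((complex \<Rightarrow> complex) \<Rightarrow> complex \<Rightarrow> complex) \<Rightarrow> bool" where
  "bounded_operator_Lp_Ap p v T \<longleftrightarrow>
     (\<forall>f\<in>Lp_space p v. T f \<in> Ap_space p v) \<and>
     (\<forall>f\<in>Lp_space p v. \<forall>g\<in>Lp_space p v. \<forall>a b. \<forall>z\<in>unit_disk.
        T (\<lambda>\<xi>. a * f \<xi> + b * g \<xi>) z = a * T f z + b * T g z) \<and>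
     (\<exists>C. \<forall>f\<in>Lp_space p v. Lp_norm p v (T f) \<le> C * Lp_norm p v f)"

end

theory Submission
  imports Defs "HOL-Complex_Analysis.Complex_Analysis"
begin

text \<open>Integrating by parts, the adjoint \<open>delta\<close> of the d-bar operator in \<open>L\<^sup>2(\<omega>)\<close> satisfies
  \<open>\<parallel>delta a\<parallel>\<^sup>2 = \<parallel>dzb a\<parallel>\<^sup>2 + \<integral> |a|\<^sup>2 (\<Delta>\<phi> / 2) \<omega> dA\<close>, so that \<open>a / \<tau>\<close> is controlled by \<open>delta a\<close>.
  Freezing \<open>\<phi>\<close> on a disk of radius comparable to \<open>\<tau> z\<close> by a local gauge gives a function \<open>peak z\<close>
  supported there which represents the evaluation at \<open>z\<close> and has norm at most a constant times
  \<open>\<omega>(z)\<^sup>-\<^sup>1\<^sup>/\<^sup>2 / \<tau> z\<close>. The Bergman kernel \<open>K\<^sub>z\<close> is the orthogonal projection of \<open>peak z\<close>, hence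
  \<open>K\<^sub>z - peak z\<close> is a limit of functions \<open>delta a\<close>. For \<open>\<omega>\<close> in class \<open>\<E>\<close> the weight
  \<open>1 + |x - z|\<^sup>2 / (B \<tau> z)\<^sup>2\<close> with \<open>B\<close> large varies slowly on the scale of \<open>\<tau>\<close>, and the basic inequality
  survives multiplication by it. So the bound for \<open>peak z\<close> passes to the product of this weight and \<open>K\<^sub>z\<close>;
  the Cauchy-Schwarz inequality then bounds \<open>\<integral> |K\<^sub>z(x)| \<omega>(z)\<^sup>1\<^sup>/\<^sup>2 \<omega>(x)\<^sup>1\<^sup>/\<^sup>2 dA(x)\<close> uniformly in \<open>z\<close>, and
  Schur's test concludes.\<close>

section \<open>Wirtinger derivatives\<close>

text \<open>The difficulty is decay away from the diagonal: orthogonality alone controls only the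
  unweighted norm of K_z. A weight X growing away from z passes through because X^2 a is again a
  test function when a is, so K_z is orthogonal to \<open>delta\<close> of it. The price is the
  derivative of X, and class E makes it small against X / \<tau>. Quadratic growth suffices in the
  plane: the integral of X^(-2) is of order \<tau>(z)^2, and its square root cancels the factor 1 /
  \<tau>(z) from the norm of \<open>peak z\<close>. The other constraint is regularity. As \<phi> is
  only C^2, the gauge is only shown to be C^1 and \<open>peak z\<close> continuous. The d-bar
  equation is never solved: K_z is the limit of a sequence minimizing the norm of
  \<open>peak z\<close> + \<open>delta a\<close>, and its holomorphy comes from a Weyl lemma with an
  explicit rate. Test functions are powers of a truncated paraboloid, whose finite smoothness can be
  read off from formulas. Two bounds on the normalized kernel finish the proof: a uniform L^1 bound,
  which by symmetry serves for rows and columns, and a pointwise bound, which makes the integrals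
  converge for all p \<ge> 1, including p = 1.\<close>

definition has_wirtinger :: "(complex \<Rightarrow> complex) \<Rightarrow> complex \<Rightarrow> complex \<Rightarrow> complex \<Rightarrow> bool" where
  "has_wirtinger f a b z \<longleftrightarrow> (f has_derivative (\<lambda>t. a * t + b * cnj t)) (at z)"

definition dz :: "(complex \<Rightarrow> complex) \<Rightarrow> complex \<Rightarrow> complex" where
  "dz f z = (frechet_derivative f (at z) 1 - \<i> * frechet_derivative f (at z) \<i>) / 2"

definition dzb :: "(complex \<Rightarrow> complex) \<Rightarrow> complex \<Rightarrow> complex" where
  "dzb f z = (frechet_derivative f (at z) 1 + \<i> * frechet_derivative f (at z) \<i>) / 2"

lemma has_wirtinger_imp:
  assumes "has_wirtinger f a b z"
  shows "f differentiable (at z)" "dz f z = a" "dzb f z = b"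
proof -
  have d: "(f has_derivative (\<lambda>t. a * t + b * cnj t)) (at z)"
    using assms by (simp add: has_wirtinger_def)
  show "f differentiable (at z)" using d by (auto simp: differentiable_def)
  have e: "frechet_derivative f (at z) = (\<lambda>t. a * t + b * cnj t)"
    using frechet_derivative_at[OF d] by simp
  show "dz f z = a" "dzb f z = b"
    by (simp_all add: dz_def dzb_def e algebra_simps)
qed

lemma has_wirtinger_dz_dzb:
  assumes "f differentiable (at z)"
  shows "has_wirtinger f (dz f z) (dzb f z) z"
proof -
  let ?L = "frechet_derivative f (at z)"
  have d: "(f has_derivative ?L) (at z)" using assms frechet_derivative_works by blast
  then interpret L: bounded_linear ?L by (rule has_derivative_bounded_linear)
  have "?L t = dz f z * t + dzb f z * cnj t" for t
  proof -
    have "?L t = ?L (Re t *\<^sub>R 1 + Im t *\<^sub>R \<i>)"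
      by (rule arg_cong[where f="?L"]) (simp add: complex_eq_iff)
    also have "\<dots> = Re t *\<^sub>R ?L 1 + Im t *\<^sub>R ?L \<i>" by (simp only: L.add L.scaleR)
    also have "\<dots> = dz f z * t + dzb f z * cnj t"
      by (simp add: dz_def dzb_def complex_eq_iff field_simps)
    finally show ?thesis .
  qed
  then have "?L = (\<lambda>t. dz f z * t + dzb f z * cnj t)" by auto
  then show ?thesis using d by (simp add: has_wirtinger_def)
qed

lemma has_wirtinger_transform:
  assumes "has_wirtinger f a b z" "open U" "z \<in> U" "\<And>x. x \<in> U \<Longrightarrow> g x = f x"
  shows "has_wirtinger g a b z"
  using assms has_derivative_transform_within_open[of f _ z UNIV U g]
  by (auto simp: has_wirtinger_def)

lemma has_wirtinger_const: "has_wirtinger (\<lambda>_. c) 0 0 z"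
  by (simp add: has_wirtinger_def)

lemma has_wirtinger_field_derivative:
  "(f has_field_derivative d) (at z) \<Longrightarrow> has_wirtinger f d 0 z"
  by (simp add: has_wirtinger_def has_field_derivative_def)

lemma has_wirtinger_cnj:
  assumes "has_wirtinger f a b z"
  shows "has_wirtinger (\<lambda>x. cnj (f x)) (cnj b) (cnj a) z"
  unfolding has_wirtinger_def
  using has_derivative_cnj[OF assms[unfolded has_wirtinger_def]]
  by (simp add: add.commute)

lemma has_wirtinger_add:
  assumes "has_wirtinger f a b z" "has_wirtinger g c d z"
  shows "has_wirtinger (\<lambda>x. f x + g x) (a + c) (b + d) z"
  unfolding has_wirtinger_def
  by (rule has_derivative_eq_rhs[OF has_derivative_add[OF assms[unfolded has_wirtinger_def]]])
     (simp add: algebra_simps)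

lemma has_wirtinger_mult:
  assumes "has_wirtinger f a b z" "has_wirtinger g c d z"
  shows "has_wirtinger (\<lambda>x. f x * g x) (a * g z + f z * c) (b * g z + f z * d) z"
  unfolding has_wirtinger_def
  by (rule has_derivative_eq_rhs[OF has_derivative_mult[OF assms[unfolded has_wirtinger_def]]])
     (simp add: algebra_simps)

lemma has_wirtinger_compose:
  assumes "has_wirtinger f a b z" "(h has_field_derivative d) (at (f z))"
  shows "has_wirtinger (\<lambda>x. h (f x)) (d * a) (d * b) z"
  unfolding has_wirtinger_def
  by (rule has_derivative_eq_rhs[OF has_derivative_compose[OF
        assms(1)[unfolded has_wirtinger_def] has_field_derivative_imp_has_derivative[OF assms(2)]]])
     (simp add: algebra_simps)

text \<open>Here \<open>h\<close> is only differentiable on the real line, so the complex chain rule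
  does not apply. Since \<open>u\<close> is real, its derivative takes real values, and this
  identifies the real chain rule with the Wirtinger form.\<close>

lemma has_wirtinger_real_compose:
  fixes u :: "complex \<Rightarrow> real"
  assumes "has_wirtinger (\<lambda>x. of_real (u x)) a b z" "(h has_real_derivative d) (at (u z))"
  shows "has_wirtinger (\<lambda>x. of_real (h (u x))) (d * a) (d * b) z"
proof -
  have "((\<lambda>x. Re (of_real (u x))) has_derivative (\<lambda>t. Re (a * t + b * cnj t))) (at z)"
    using has_derivative_Re[OF assms(1)[unfolded has_wirtinger_def]] .
  then have u: "(u has_derivative (\<lambda>t. Re (a * t + b * cnj t))) (at z)" by simp
  \<comment> \<open>The imaginary part of a real function is constantly 0, so uniqueness of
    derivatives kills the imaginary part of the linear map.\<close>
  have im: "Im (a * t + b * cnj t) = 0" for t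
  proof -
    have "((\<lambda>x. Im (complex_of_real (u x))) has_derivative (\<lambda>t. Im (a * t + b * cnj t))) (at z)"
      using has_derivative_Im[OF assms(1)[unfolded has_wirtinger_def]] .
    then have "((\<lambda>x. 0) has_derivative (\<lambda>t. Im (a * t + b * cnj t))) (at z)" by simp
    from has_derivative_unique[OF this has_derivative_const] show ?thesis by metis
  qed
  have e: "complex_of_real (Re (a * t + b * cnj t)) = a * t + b * cnj t" for t
    using im[of t] by (simp add: complex_eq_iff)
  have "((\<lambda>x. h (u x)) has_derivative (\<lambda>t. d * Re (a * t + b * cnj t))) (at z)"
    using has_derivative_compose[OF u has_field_derivative_imp_has_derivative[OF assms(2)]] by simp
  from has_derivative_of_real[OF this]
  show ?thesis unfolding has_wirtinger_def
    by (rule has_derivative_eq_rhs) (simp only: of_real_mult e, simp add: algebra_simps)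
qed

section \<open>Smoothness of finite order, counted in Wirtinger derivatives\<close>

primrec Ck :: "nat \<Rightarrow> complex set \<Rightarrow> (complex \<Rightarrow> complex) \<Rightarrow> bool" where
  "Ck 0 U f \<longleftrightarrow> continuous_on U f"
| "Ck (Suc k) U f \<longleftrightarrow> (\<forall>z\<in>U. f differentiable (at z)) \<and> Ck k U (dz f) \<and> Ck k U (dzb f)"

lemma Ck_SucD: "Ck (Suc k) U f \<Longrightarrow> Ck k U f"
proof (induction k arbitrary: f)
  case 0
  then show ?case
    by (auto intro!: continuous_at_imp_continuous_on differentiable_imp_continuous_within)
next
  case (Suc k)
  have "Ck k U (dz f)" "Ck k U (dzb f)"
    using Suc.prems by (auto intro!: Suc.IH simp del: Ck.simps(2) simp: Ck.simps(2)[of "Suc k"])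
  then show ?case using Suc.prems by simp
qed

lemma Ck_le: "Ck n U f \<Longrightarrow> m \<le> n \<Longrightarrow> Ck m U f"
  by (induction n) (auto simp: le_Suc_eq dest: Ck_SucD simp del: Ck.simps)

lemma Ck_continuous: "Ck k U f \<Longrightarrow> continuous_on U f"
  using Ck_le[of k U f 0] by simp

lemma Ck_subset: "Ck k U f \<Longrightarrow> V \<subseteq> U \<Longrightarrow> Ck k V f"
  by (induction k arbitrary: f) (auto intro: continuous_on_subset)

lemma Ck_Un: "open U \<Longrightarrow> open V \<Longrightarrow> Ck k U f \<Longrightarrow> Ck k V f \<Longrightarrow> Ck k (U \<union> V) f"
  by (induction k arbitrary: f) (auto intro: continuous_on_open_Un)

lemma Ck_cong:
  assumes "open U" "\<And>z. z \<in> U \<Longrightarrow> f z = g z" "Ck k U g"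
  shows "Ck k U f"
  using assms(2,3)
proof (induction k arbitrary: f g)
  case 0
  then show ?case using continuous_on_cong by auto
next
  case (Suc k)
  have w: "has_wirtinger f (dz g z) (dzb g z) z" if "z \<in> U" for z
    using Suc.prems that assms(1)
    by (intro has_wirtinger_transform[OF has_wirtinger_dz_dzb, of g z U]) auto
  have "Ck k U (dz f)" "Ck k U (dzb f)"
    using Suc.prems(2) by (auto intro!: Suc.IH[of "dz f" "dz g"] Suc.IH[of "dzb f" "dzb g"]
        simp: has_wirtinger_imp[OF w])
  then show ?case using has_wirtinger_imp(1)[OF w] by auto
qed

text \<open>The formulas \<open>a\<close> and \<open>b\<close> need to give the derivatives only on
  \<open>U\<close>. With this rule the closure properties below become inductions on the order, each
  step being one calculus rule.\<close>

lemma Ck_SucI: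
  assumes "open U" "\<And>z. z \<in> U \<Longrightarrow> has_wirtinger f (a z) (b z) z" "Ck k U a" "Ck k U b"
  shows "Ck (Suc k) U f"
  using assms has_wirtinger_imp[OF assms(2)] by (auto intro: Ck_cong)

lemma Ck_SucE:
  assumes "Ck (Suc k) U f"
  shows "z \<in> U \<Longrightarrow> has_wirtinger f (dz f z) (dzb f z) z" "Ck k U (dz f)" "Ck k U (dzb f)"
  using assms has_wirtinger_dz_dzb by auto

lemma Ck_const: "Ck k U (\<lambda>_. c)"
proof (induction k arbitrary: c)
  case (Suc k)
  have "dz (\<lambda>_. c) = (\<lambda>_. 0)" "dzb (\<lambda>_. c) = (\<lambda>_. 0)"
    using has_wirtinger_imp[OF has_wirtinger_const] by auto
  then show ?case using Suc by simp
qed simp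

lemma Ck_add: "open U \<Longrightarrow> Ck k U f \<Longrightarrow> Ck k U g \<Longrightarrow> Ck k U (\<lambda>z. f z + g z)"
proof (induction k arbitrary: f g)
  case 0 then show ?case by (auto intro: continuous_intros)
next
  case (Suc k)
  note f = Ck_SucE[OF Suc.prems(2)] and g = Ck_SucE[OF Suc.prems(3)]
  show ?case
    by (rule Ck_SucI[OF Suc.prems(1) has_wirtinger_add[OF f(1) g(1)]])
       (auto intro!: Suc f g)
qed

lemma Ck_mult: "open U \<Longrightarrow> Ck k U f \<Longrightarrow> Ck k U g \<Longrightarrow> Ck k U (\<lambda>z. f z * g z)"
proof (induction k arbitrary: f g)
  case 0 then show ?case by (auto intro: continuous_intros)
next
  case (Suc k)
  note f = Ck_SucE[OF Suc.prems(2)] and g = Ck_SucE[OF Suc.prems(3)]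
  show ?case
    by (rule Ck_SucI[OF Suc.prems(1) has_wirtinger_mult[OF f(1) g(1)]])
       (auto intro!: Suc f g Ck_add Ck_SucD[OF Suc.prems(2)] Ck_SucD[OF Suc.prems(3)])
qed

lemma Ck_minus: "open U \<Longrightarrow> Ck k U f \<Longrightarrow> Ck k U (\<lambda>z. - f z)"
  using Ck_mult[OF _ Ck_const[of k U "-1"], of f] by simp

lemma Ck_diff: "open U \<Longrightarrow> Ck k U f \<Longrightarrow> Ck k U g \<Longrightarrow> Ck k U (\<lambda>z. f z - g z)"
  using Ck_add[OF _ _ Ck_minus, of U k f g] by simp

lemma Ck_power: "open U \<Longrightarrow> Ck k U f \<Longrightarrow> Ck k U (\<lambda>z. f z ^ n)"
  by (induction n) (auto intro: Ck_const Ck_mult)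

lemma Ck_cnj: "open U \<Longrightarrow> Ck k U f \<Longrightarrow> Ck k U (\<lambda>z. cnj (f z))"
proof (induction k arbitrary: f)
  case 0 then show ?case by (auto intro: continuous_intros)
next
  case (Suc k)
  note f = Ck_SucE[OF Suc.prems(2)]
  show ?case
    by (rule Ck_SucI[OF Suc.prems(1) has_wirtinger_cnj[OF f(1)]]) (auto intro!: Suc f)
qed

lemma Ck_holomorphic: "open U \<Longrightarrow> f holomorphic_on U \<Longrightarrow> Ck k U f"
proof (induction k arbitrary: f)
  case 0 then show ?case by (auto intro: holomorphic_on_imp_continuous_on)
next
  case (Suc k)
  show ?case
    by (rule Ck_SucI[OF Suc.prems(1) has_wirtinger_field_derivative[OF holomorphic_derivI[OF Suc.prems(2,1)]]])
       (auto intro!: Suc Ck_const holomorphic_deriv)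
qed

lemma Ck_exp: "open U \<Longrightarrow> Ck k U f \<Longrightarrow> Ck k U (\<lambda>z. exp (f z))"
proof (induction k arbitrary: f)
  case 0 then show ?case by (auto intro: continuous_intros)
next
  case (Suc k)
  note f = Ck_SucE[OF Suc.prems(2)]
  show ?case
    by (rule Ck_SucI[OF Suc.prems(1) has_wirtinger_compose[OF f(1) DERIV_exp]])
       (auto intro!: Ck_mult Suc.IH f Suc.prems Ck_SucD[OF Suc.prems(2)])
qed

lemma has_wirtinger_of_real:
  fixes f :: "complex \<Rightarrow> real"
  assumes "f differentiable (at z)"
  shows "has_wirtinger (\<lambda>x. of_real (f x))
      (of_real (partial_deriv 1 f z) * (1/2) + of_real (partial_deriv \<i> f z) * (- \<i>/2))
      (of_real (partial_deriv 1 f z) * (1/2) + of_real (partial_deriv \<i> f z) * (\<i>/2)) z"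
proof -
  let ?L = "frechet_derivative f (at z)"
  have d: "(f has_derivative ?L) (at z)"
    using assms by (simp only: frechet_derivative_works)
  interpret L: bounded_linear ?L by (rule has_derivative_bounded_linear[OF d])
  have "?L t = Re t * ?L 1 + Im t * ?L \<i>" for t
  proof -
    have "?L t = ?L (Re t *\<^sub>R 1 + Im t *\<^sub>R \<i>)"
      by (rule arg_cong[where f="?L"]) (simp add: complex_eq_iff)
    also have "\<dots> = Re t *\<^sub>R ?L 1 + Im t *\<^sub>R ?L \<i>" by (simp only: L.add L.scaleR)
    finally show ?thesis by simp
  qed
  then have e: "complex_of_real (?L t) = of_real (Re t) * of_real (?L 1) + of_real (Im t) * of_real (?L \<i>)" for t
    by (metis of_real_add of_real_mult)
  show ?thesis unfolding has_wirtinger_def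
    by (rule has_derivative_eq_rhs[OF has_derivative_of_real[OF d]])
       (rule ext, subst e, simp add: partial_deriv_def complex_eq_iff algebra_simps)
qed

lemma Ck_of_real:
  fixes f :: "complex \<Rightarrow> real"
  assumes "open U"
  shows "C_on k U f \<Longrightarrow> Ck k U (\<lambda>z. of_real (f z))"
proof (induction k arbitrary: f)
  case 0 then show ?case by (simp add: continuous_on_of_real)
next
  case (Suc k)
  have diff: "f differentiable (at z)" if "z \<in> U" for z
    using Suc.prems that at_within_open[OF that assms] by (simp add: differentiable_on_def) metis
  have "Ck k U (\<lambda>z. of_real (partial_deriv 1 f z))" "Ck k U (\<lambda>z. of_real (partial_deriv \<i> f z))"
    using Suc by (auto simp: Basis_complex_def)
  then show ?case
    by (intro Ck_SucI[OF assms has_wirtinger_of_real[OF diff]] Ck_add Ck_mult Ck_const assms)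
qed

section \<open>Bump functions and integration on the disk\<close>

text \<open>A truncated paraboloid. Raising it to the power k + 1 produces a C^k function supported
  in the disk of radius \<open>r\<close>, whose derivatives are again lower powers times linear
  factors.\<close>

definition bump :: "complex \<Rightarrow> real \<Rightarrow> complex \<Rightarrow> real" where
  "bump w r z = max 0 (1 - (norm (z - w))\<^sup>2 / r\<^sup>2)"

text \<open>At the kink the difference quotient is at most \<open>\<bar>x\<bar> ^ Suc n\<close> on
  either side, which tends to 0 because the exponent is at least 2. Elsewhere the function is
  locally 0 or a plain power.\<close>

lemma DERIV_max_power:
  "((\<lambda>x::real. (max 0 x) ^ (Suc (Suc n))) has_real_derivative (of_nat (Suc (Suc n)) * (max 0 x) ^ Suc n)) (at x)"
proof (cases "x = 0")
  case True
  have *: "((\<lambda>x::real. \<bar>(max 0 x) ^ (Suc (Suc n)) - 0\<bar> / \<bar>x\<bar>) \<longlongrightarrow> 0) (at 0)"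
  proof (rule tendsto_sandwich[of "\<lambda>_. 0" _ _ "\<lambda>x. \<bar>x\<bar> ^ Suc n"])
    show "((\<lambda>x::real. \<bar>x\<bar> ^ Suc n) \<longlongrightarrow> 0) (at 0)" by (rule tendsto_eq_intros | simp)+
    show "\<forall>\<^sub>F x::real in at 0. \<bar>(max 0 x) ^ (Suc (Suc n)) - 0\<bar> / \<bar>x\<bar> \<le> \<bar>x\<bar> ^ Suc n"
    proof (intro always_eventually allI)
      fix x :: real
      show "\<bar>(max 0 x) ^ (Suc (Suc n)) - 0\<bar> / \<bar>x\<bar> \<le> \<bar>x\<bar> ^ Suc n"
      proof (cases "0 < x")
        case True then show ?thesis by (simp add: max_def)
      next
        case False
        then have "max 0 x = 0" by simp
        then show ?thesis by (simp only:) (simp del: power_Suc add: zero_le_power)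
      qed
    qed
  qed auto
  have "((\<lambda>y::real. ((max 0 (0+y)) ^ (Suc (Suc n)) - (max 0 0) ^ Suc (Suc n)) / y) \<longlongrightarrow> 0) (at 0)"
    by (rule tendsto_rabs_zero_cancel) (use * in simp)
  then show ?thesis using True by (simp add: DERIV_def)
next
  case False
  then consider "x < 0" | "x > 0" by linarith
  then show ?thesis
  proof cases
    case 1
    have "((\<lambda>x::real. 0) has_real_derivative 0) (at x)" by simp
    then have "((\<lambda>x::real. (max 0 x) ^ (Suc (Suc n))) has_real_derivative 0) (at x)"
      by (rule has_field_derivative_transform_within_open[of _ _ _ "{..<0}"])
         (use 1 in \<open>auto simp: max_def\<close>)
    then show ?thesis using 1 by simp
  next
    case 2
    have "((\<lambda>x::real. x ^ Suc (Suc n)) has_real_derivative of_nat (Suc (Suc n)) * x ^ Suc n) (at x)"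
      by (rule derivative_eq_intros refl | simp)+
    then have "((\<lambda>x::real. (max 0 x) ^ (Suc (Suc n))) has_real_derivative of_nat (Suc (Suc n)) * x ^ Suc n) (at x)"
      by (rule has_field_derivative_transform_within_open[of _ _ _ "{0<..}"])
         (use 2 in \<open>auto simp: max_def\<close>)
    then show ?thesis using 2 by simp
  qed
qed

lemma has_wirtinger_bump_power:
  "has_wirtinger (\<lambda>z. of_real (bump w r z ^ Suc (Suc n)))
     (of_real (of_nat (Suc (Suc n)) * bump w r z ^ Suc n) * (- cnj (z - w) / r\<^sup>2))
     (of_real (of_nat (Suc (Suc n)) * bump w r z ^ Suc n) * (- (z - w) / r\<^sup>2)) z"
proof -
  have id: "has_wirtinger (\<lambda>z. z - w) 1 0 z"
    by (rule has_wirtinger_field_derivative) (rule derivative_eq_intros refl | simp)+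
  have "has_wirtinger (\<lambda>z. 1 + (- 1 / of_real (r\<^sup>2)) * ((z - w) * cnj (z - w)))
     (0 + (0 * ((z - w) * cnj (z - w)) + (- 1 / of_real (r\<^sup>2)) * (1 * cnj (z - w) + (z - w) * cnj 0)))
     (0 + (0 * ((z - w) * cnj (z - w)) + (- 1 / of_real (r\<^sup>2)) * (0 * cnj (z - w) + (z - w) * cnj 1))) z"
    by (intro has_wirtinger_add has_wirtinger_mult has_wirtinger_const has_wirtinger_cnj id)
  moreover have "(\<lambda>z. 1 + (- 1 / of_real (r\<^sup>2)) * ((z - w) * cnj (z - w)))
     = (\<lambda>z. complex_of_real (1 - (norm (z - w))\<^sup>2 / r\<^sup>2))"
    by (rule ext) (simp only: complex_norm_square[symmetric], simp)
  moreover have "0 + (0 * ((z - w) * cnj (z - w)) + (- 1 / of_real (r\<^sup>2)) * (1 * cnj (z - w) + (z - w) * cnj 0)) = - cnj (z - w) / of_real (r\<^sup>2)"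
    "0 + (0 * ((z - w) * cnj (z - w)) + (- 1 / of_real (r\<^sup>2)) * (0 * cnj (z - w) + (z - w) * cnj 1)) = - (z - w) / of_real (r\<^sup>2)"
    by (simp_all add: diff_divide_distrib)
  ultimately have u: "has_wirtinger (\<lambda>z. complex_of_real (1 - (norm (z - w))\<^sup>2 / r\<^sup>2))
     (- cnj (z - w) / of_real (r\<^sup>2)) (- (z - w) / of_real (r\<^sup>2)) z" by (simp only:)
  show ?thesis unfolding bump_def
    using has_wirtinger_real_compose[OF u DERIV_max_power, of n] by (simp only: of_real_power)
qed

lemma continuous_on_bump[continuous_intros]: "continuous_on U (bump w r)"
  unfolding bump_def divide_inverse by (intro continuous_intros)

lemma Ck_bump: "open U \<Longrightarrow> Ck k U (\<lambda>z. of_real (bump w r z ^ Suc k))"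
proof (induction k)
  case 0 then show ?case by (auto intro!: continuous_intros)
next
  case (Suc k)
  have a: "Ck k U (\<lambda>z. - (z - w) / complex_of_real (r\<^sup>2))"
    \<comment> \<open>For \<open>r = 0\<close> the quotient is the constant 0 by the convention on
      division.\<close>
    using Suc.prems by (cases "r = 0") (auto intro!: Ck_holomorphic holomorphic_intros)
  have b: "Ck k U (\<lambda>z. - cnj (z - w) / complex_of_real (r\<^sup>2))"
    using Ck_cnj[OF Suc.prems a] by simp
  have c: "Ck k U (\<lambda>z. complex_of_real (real (Suc (Suc k)) * bump w r z ^ Suc k))"
    using Ck_mult[OF Suc.prems Ck_const Suc.IH[OF Suc.prems], of "of_nat (Suc (Suc k))"] by simp
  show ?case
    by (rule Ck_SucI[OF Suc.prems has_wirtinger_bump_power])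
       (intro Ck_mult a b c Suc.prems)+
qed

lemma bump_bounds: "0 \<le> bump w r z" "bump w r z \<le> 1"
  by (auto simp: bump_def)

lemma bump_eq_0: "0 < r \<Longrightarrow> r \<le> norm (z - w) \<Longrightarrow> bump w r z = 0"
  by (simp add: bump_def power_mono)

lemma bump_eq: "norm (z - w) \<le> r \<Longrightarrow> 0 < r \<Longrightarrow> bump w r z = 1 - (norm (z - w))\<^sup>2 / r\<^sup>2"
  by (simp add: bump_def power_mono)

section \<open>Normalized area measure on the disk and its relation to Lebesgue measure\<close>

lemma space_dA [simp]: "space dA = unit_disk"
  by (simp add: dA_def)

lemma sets_dA: "sets dA = sets (lebesgue_on unit_disk)"
  by (simp add: dA_def)

lemma measurable_dA_iff: "f \<in> borel_measurable dA \<longleftrightarrow> f \<in> borel_measurable (lebesgue_on unit_disk)"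
  by (rule arg_cong[where f="\<lambda>S. f \<in> S"], rule measurable_cong_sets) (simp_all add: sets_dA)

lemma continuous_imp_measurable_dA:
  "continuous_on unit_disk f \<Longrightarrow> f \<in> borel_measurable dA"
  by (simp add: measurable_dA_iff continuous_imp_measurable_on_sets_lebesgue)

lemma borel_imp_measurable_dA:
  "f \<in> borel_measurable borel \<Longrightarrow> f \<in> borel_measurable dA"
  by (simp add: measurable_dA_iff measurable_completion measurable_restrict_space1)

lemma nn_integral_dA:
  assumes "f \<in> borel_measurable borel"
  shows "(\<integral>\<^sup>+x. f x \<partial>dA) = ennreal (1/pi) * (\<integral>\<^sup>+x. f x * indicator unit_disk x \<partial>lborel)"
proof -
  have f: "f \<in> borel_measurable (lebesgue_on unit_disk)"
    using assms by (simp add: measurable_completion measurable_restrict_space1)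
  have "(\<integral>\<^sup>+x. f x \<partial>dA) = (\<integral>\<^sup>+x. ennreal (1/pi) * f x \<partial>lebesgue_on unit_disk)"
    unfolding dA_def by (rule nn_integral_density) (use f in auto)
  also have "\<dots> = ennreal (1/pi) * (\<integral>\<^sup>+x. f x \<partial>lebesgue_on unit_disk)"
    by (rule nn_integral_cmult) (use f in auto)
  also have "(\<integral>\<^sup>+x. f x \<partial>lebesgue_on unit_disk) = (\<integral>\<^sup>+x. f x * indicator unit_disk x \<partial>lebesgue)"
    by (rule nn_integral_restrict_space) simp
  also have "\<dots> = (\<integral>\<^sup>+x. f x * indicator unit_disk x \<partial>lborel)"
    by (rule nn_integral_completion)
  finally show ?thesis .
qed

lemma emeasure_dA_le:
  assumes "0 \<le> r"
  shows "emeasure dA (cball z r \<inter> unit_disk) \<le> ennreal (r\<^sup>2)"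
proof -
  have "emeasure dA (cball z r \<inter> unit_disk) = (\<integral>\<^sup>+x. indicator (cball z r \<inter> unit_disk) x \<partial>dA)"
    by (rule nn_integral_indicator[symmetric]) (simp add: sets_dA sets_restrict_space_iff)
  also have "\<dots> = ennreal (1/pi) * (\<integral>\<^sup>+x. indicator (cball z r \<inter> unit_disk) x * indicator unit_disk x \<partial>lborel)"
    by (rule nn_integral_dA, rule borel_measurable_indicator) auto
  also have "\<dots> \<le> ennreal (1/pi) * (\<integral>\<^sup>+x. indicator (cball z r) x \<partial>lborel)"
    by (intro mult_left_mono nn_integral_mono) (auto split: split_indicator)
  also have "(\<integral>\<^sup>+x. indicator (cball z r) x \<partial>lborel) = emeasure lborel (cball z r)"
    by simp
  also have "\<dots> = ennreal (pi * r\<^sup>2)"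
    using assms by (simp add: emeasure_cball unit_ball_vol_2)
  also have "ennreal (1/pi) * ennreal (pi * r\<^sup>2) = ennreal (r\<^sup>2)"
    by (simp add: ennreal_mult[symmetric])
  finally show ?thesis .
qed

lemma finite_measure_dA: "finite_measure dA"
proof
  have "cball 0 1 \<inter> unit_disk = unit_disk" by auto
  with emeasure_dA_le[of 1 0] have "emeasure dA unit_disk \<le> 1" by simp
  then show "emeasure dA (space dA) \<noteq> \<infinity>" using neq_top_trans by force
qed

interpretation dA: finite_measure dA
  by (rule finite_measure_dA)

text \<open>Translations and dilations preserve Lebesgue measure on the plane but not
  \<open>dA\<close>. Arguments using them are carried out on \<open>lborel\<close> for the extension
  by zero, here \<open>G\<close>.\<close>

lemma integral_dA_lborel:
  fixes g :: "complex \<Rightarrow> 'a::{banach,second_countable_topology}"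
  assumes "G \<in> borel_measurable borel" "\<And>x. x \<in> unit_disk \<Longrightarrow> G x = g x" "\<And>x. x \<notin> unit_disk \<Longrightarrow> G x = 0"
  shows "(LINT x|dA. g x) = (1/pi) *\<^sub>R (LINT x|lborel. G x)"
    and "integrable dA g \<longleftrightarrow> integrable lborel G"
proof -
  have Gm: "G \<in> borel_measurable (lebesgue_on unit_disk)"
    using assms(1) by (simp add: measurable_completion measurable_restrict_space1)
  have eqG: "(\<lambda>x. indicator unit_disk x *\<^sub>R G x) = G"
    using assms(3) by (auto simp: fun_eq_iff split: split_indicator)
  have "(LINT x|dA. g x) = (LINT x|dA. G x)"
    by (rule Bochner_Integration.integral_cong) (simp_all add: assms(2))
  also have "\<dots> = (LINT x|lebesgue_on unit_disk. (1/pi) *\<^sub>R G x)"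
    unfolding dA_def by (rule integral_density) (use Gm in auto)
  also have "\<dots> = (1/pi) *\<^sub>R (LINT x|lebesgue_on unit_disk. G x)" by simp
  also have "(LINT x|lebesgue_on unit_disk. G x) = (LINT x|lebesgue. indicator unit_disk x *\<^sub>R G x)"
    by (rule integral_restrict_space) simp
  also have "\<dots> = (LINT x|lebesgue. G x)" by (simp only: eqG)
  also have "\<dots> = (LINT x|lborel. G x)"
    by (rule integral_completion) (use assms(1) in simp)
  finally show "(LINT x|dA. g x) = (1/pi) *\<^sub>R (LINT x|lborel. G x)" .
  have "integrable dA g \<longleftrightarrow> integrable dA G"
    by (rule Bochner_Integration.integrable_cong) (simp_all add: assms(2))
  also have "\<dots> \<longleftrightarrow> integrable (lebesgue_on unit_disk) (\<lambda>x. (1/pi) *\<^sub>R G x)"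
    unfolding dA_def by (rule integrable_density) (use Gm in auto)
  also have "\<dots> \<longleftrightarrow> integrable (lebesgue_on unit_disk) G"
  proof
    assume "integrable (lebesgue_on unit_disk) (\<lambda>x. (1/pi) *\<^sub>R G x)"
    from integrable_scaleR_right[OF this, of pi] show "integrable (lebesgue_on unit_disk) G" by simp
  qed simp
  also have "\<dots> \<longleftrightarrow> integrable lebesgue (\<lambda>x. indicator unit_disk x *\<^sub>R G x)"
    by (rule integrable_restrict_space) simp
  also have "\<dots> \<longleftrightarrow> integrable lborel G"
    using assms(1) by (simp add: eqG integrable_completion)
  finally show "integrable dA g \<longleftrightarrow> integrable lborel G" .
qed

lemma borel_measurable_cut_disk:
  fixes f :: "complex \<Rightarrow> 'a::real_normed_vector"
  assumes "continuous_on unit_disk f"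
  shows "(\<lambda>x. if x \<in> unit_disk then f x else 0) \<in> borel_measurable borel"
proof -
  have "(\<lambda>x. indicator unit_disk x *\<^sub>R f x) \<in> borel_measurable borel"
    by (rule borel_measurable_continuous_on_indicator) (use assms in auto)
  then show ?thesis by (rule measurable_cong[THEN iffD1, rotated]) auto
qed

section \<open>Compact support in the disk and vanishing integrals of derivatives\<close>

definition vanish :: "(complex \<Rightarrow> 'a::zero) \<Rightarrow> bool" where
  "vanish f \<longleftrightarrow> (\<exists>R<1. \<forall>x\<in>unit_disk. R < norm x \<longrightarrow> f x = 0)"

lemma vanishI: "R < 1 \<Longrightarrow> (\<And>x. x \<in> unit_disk \<Longrightarrow> R < norm x \<Longrightarrow> f x = 0) \<Longrightarrow> vanish f"
  by (auto simp: vanish_def)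

lemma vanish_bounded:
  fixes f :: "complex \<Rightarrow> 'a::real_normed_vector"
  assumes "continuous_on unit_disk f" "vanish f"
  obtains M where "0 \<le> M" "\<And>x. x \<in> unit_disk \<Longrightarrow> norm (f x) \<le> M"
proof -
  obtain R where R: "R < 1" "\<And>x. x \<in> unit_disk \<Longrightarrow> R < norm x \<Longrightarrow> f x = 0"
    using assms(2) by (auto simp: vanish_def)
  have "compact (f ` cball 0 R)"
    by (rule compact_continuous_image) (use R(1) in \<open>auto intro: continuous_on_subset[OF assms(1)]\<close>)
  then obtain M where M: "\<And>x. x \<in> cball 0 R \<Longrightarrow> norm (f x) \<le> M"
    by (meson bounded_iff compact_imp_bounded imageI)
  have "norm (f x) \<le> max 0 M" if "x \<in> unit_disk" for x
    using M[of x] R(2)[OF that] by (cases "R < norm x") auto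
  then show ?thesis using that[of "max 0 M"] by auto
qed

lemma vanish_integrable:
  fixes f :: "complex \<Rightarrow> 'a::{banach,second_countable_topology}"
  assumes "continuous_on unit_disk f" "vanish f"
  shows "integrable dA f"
proof -
  obtain M where M: "\<And>x. x \<in> unit_disk \<Longrightarrow> norm (f x) \<le> M"
    using vanish_bounded[OF assms] by blast
  show ?thesis
    by (rule dA.integrable_const_bound[where B=M])
       (use M continuous_imp_measurable_dA[OF assms(1)] in auto)
qed

lemma wirtinger_vanish:
  assumes "Ck 1 unit_disk f" "vanish f"
  shows "vanish (dz f)" "vanish (dzb f)"
proof -
  obtain R where R: "R < 1" "\<And>x. x \<in> unit_disk \<Longrightarrow> R < norm x \<Longrightarrow> f x = 0"
    using assms(2) by (auto simp: vanish_def)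
  have "dz f x = 0 \<and> dzb f x = 0" if "x \<in> unit_disk" "R < norm x" for x
  proof -
    have "has_wirtinger f 0 0 x"
    proof (rule has_wirtinger_transform[OF has_wirtinger_const[of 0]])
      show "open (unit_disk \<inter> {x. R < norm x})"
        by (intro open_Int open_ball open_Collect_less continuous_intros)
    qed (use that R in auto)
    then show ?thesis using has_wirtinger_imp by blast
  qed
  then show "vanish (dz f)" "vanish (dzb f)" using R(1) by (auto simp: vanish_def)
qed

text \<open>Translation invariance takes the place of the divergence theorem: the integral of a
  difference quotient of a compactly supported function is 0, and dominated convergence passes this
  to every directional derivative. Two directions separate \<open>dz\<close> from
  \<open>dzb\<close>.\<close>

lemma integral_wirtinger_eq_0:
  assumes f: "Ck 1 unit_disk f" "vanish f"
  shows "(LINT x|dA. dz f x) = 0" "(LINT x|dA. dzb f x) = 0"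
proof -
  obtain R where R: "R < 1" "\<And>x. x \<in> unit_disk \<Longrightarrow> R < norm x \<Longrightarrow> f x = 0"
    using f(2) by (auto simp: vanish_def)
  have cont: "continuous_on unit_disk (dz f)" "continuous_on unit_disk (dzb f)"
    using f(1) by auto
  have van: "vanish (dz f)" "vanish (dzb f)" using wirtinger_vanish f by auto
  define F where "F x = (if x \<in> unit_disk then f x else 0)" for x
  define A where "A x = (if x \<in> unit_disk then dz f x else 0)" for x
  define B where "B x = (if x \<in> unit_disk then dzb f x else 0)" for x
  have W: "has_wirtinger F (A x) (B x) x" for x
  proof (cases "x \<in> unit_disk")
    case True
    have "has_wirtinger f (dz f x) (dzb f x) x" using Ck_SucE(1)[of 0 unit_disk f x] f(1) True by (simp del: Ck.simps)
    then show ?thesis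
      unfolding A_def B_def using True
      by (simp only: if_True, rule_tac has_wirtinger_transform[where f=f and U=unit_disk]) (auto simp: F_def)
  next
    case False
    have "has_wirtinger F 0 0 x"
    proof (rule has_wirtinger_transform[OF has_wirtinger_const[of 0]])
      show "open {x::complex. R < norm x}" by (intro open_Collect_less continuous_intros)
      show "x \<in> {x. R < norm x}" using False R(1) by simp
    qed (use R in \<open>auto simp: F_def\<close>)
    then show ?thesis using False by (simp add: A_def B_def)
  qed
  obtain M1 where M1: "0 \<le> M1" "\<And>x. x \<in> unit_disk \<Longrightarrow> norm (dz f x) \<le> M1"
    using vanish_bounded[OF cont(1) van(1)] by blast
  obtain M2 where M2: "0 \<le> M2" "\<And>x. x \<in> unit_disk \<Longrightarrow> norm (dzb f x) \<le> M2"
    using vanish_bounded[OF cont(2) van(2)] by blast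
  define M where "M = M1 + M2"
  have D: "(F has_derivative (\<lambda>t. A x * t + B x * cnj t)) (at x)" for x
    using W by (simp add: has_wirtinger_def)
  \<comment> \<open>The extension by zero is differentiable on the whole plane with bounded
    derivative. The resulting global Lipschitz constant will dominate the difference
    quotients.\<close>
  have lip: "norm (F x - F y) \<le> M * norm (x - y)" for x y
  proof (rule differentiable_bound[where S=UNIV and f'="\<lambda>x t. A x * t + B x * cnj t"])
    fix x show "onorm (\<lambda>t. A x * t + B x * cnj t) \<le> M"
    proof (rule onorm_le)
      fix t
      have "norm (A x) \<le> M1" "norm (B x) \<le> M2" using M1 M2 by (auto simp: A_def B_def)
      then have "norm (A x * t) \<le> M1 * norm t" "norm (B x * cnj t) \<le> M2 * norm t"
        by (auto simp: norm_mult mult_right_mono)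
      then show "norm (A x * t + B x * cnj t) \<le> M * norm t"
        using norm_triangle_ineq[of "A x * t" "B x * cnj t"] by (simp add: M_def algebra_simps)
    qed
  qed (use D in auto)
  have contF: "continuous_on UNIV F"
    using D by (meson continuous_at_imp_continuous_on has_derivative_continuous)
  have Fm: "F \<in> borel_measurable borel" using contF by (rule borel_measurable_continuous_onI)
  have Am: "A \<in> borel_measurable borel" and Bm: "B \<in> borel_measurable borel"
    using borel_measurable_cut_disk[OF cont(1)] borel_measurable_cut_disk[OF cont(2)]
    unfolding A_def[abs_def] B_def[abs_def] by auto
  have Fint: "integrable lborel F"
    using integral_dA_lborel(2)[of F f] vanish_integrable[OF Ck_continuous[OF f(1)] f(2)] Fm by (simp add: F_def)
  have Aint: "integrable lborel A" and Bint: "integrable lborel B"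
    using integral_dA_lborel(2)[of A "dz f"] integral_dA_lborel(2)[of B "dzb f"]
      vanish_integrable[OF cont(1) van(1)] vanish_integrable[OF cont(2) van(2)] Am Bm
    by (simp_all add: A_def B_def)
  have key: "(LINT x|lborel. A x * t + B x * cnj t) = 0" if t: "norm t = 1" for t
  proof -
    define s where "s n = complex_of_real (1 / real (Suc n)) * t" for n
    define g where "g n x = real (Suc n) *\<^sub>R (F (s n + x) - F x)" for n x
    have ns: "norm (s n) = 1 / real (Suc n)" for n
      by (simp only: s_def norm_mult norm_of_real t) simp
    have shift: "integrable lborel (\<lambda>x. F (c + x))" "(LINT x|lborel. F (c + x)) = (LINT x|lborel. F x)" for c
    proof -
      have *: "distr lborel borel ((+) c) = (lborel :: complex measure)" by (rule lborel_distr_plus)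
      have "integrable (distr lborel borel ((+) c)) F" using Fint by (simp add: *)
      then show "integrable lborel (\<lambda>x. F (c + x))"
        using integrable_distr_eq[of "(+) c" lborel borel F] Fm by simp
      have "(LINT x|distr lborel borel ((+) c). F x) = (LINT x|lborel. F (c + x))"
        by (rule integral_distr) (use Fm in auto)
      then show "(LINT x|lborel. F (c + x)) = (LINT x|lborel. F x)" by (simp add: *)
    qed
    have g0: "(LINT x|lborel. g n x) = 0" for n
      unfolding g_def using shift Fint by simp
    have lim: "(\<lambda>n. g n x) \<longlonglongrightarrow> A x * t + B x * cnj t" for x
    proof -
      have "((\<lambda>h. (F (x + h *\<^sub>R t) - F x) /\<^sub>R h) \<longlongrightarrow> A x * t + B x * cnj t) (at 0)"
      proof -
        have "((\<lambda>h::real. F (x + h *\<^sub>R t)) has_derivative (\<lambda>h. A x * (h *\<^sub>R t) + B x * cnj (h *\<^sub>R t))) (at 0)"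
          by (rule has_derivative_compose[where g=F and f="\<lambda>h. x + h *\<^sub>R t"])
             (use D[of x] in \<open>auto intro!: derivative_eq_intros\<close>)
        then have "((\<lambda>h::real. F (x + h *\<^sub>R t)) has_vector_derivative (A x * t + B x * cnj t)) (at 0)"
          unfolding has_vector_derivative_def by (rule has_derivative_eq_rhs) (auto simp: scaleR_add_right)
        then have "((\<lambda>h. norm ((F (x + h *\<^sub>R t) - F x - h *\<^sub>R (A x * t + B x * cnj t)) /\<^sub>R \<bar>h\<bar>)) \<longlongrightarrow> 0) (at 0)"
          by (intro tendsto_norm_zero) (simp add: has_vector_derivative_def has_derivative_within inverse_eq_divide diff_diff_eq)
        then have "((\<lambda>h. norm ((F (x + h *\<^sub>R t) - F x) /\<^sub>R h - (A x * t + B x * cnj t))) \<longlongrightarrow> 0) (at 0)"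
        proof (rule Lim_transform_eventually)
          show "\<forall>\<^sub>F h in at 0. norm ((F (x + h *\<^sub>R t) - F x - h *\<^sub>R (A x * t + B x * cnj t)) /\<^sub>R \<bar>h\<bar>)
              = norm ((F (x + h *\<^sub>R t) - F x) /\<^sub>R h - (A x * t + B x * cnj t))"
            unfolding eventually_at_filter
          proof (intro always_eventually allI impI)
            fix h :: real assume "h \<noteq> 0"
            then have "(F (x + h *\<^sub>R t) - F x) /\<^sub>R h - (A x * t + B x * cnj t) = (F (x + h *\<^sub>R t) - F x - h *\<^sub>R (A x * t + B x * cnj t)) /\<^sub>R h"
              by (simp add: scaleR_diff_right)
            then show "norm ((F (x + h *\<^sub>R t) - F x - h *\<^sub>R (A x * t + B x * cnj t)) /\<^sub>R \<bar>h\<bar>)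
              = norm ((F (x + h *\<^sub>R t) - F x) /\<^sub>R h - (A x * t + B x * cnj t))"
              by (simp only: norm_scaleR) simp
          qed
        qed
        then show ?thesis by (simp only: tendsto_norm_zero_iff LIM_zero_iff)
      qed
      moreover have "filterlim (\<lambda>n. 1 / real (Suc n)) (at 0) sequentially"
        unfolding filterlim_at using LIMSEQ_inverse_real_of_nat by (simp add: inverse_eq_divide)
      ultimately have "(\<lambda>n. (F (x + (1 / real (Suc n)) *\<^sub>R t) - F x) /\<^sub>R (1 / real (Suc n))) \<longlonglongrightarrow> A x * t + B x * cnj t"
        by (rule filterlim_compose)
      then show ?thesis by (simp add: g_def s_def scaleR_conv_of_real add.commute)
    qed
    \<comment> \<open>The shifts \<open>s n\<close> have norm at most 1, so all difference quotients
      are supported in one disk of radius 2, and the dominating function is integrable.\<close>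
    have bnd: "norm (g n x) \<le> indicator (cball 0 2) x *\<^sub>R M" for n x
    proof (cases "x \<in> cball 0 2")
      case True
      have "norm (F (s n + x) - F x) \<le> M * norm (s n)" using lip[of "s n + x" x] by simp
      then have "real (Suc n) * norm (F (s n + x) - F x) \<le> real (Suc n) * (M * norm (s n))"
        by (rule mult_left_mono) simp
      also have "\<dots> = M" by (simp add: ns)
      finally show ?thesis using True by (simp add: g_def)
    next
      case False
      have "norm (s n) \<le> 1" by (simp add: ns)
      moreover have "norm x \<le> norm (s n + x) + norm (s n)"
        using norm_triangle_ineq4[of "s n + x" "s n"] by simp
      ultimately have "s n + x \<notin> unit_disk" "x \<notin> unit_disk" using False by auto
      then show ?thesis using False by (simp add: g_def F_def)
    qed
    have "(\<lambda>n. LINT x|lborel. g n x) \<longlonglongrightarrow> (LINT x|lborel. A x * t + B x * cnj t)"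
    proof (rule integral_dominated_convergence[where w="\<lambda>x. indicator (cball 0 2) x *\<^sub>R M"])
      show "(\<lambda>x. A x * t + B x * cnj t) \<in> borel_measurable lborel" using Am Bm by simp
      show "g n \<in> borel_measurable lborel" for n unfolding g_def using Fm by simp
      show "integrable lborel (\<lambda>x::complex. indicator (cball 0 2) x *\<^sub>R M)"
        by (rule integrable_scaleR_left) (auto intro!: integrable_real_indicator emeasure_bounded_finite)
    qed (use lim bnd in auto)
    then show ?thesis using g0 LIMSEQ_unique[OF _ tendsto_const[of 0]] by simp
  qed
  \<comment> \<open>The direction 1 gives the sum of the two integrals, the direction \<i> gives
    \<i> times their difference.\<close>
  have "(LINT x|lborel. A x) + (LINT x|lborel. B x) = 0"
    using key[of 1] Aint Bint by simp
  moreover have "(LINT x|lborel. A x) * \<i> - (LINT x|lborel. B x) * \<i> = 0"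
    using key[of \<i>] Aint Bint by simp
  ultimately have "(LINT x|lborel. A x) = 0" "(LINT x|lborel. B x) = 0"
    by (simp_all add: algebra_simps complex_eq_iff)
  then show "(LINT x|dA. dz f x) = 0" "(LINT x|dA. dzb f x) = 0"
    using integral_dA_lborel(1)[of A "dz f"] integral_dA_lborel(1)[of B "dzb f"] Am Bm
    by (simp_all add: A_def B_def)
qed

lemma vanish_near:
  assumes "norm w + r < 1" "\<And>x. x \<in> unit_disk \<Longrightarrow> r \<le> norm (x - w) \<Longrightarrow> f x = 0"
  shows "vanish f"
proof (rule vanishI[OF assms(1)])
  fix x :: complex assume x: "x \<in> unit_disk" "norm w + r < norm x"
  have "norm x \<le> norm (x - w) + norm w" using norm_triangle_ineq[of "x - w" w] by simp
  with x show "f x = 0" by (intro assms(2)) auto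
qed

lemma vanish_mult_left: "vanish f \<Longrightarrow> vanish (\<lambda>x. g x * f x :: 'a::mult_zero)"
  by (force simp: vanish_def)

lemma vanish_mult_right: "vanish f \<Longrightarrow> vanish (\<lambda>x. f x * g x :: 'a::mult_zero)"
  by (force simp: vanish_def)

lemma vanish_comp: "vanish f \<Longrightarrow> h 0 = 0 \<Longrightarrow> vanish (\<lambda>x. h (f x))"
  by (force simp: vanish_def)

lemma vanish_add:
  assumes "vanish f" "vanish g"
  shows "vanish (\<lambda>x. f x + g x :: 'a::monoid_add)"
proof -
  obtain R S where "R < 1" "\<forall>x\<in>unit_disk. R < norm x \<longrightarrow> f x = 0"
    and "S < 1" "\<forall>x\<in>unit_disk. S < norm x \<longrightarrow> g x = 0"
    using assms by (auto simp: vanish_def)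
  then show ?thesis by (intro vanishI[of "max R S"]) auto
qed

section \<open>Mollifiers and integration by parts\<close>

text \<open>The cube gives two derivatives, the factor \<open>1 / r\<^sup>2\<close> makes the total
  mass independent of the radius, and the factor 4 gives
  \<open>dzb (bump ^ 4) = - (z - w) * chi\<close>.\<close>

definition chi :: "complex \<Rightarrow> real \<Rightarrow> complex \<Rightarrow> real" where
  "chi w r z = 4 * bump w r z ^ 3 / r\<^sup>2"

text \<open>Away from \<open>w\<close>, \<open>bump ^ 4 / (z - w)\<close> is a d-bar primitive of
  \<open>- chi\<close>, singular at \<open>w\<close>. Subtracting two radii removes the pole, so a
  difference of mollifiers becomes the d-bar derivative of a compactly supported function.\<close>

definition chi_primitive :: "complex \<Rightarrow> real \<Rightarrow> real \<Rightarrow> complex \<Rightarrow> complex" where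
  "chi_primitive w r s z = of_real (bump w r z ^ 4 - bump w s z ^ 4) / (z - w)"

lemma continuous_on_chi[continuous_intros]: "continuous_on U (chi w r)"
  unfolding chi_def divide_inverse by (intro continuous_intros)

lemma chi_nonneg: "0 \<le> chi w r z"
  by (simp add: chi_def bump_bounds)

lemma chi_eq_0: "0 < r \<Longrightarrow> r \<le> norm (z - w) \<Longrightarrow> chi w r z = 0"
  by (simp add: chi_def bump_eq_0)

lemma chi_le: "0 < r \<Longrightarrow> chi w r z \<le> 4 / r\<^sup>2"
  using power_le_one[OF bump_bounds, of w r z 3] by (simp add: chi_def divide_right_mono)

lemma vanish_chi: "0 < r \<Longrightarrow> norm w + r < 1 \<Longrightarrow> vanish (chi w r)"
  by (rule vanish_near) (auto intro: chi_eq_0)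

lemma vanish_ker: "0 < s \<Longrightarrow> s < r \<Longrightarrow> norm w + r < 1 \<Longrightarrow> vanish (chi_primitive w r s)"
  by (rule vanish_near) (auto simp: chi_primitive_def bump_eq_0)

text \<open>Away from \<open>w\<close> this is the product rule. Near \<open>w\<close> both bumps
  are polynomials in |z - w|^2 with value 1 at \<open>w\<close>, so the difference of their fourth
  powers is divisible by \<open>(z - w) * cnj (z - w)\<close>, and the quotient is smooth across
  \<open>w\<close>.\<close>

lemma wirtinger_ker:
  assumes s: "0 < s" "s < r"
  shows "has_wirtinger (chi_primitive w r s) (dz (chi_primitive w r s) z) (of_real (chi w s z - chi w r z)) z"
    and "open U \<Longrightarrow> Ck 2 U (chi_primitive w r s)"
proof -
  let ?b = "\<lambda>t z. complex_of_real (bump w t z ^ Suc (Suc 2))"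
  define E where "E z = of_real (1/s\<^sup>2 - 1/r\<^sup>2)
     * ((2 - of_real (1/r\<^sup>2 + 1/s\<^sup>2) * ((z - w) * cnj (z - w)))
     * ((1 - of_real (1/r\<^sup>2) * ((z - w) * cnj (z - w)))^2 + (1 - of_real (1/s\<^sup>2) * ((z - w) * cnj (z - w)))^2))" for z
  have ker1: "chi_primitive w r s z = (?b r z + (-1) * ?b s z) * inverse (z - w)" for z
    by (simp add: chi_primitive_def divide_inverse numeral_eq_Suc)
  have ker2: "chi_primitive w r s z = cnj (z - w) * E z" if "z \<in> ball w s" for z
  proof (cases "z = w")
    case True then show ?thesis by (simp add: chi_primitive_def)
  next
    case False
    define N where "N = (z - w) * cnj (z - w)"
    have N: "N = of_real ((norm (z - w))\<^sup>2)" unfolding N_def by (rule complex_norm_square[symmetric])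
    have d: "norm (z - w) < s" using that by (simp add: dist_norm norm_minus_commute)
    have b: "complex_of_real (bump w r z) = 1 - of_real (1/r\<^sup>2) * N" "complex_of_real (bump w s z) = 1 - of_real (1/s\<^sup>2) * N"
      using d s by (simp_all add: bump_eq N)
    \<comment> \<open>This is p^4 - q^4 = (p - q)(p + q)(p^2 + q^2), where p - q carries the factor
      \<open>N\<close> that cancels the pole.\<close>
    have alg: "(1 - a * N)^4 - (1 - b * N)^4 = N * ((b - a) * ((2 - (a + b) * N) * ((1 - a * N)^2 + (1 - b * N)^2)))" for a b :: complex
      by (simp add: power4_eq_xxxx power2_eq_square algebra_simps)
    have "of_real (bump w r z ^ 4 - bump w s z ^ 4) = N * E z"
      unfolding E_def N_def[symmetric] by (simp only: of_real_diff of_real_power of_real_add b alg)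
    then show ?thesis using False by (simp add: chi_primitive_def N_def)
  qed
  have CkE: "Ck k U E" if "open U" for k U
    unfolding E_def[abs_def]
    by (intro Ck_mult Ck_const Ck_diff Ck_power Ck_cnj Ck_add that Ck_holomorphic holomorphic_intros)
  have Ckid: "Ck k U (\<lambda>z. cnj (z - w))" if "open U" for k U
    by (intro Ck_cnj that Ck_holomorphic holomorphic_intros)
  show Ck: "Ck 2 U (chi_primitive w r s)" if U: "open U" for U
  proof -
    have 1: "open (U - {w})" "open (U \<inter> ball w s)" using U by auto
    have "Ck 2 (U - {w}) (\<lambda>z. (?b r z + (-1) * ?b s z) * inverse (z - w))"
    proof (intro Ck_mult Ck_add Ck_const 1)
      show "Ck 2 (U - {w}) (?b r)" "Ck 2 (U - {w}) (?b s)"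
        using Ck_le[OF Ck_bump[OF 1(1), where k=3], of 2] by (simp_all del: Ck.simps add: numeral_3_eq_3)
      show "Ck 2 (U - {w}) (\<lambda>z. inverse (z - w))"
        by (intro Ck_holomorphic 1 holomorphic_intros) auto
    qed
    then have a: "Ck 2 (U - {w}) (chi_primitive w r s)" by (simp only: ker1[abs_def])
    have b: "Ck 2 (U \<inter> ball w s) (chi_primitive w r s)"
      by (rule Ck_cong[OF 1(2) _ Ck_mult[OF 1(2) Ckid[OF 1(2)] CkE[OF 1(2)]]]) (use ker2 in auto)
    have "Ck 2 ((U - {w}) \<union> (U \<inter> ball w s)) (chi_primitive w r s)" by (rule Ck_Un[OF 1 a b])
    moreover have "U \<subseteq> (U - {w}) \<union> (U \<inter> ball w s)" using s by auto
    ultimately show ?thesis by (rule Ck_subset)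
  qed
  have "dzb (chi_primitive w r s) z = of_real (chi w s z - chi w r z)"
  proof (cases "z = w")
    \<comment> \<open>At the centre the derivative is \<open>E w\<close> = 4 / s^2 - 4 / r^2, the
      difference of the two mollifiers at their maximum.\<close>
    case True
    have "has_wirtinger (\<lambda>z. cnj (z - w)) (cnj 0) (cnj 1) z"
      by (intro has_wirtinger_cnj has_wirtinger_field_derivative) (rule derivative_eq_intros refl | simp)+
    moreover have "has_wirtinger E (dz E z) (dzb E z) z"
      using Ck_SucE(1)[OF CkE[of UNIV "Suc 0"], of z] by simp
    ultimately have "has_wirtinger (\<lambda>z. cnj (z - w) * E z) (cnj 0 * E z + cnj (z - w) * dz E z) (cnj 1 * E z + cnj (z - w) * dzb E z) z"
      by (rule has_wirtinger_mult)
    then have "has_wirtinger (chi_primitive w r s) (cnj 0 * E z + cnj (z - w) * dz E z) (cnj 1 * E z + cnj (z - w) * dzb E z) z"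
      by (rule has_wirtinger_transform[of _ _ _ _ "ball w s"]) (use True s ker2 in auto)
    from has_wirtinger_imp(3)[OF this] show ?thesis
      using True s by (simp add: E_def chi_def bump_def)
  next
    case False
    have i: "has_wirtinger (\<lambda>z. inverse (z - w)) (- inverse ((z - w) * (z - w))) 0 z"
      by (rule has_wirtinger_field_derivative) (use False in \<open>auto intro!: derivative_eq_intros simp: power2_eq_square\<close>)
    have "has_wirtinger (\<lambda>z. (?b r z + (-1) * ?b s z) * inverse (z - w))
      ((of_real (of_nat (Suc (Suc 2)) * bump w r z ^ Suc 2) * (- cnj (z - w) / r\<^sup>2) + (0 * ?b s z + (-1) * (of_real (of_nat (Suc (Suc 2)) * bump w s z ^ Suc 2) * (- cnj (z - w) / s\<^sup>2)))) * inverse (z - w)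
         + (?b r z + (-1) * ?b s z) * (- inverse ((z - w) * (z - w))))
      ((of_real (of_nat (Suc (Suc 2)) * bump w r z ^ Suc 2) * (- (z - w) / r\<^sup>2) + (0 * ?b s z + (-1) * (of_real (of_nat (Suc (Suc 2)) * bump w s z ^ Suc 2) * (- (z - w) / s\<^sup>2)))) * inverse (z - w)
         + (?b r z + (-1) * ?b s z) * 0) z"
      by (intro has_wirtinger_mult has_wirtinger_add has_wirtinger_const has_wirtinger_bump_power i)
    then have "has_wirtinger (chi_primitive w r s)
      ((of_real (of_nat (Suc (Suc 2)) * bump w r z ^ Suc 2) * (- cnj (z - w) / r\<^sup>2) + (0 * ?b s z + (-1) * (of_real (of_nat (Suc (Suc 2)) * bump w s z ^ Suc 2) * (- cnj (z - w) / s\<^sup>2)))) * inverse (z - w)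
         + (?b r z + (-1) * ?b s z) * (- inverse ((z - w) * (z - w))))
      ((of_real (of_nat (Suc (Suc 2)) * bump w r z ^ Suc 2) * (- (z - w) / r\<^sup>2) + (0 * ?b s z + (-1) * (of_real (of_nat (Suc (Suc 2)) * bump w s z ^ Suc 2) * (- (z - w) / s\<^sup>2)))) * inverse (z - w)
         + (?b r z + (-1) * ?b s z) * 0) z"
      by (simp only: ker1[abs_def])
    from has_wirtinger_imp(3)[OF this]
    have "dzb (chi_primitive w r s) z = ((4 * of_real (bump w r z ^ 3) * (- (z - w) / r\<^sup>2)) - (4 * of_real (bump w s z ^ 3) * (- (z - w) / s\<^sup>2))) / (z - w)"
      by (simp add: numeral_eq_Suc divide_inverse)
    also have "\<dots> = of_real (chi w s z - chi w r z)"
      using False s by (simp add: chi_def field_simps)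
    finally show ?thesis .
  qed
  moreover have "Ck (Suc 1) UNIV (chi_primitive w r s)" using Ck[OF open_UNIV] by (simp only: numeral_2_eq_2 One_nat_def)
  ultimately show "has_wirtinger (chi_primitive w r s) (dz (chi_primitive w r s) z) (of_real (chi w s z - chi w r z)) z"
    using Ck_SucE(1)[of 1 UNIV "chi_primitive w r s" z] by (simp del: Ck.simps)
qed

text \<open>In polar coordinates the value is 1. Keeping it symbolic avoids that computation, and
  positivity is enough for dividing by it.\<close>

definition bump_mass :: real where
  "bump_mass = (LINT x|lborel. chi 0 1 x) / pi"

text \<open>Under the substitution w + r x the Jacobian r^2 cancels the normalization of
  \<open>chi\<close>. A support touching the unit circle is allowed, since \<open>chi\<close> is
  already 0 on its boundary.\<close>

lemma integral_chi:
  assumes r: "0 < r" "norm w + r \<le> 1"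
  shows "(LINT x|dA. chi w r x) = bump_mass"
proof -
  have m: "chi v t \<in> borel_measurable borel" for v t
    by (rule borel_measurable_continuous_onI) (rule continuous_on_chi)
  have out: "chi w r x = 0" if "x \<notin> unit_disk" for x
  proof (rule chi_eq_0[OF r(1)])
    show "r \<le> norm (x - w)" using that r norm_triangle_ineq2[of x w] by simp
  qed
  have "(LINT x|dA. chi w r x) = (1/pi) *\<^sub>R (LINT x|lborel. chi w r x)"
    by (rule integral_dA_lborel(1)) (use m out in auto)
  also have "(LINT x|lborel. chi w r x) = (LINT x|density (distr lborel borel (\<lambda>x. w + r *\<^sub>R x)) (\<lambda>_. \<bar>r\<bar>^DIM(complex)). chi w r x)"
    using lborel_affine[of r w] r by simp
  also have "\<dots> = (LINT x|distr lborel borel (\<lambda>x. w + r *\<^sub>R x). \<bar>r\<bar>^DIM(complex) *\<^sub>R chi w r x)"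
    by (rule integral_density) (use m in auto)
  also have "\<dots> = (LINT x|lborel. \<bar>r\<bar>^DIM(complex) *\<^sub>R chi w r (w + r *\<^sub>R x))"
    by (rule integral_distr) (use m in auto)
  also have "(\<lambda>x. \<bar>r\<bar>^DIM(complex) *\<^sub>R chi w r (w + r *\<^sub>R x)) = chi 0 1"
    using r by (auto simp: fun_eq_iff chi_def bump_def power_mult_distrib)
  finally show ?thesis by (simp add: bump_mass_def)
qed

lemma bump_mass_pos: "0 < bump_mass"
proof -
  have m: "chi v t \<in> borel_measurable borel" for v t
    by (rule borel_measurable_continuous_onI) (rule continuous_on_chi)
  have i: "integrable lborel (chi 0 1)"
  proof (rule Bochner_Integration.integrable_bound[where f="\<lambda>x. indicator (cball 0 1) x *\<^sub>R (4::real)"])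
    show "integrable lborel (\<lambda>x::complex. indicator (cball 0 1) x *\<^sub>R (4::real))"
      by (rule integrable_scaleR_left) (auto intro!: integrable_real_indicator emeasure_bounded_finite)
    have "norm (chi 0 1 x) \<le> norm (indicator (cball 0 1) x *\<^sub>R (4::real))" for x
      using chi_le[of 1 0 x] chi_nonneg[of 0 1 x] chi_eq_0[of 1 x 0] by (auto split: split_indicator)
    then show "AE x in lborel. norm (chi 0 1 x) \<le> norm (indicator (cball 0 1) x *\<^sub>R (4::real))" by simp
  qed (use m in auto)
  \<comment> \<open>On the disk of radius 1/2 the bump is at least 3/4, and 4 (3/4)^3 =
    27/16.\<close>
  have i2: "integrable lborel (\<lambda>x::complex. indicator (cball 0 (1/2)) x *\<^sub>R (27/16::real))"
    by (rule integrable_scaleR_left) (auto intro!: integrable_real_indicator emeasure_bounded_finite)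
  have "(LINT x|lborel. indicator (cball (0::complex) (1/2)) x *\<^sub>R (27/16::real)) \<le> (LINT x|lborel. chi 0 1 x)"
  proof (rule integral_mono[OF i2 i])
    fix x :: complex
    show "indicator (cball 0 (1/2)) x *\<^sub>R (27/16) \<le> chi 0 1 x"
    proof (cases "x \<in> cball 0 (1/2)")
      case True
      then have "(norm x)^2 \<le> (1/2)^2" by (intro power_mono) auto
      then have "3/4 \<le> bump 0 1 x" by (simp add: bump_def power2_eq_square)
      then have "(3/4)^3 \<le> bump 0 1 x ^ 3" by (rule power_mono) simp
      then show ?thesis using True by (simp add: chi_def power3_eq_cube)
    qed (simp add: chi_nonneg)
  qed
  moreover have "(LINT x|lborel. indicator (cball (0::complex) (1/2)) x *\<^sub>R (27/16::real)) = measure lborel (cball (0::complex) (1/2)) * (27/16)"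
    using emeasure_bounded_finite[of "cball (0::complex) (1/2)"] by simp
  moreover have "0 < measure lborel (cball (0::complex) (1/2))"
    using content_cball_pos[of "1/2" "0::complex"] by simp
  ultimately have "0 < (LINT x|lborel. chi 0 1 x)" by linarith
  then show ?thesis by (simp add: bump_mass_def)
qed

lemma chi_tendsto:
  fixes u :: "complex \<Rightarrow> complex"
  assumes u: "continuous_on unit_disk u" and w: "w \<in> unit_disk"
    and r: "\<And>n. 0 < r n" "r \<longlonglongrightarrow> 0"
  shows "(\<lambda>n. LINT x|dA. u x * of_real (chi w (r n) x)) \<longlonglongrightarrow> of_real bump_mass * u w"
proof (rule LIMSEQ_I)
  fix e :: real assume e: "0 < e"
  \<comment> \<open>The factor 2 makes the final bound \<open>e' * bump_mass\<close> strictly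
    smaller than \<open>e\<close>.\<close>
  define e' where "e' = e / (2 * bump_mass)"
  have e': "0 < e'" using e bump_mass_pos by (simp add: e'_def)
  have "isCont u w" using u w by (simp add: continuous_on_eq_continuous_at)
  then obtain d where d: "0 < d" "\<And>x. dist x w < d \<Longrightarrow> dist (u x) (u w) < e'"
    using e' by (auto simp: continuous_at_eps_delta)
  have "\<forall>\<^sub>F n in sequentially. r n < min d (1 - norm w)"
    by (rule order_tendstoD(2)[OF r(2)]) (use d(1) w in auto)
  then obtain N where N: "\<And>n. n \<ge> N \<Longrightarrow> r n < min d (1 - norm w)"
    by (auto simp: eventually_sequentially)
  have "norm ((LINT x|dA. u x * of_real (chi w (r n) x)) - of_real bump_mass * u w) < e" if n: "n \<ge> N" for n
  proof -
    have rn: "0 < r n" "norm w + r n < 1" "r n < d" using N[OF n] r(1) by auto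
    have v: "vanish (chi w (r n))" using vanish_chi rn by auto
    have vc: "vanish (\<lambda>x. complex_of_real (chi w (r n) x))" by (rule vanish_comp[OF v]) simp
    have i: "integrable dA (\<lambda>x. g x * complex_of_real (chi w (r n) x))" if "continuous_on unit_disk g" for g
      by (rule vanish_integrable) (auto intro!: continuous_intros that vanish_mult_left vc)
    have ic: "integrable dA (chi w (r n))" by (rule vanish_integrable[OF continuous_on_chi v])
    have "(LINT x|dA. u w * complex_of_real (chi w (r n) x)) = of_real bump_mass * u w"
      using integral_chi[of "r n" w] rn by simp
    moreover have "(LINT x|dA. u x * of_real (chi w (r n) x) - u w * of_real (chi w (r n) x))
        = (LINT x|dA. u x * of_real (chi w (r n) x)) - (LINT x|dA. u w * of_real (chi w (r n) x))"
      by (rule Bochner_Integration.integral_diff) (use i[OF u] i[of "\<lambda>_. u w"] in auto)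
    ultimately have "(LINT x|dA. u x * of_real (chi w (r n) x)) - of_real bump_mass * u w
        = (LINT x|dA. u x * of_real (chi w (r n) x) - u w * of_real (chi w (r n) x))"
      by (simp only:)
    also have "norm \<dots> \<le> (LINT x|dA. e' * chi w (r n) x)"
    proof (rule order_trans[OF integral_norm_bound integral_mono])
      show "integrable dA (\<lambda>x. norm (u x * of_real (chi w (r n) x) - u w * of_real (chi w (r n) x)))"
        using i[OF u] i[of "\<lambda>_. u w"] by auto
      show "integrable dA (\<lambda>x. e' * chi w (r n) x)" using ic by simp
      fix x
      show "norm (u x * of_real (chi w (r n) x) - u w * of_real (chi w (r n) x)) \<le> e' * chi w (r n) x"
      proof (cases "norm (x - w) < r n")
        case True
        then have "norm (u x - u w) \<le> e'" using d(2)[of x] rn by (simp add: dist_norm)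
        then show ?thesis
          using chi_nonneg[of w "r n" x] by (simp add: left_diff_distrib[symmetric] norm_mult mult_right_mono)
      qed (use chi_eq_0 rn in auto)
    qed
    also have "\<dots> = e' * bump_mass" using integral_chi[of "r n" w] rn by simp
    also have "\<dots> < e" using e bump_mass_pos by (simp add: e'_def)
    finally show ?thesis .
  qed
  then show "\<exists>no. \<forall>n\<ge>no. norm ((LINT x|dA. u x * of_real (chi w (r n) x)) - of_real bump_mass * u w) < e"
    by blast
qed

lemma integration_by_parts:
  assumes f: "Ck 1 unit_disk f" and g: "Ck 1 unit_disk g" "vanish g"
  shows "(LINT x|dA. dz f x * g x) = - (LINT x|dA. f x * dz g x)"
    and "(LINT x|dA. dzb f x * g x) = - (LINT x|dA. f x * dzb g x)"
proof -
  have fg: "Ck 1 unit_disk (\<lambda>x. f x * g x)" "vanish (\<lambda>x. f x * g x)"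
    using f g by (auto intro!: Ck_mult vanish_mult_left simp del: Ck.simps)
  have W: "has_wirtinger (\<lambda>x. f x * g x) (dz f x * g x + f x * dz g x) (dzb f x * g x + f x * dzb g x) x" if "x \<in> unit_disk" for x
    using f g that by (intro has_wirtinger_mult has_wirtinger_dz_dzb) auto
  have cf: "continuous_on unit_disk f" "continuous_on unit_disk (dz f)" "continuous_on unit_disk (dzb f)"
    and cg: "continuous_on unit_disk g" "continuous_on unit_disk (dz g)" "continuous_on unit_disk (dzb g)"
    using f g Ck_continuous[OF f] Ck_continuous[OF g(1)] by auto
  note v = wirtinger_vanish[OF g]
  have i: "integrable dA (\<lambda>x. dz f x * g x)" "integrable dA (\<lambda>x. f x * dz g x)"
      "integrable dA (\<lambda>x. dzb f x * g x)" "integrable dA (\<lambda>x. f x * dzb g x)"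
    by (rule vanish_integrable; intro continuous_intros cf cg vanish_mult_left v g)+
  have "(LINT x|dA. dz f x * g x + f x * dz g x) = (LINT x|dA. dz (\<lambda>x. f x * g x) x)"
    by (rule Bochner_Integration.integral_cong) (simp_all add: has_wirtinger_imp[OF W])
  then show "(LINT x|dA. dz f x * g x) = - (LINT x|dA. f x * dz g x)"
    using i integral_wirtinger_eq_0[OF fg] by (simp add: eq_neg_iff_add_eq_0)
  have "(LINT x|dA. dzb f x * g x + f x * dzb g x) = (LINT x|dA. dzb (\<lambda>x. f x * g x) x)"
    by (rule Bochner_Integration.integral_cong) (simp_all add: has_wirtinger_imp[OF W])
  then show "(LINT x|dA. dzb f x * g x) = - (LINT x|dA. f x * dzb g x)"
    using i integral_wirtinger_eq_0[OF fg] by (simp add: eq_neg_iff_add_eq_0)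
qed

lemma has_wirtinger_bump_cube:
  fixes w r
  defines "b \<equiv> \<lambda>x. complex_of_real (bump w r x ^ 3)"
  shows "has_wirtinger b (of_real (3 * bump w r x ^ 2) * (- cnj (x - w) / r\<^sup>2)) (of_real (3 * bump w r x ^ 2) * (- (x - w) / r\<^sup>2)) x"
    and "dz (dzb b) x = dzb (dz b) x"
proof -
  show W: "has_wirtinger b (of_real (3 * bump w r x ^ 2) * (- cnj (x - w) / r\<^sup>2)) (of_real (3 * bump w r x ^ 2) * (- (x - w) / r\<^sup>2)) x" for x
    using has_wirtinger_bump_power[of w r 1 x] by (simp add: b_def numeral_eq_Suc)
  have l: "has_wirtinger (\<lambda>x. - (x - w) / of_real (r\<^sup>2)) (- 1 / of_real (r\<^sup>2)) 0 x"
    unfolding divide_inverse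
    by (rule has_wirtinger_field_derivative) (rule derivative_eq_intros refl | simp)+
  have l2: "has_wirtinger (\<lambda>x. - cnj (x - w) / of_real (r\<^sup>2)) 0 (- 1 / of_real (r\<^sup>2)) x"
    using has_wirtinger_cnj[OF l] by simp
  have q: "has_wirtinger (\<lambda>x. complex_of_real (3 * bump w r x ^ 2)) (of_real (6 * bump w r x) * (- cnj (x - w) / of_real (r\<^sup>2))) (of_real (6 * bump w r x) * (- (x - w) / of_real (r\<^sup>2))) x"
    using has_wirtinger_mult[OF has_wirtinger_const[of 3] has_wirtinger_bump_power[of w r 0 x]] by (simp add: numeral_2_eq_2 mult.assoc)
  have e: "dz b = (\<lambda>x. of_real (3 * bump w r x ^ 2) * (- cnj (x - w) / of_real (r\<^sup>2)))"
    "dzb b = (\<lambda>x. of_real (3 * bump w r x ^ 2) * (- (x - w) / of_real (r\<^sup>2)))"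
    using has_wirtinger_imp[OF W] by (auto simp: fun_eq_iff)
  show "dz (dzb b) x = dzb (dz b) x"
    unfolding e has_wirtinger_imp(2)[OF has_wirtinger_mult[OF q l]] has_wirtinger_imp(3)[OF has_wirtinger_mult[OF q l2]]
    by simp
qed

text \<open>Both derivatives are moved onto a bump function, which is explicitly smooth.\<close>

lemma dz_dzb_commute:
  assumes f: "Ck 2 unit_disk f" and w: "w \<in> unit_disk"
  shows "dzb (dz f) w = dz (dzb f) w"
proof -
  have f1: "Ck 1 unit_disk f" "Ck 1 unit_disk (dz f)" "Ck 1 unit_disk (dzb f)"
    using f Ck_le[OF f, of 1] by (simp_all add: numeral_2_eq_2)
  define u where "u x = dzb (dz f) x - dz (dzb f) x" for x
  have cu: "continuous_on unit_disk u"
    unfolding u_def using f by (intro continuous_intros) (auto simp: numeral_2_eq_2)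
  define r where "r n = (1 - norm w) / 2 * (1 / real (Suc n))" for n
  have r0: "0 < r n" for n using w by (simp add: r_def)
  have "r \<longlonglongrightarrow> (1 - norm w) / 2 * 0"
    unfolding r_def using LIMSEQ_inverse_real_of_nat by (intro tendsto_mult tendsto_const) (simp add: inverse_eq_divide)
  then have rlim: "r \<longlonglongrightarrow> 0" by simp
  have rle: "norm w + r n < 1" for n
  proof -
    have "r n \<le> (1 - norm w) / 2 * 1" unfolding r_def using w by (intro mult_left_mono) auto
    then show ?thesis using w by simp
  qed
  have "(LINT x|dA. u x * of_real (chi w (r n) x)) = 0" for n
  proof -
    define b where "b = (\<lambda>x. complex_of_real (bump w (r n) x ^ 3))"
    have b2: "Ck 2 unit_disk b" using Ck_bump[of unit_disk 2 w "r n"] by (simp add: b_def numeral_3_eq_3 numeral_2_eq_2 del: Ck.simps)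
    have b1: "Ck 1 unit_disk b" "Ck 1 unit_disk (dz b)" "Ck 1 unit_disk (dzb b)"
      using b2 Ck_le[OF b2, of 1] by (simp_all add: numeral_2_eq_2)
    have vb: "vanish b"
      by (rule vanish_near[OF rle[of n]]) (use r0[of n] in \<open>simp add: b_def bump_eq_0\<close>)
    note vb1 = wirtinger_vanish[OF b1(1) vb]
    have "(LINT x|dA. dzb (dz f) x * b x) = (LINT x|dA. f x * dz (dzb b) x)"
      using integration_by_parts(2)[OF f1(2) b1(1) vb] integration_by_parts(1)[OF f1(1) b1(3) vb1(2)] by simp
    also have "\<dots> = (LINT x|dA. f x * dzb (dz b) x)"
      unfolding b_def by (simp only: has_wirtinger_bump_cube(2))
    also have "\<dots> = (LINT x|dA. dz (dzb f) x * b x)"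
      using integration_by_parts(1)[OF f1(3) b1(1) vb] integration_by_parts(2)[OF f1(1) b1(2) vb1(1)] by simp
    finally have e: "(LINT x|dA. dzb (dz f) x * b x) = (LINT x|dA. dz (dzb f) x * b x)" .
    have i: "integrable dA (\<lambda>x. dzb (dz f) x * b x)" "integrable dA (\<lambda>x. dz (dzb f) x * b x)"
      by (rule vanish_integrable; use f in \<open>auto intro!: continuous_intros vanish_mult_left vb Ck_continuous[OF b1(1)] simp: numeral_2_eq_2\<close>)+
    have "(LINT x|dA. u x * of_real (chi w (r n) x)) = (LINT x|dA. of_real (4 / (r n)\<^sup>2) * (dzb (dz f) x * b x - dz (dzb f) x * b x))"
      by (rule Bochner_Integration.integral_cong) (use r0[of n] in \<open>simp_all add: u_def b_def chi_def field_simps\<close>)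
    also have "\<dots> = 0" using e i by simp
    finally show ?thesis .
  qed
  then have "of_real bump_mass * u w = 0"
    using chi_tendsto[OF cu w r0 rlim] by (simp only: LIMSEQ_const_iff)
  then show ?thesis using bump_mass_pos by (simp add: u_def)
qed

lemma borel_measurable_cnj [measurable (raw)]:
  "f \<in> borel_measurable M \<Longrightarrow> (\<lambda>x. cnj (f x)) \<in> borel_measurable M"
  by (rule measurable_compose[of f M borel cnj borel])
     (auto intro!: borel_measurable_continuous_onI continuous_intros)

lemma borel_measurable_complex_of_real [measurable (raw)]:
  "f \<in> borel_measurable M \<Longrightarrow> (\<lambda>x. complex_of_real (f x)) \<in> borel_measurable M"
  by (rule measurable_compose[of f M borel complex_of_real borel])
     (auto intro!: borel_measurable_continuous_onI continuous_intros)

section \<open>Weighted square-integrable functions\<close>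

locale disk_weight =
  fixes \<omega> :: "complex \<Rightarrow> real"
  assumes omega_cont: "continuous_on unit_disk \<omega>"
    and omega_pos: "\<And>x. x \<in> unit_disk \<Longrightarrow> 0 < \<omega> x"
    and omega_int: "integrable dA \<omega>"
begin

definition L2 :: "(complex \<Rightarrow> complex) \<Rightarrow> bool" where
  "L2 f \<longleftrightarrow> f \<in> borel_measurable dA \<and> integrable dA (\<lambda>x. (norm (f x))\<^sup>2 * \<omega> x)"

definition sq :: "(complex \<Rightarrow> complex) \<Rightarrow> real" where
  "sq f = (LINT x|dA. (norm (f x))\<^sup>2 * \<omega> x)"

definition nrm :: "(complex \<Rightarrow> complex) \<Rightarrow> real" where
  "nrm f = sqrt (sq f)"

abbreviation ip :: "(complex \<Rightarrow> complex) \<Rightarrow> (complex \<Rightarrow> complex) \<Rightarrow> complex" where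
  "ip \<equiv> A2_inner \<omega>"

lemma omega_meas [measurable]: "\<omega> \<in> borel_measurable dA"
  using continuous_imp_measurable_dA[OF omega_cont] .

lemma L2_meas: "L2 f \<Longrightarrow> f \<in> borel_measurable dA"
  by (simp add: L2_def)

text \<open>One pointwise domination delivers both membership in L^2 and the norm estimate.
  Monotonicity, bounded multipliers and sums are instances.\<close>

lemma L2_bound:
  assumes f: "f \<in> borel_measurable dA" and g: "L2 g" and h: "L2 h"
    and b: "\<And>x. x \<in> unit_disk \<Longrightarrow> (norm (f x))\<^sup>2 \<le> A * (norm (g x))\<^sup>2 + B * (norm (h x))\<^sup>2"
  shows "L2 f" "sq f \<le> A * sq g + B * sq h"
proof -
  have [measurable]: "f \<in> borel_measurable dA" by fact
  have i: "integrable dA (\<lambda>x. A * ((norm (g x))\<^sup>2 * \<omega> x) + B * ((norm (h x))\<^sup>2 * \<omega> x))"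
    using g h by (simp add: L2_def)
  have b': "(norm (f x))\<^sup>2 * \<omega> x \<le> A * ((norm (g x))\<^sup>2 * \<omega> x) + B * ((norm (h x))\<^sup>2 * \<omega> x)" if "x \<in> unit_disk" for x
    using mult_right_mono[OF b[OF that], of "\<omega> x"] omega_pos[OF that] by (simp add: algebra_simps)
  have fi: "integrable dA (\<lambda>x. (norm (f x))\<^sup>2 * \<omega> x)"
  proof (rule Bochner_Integration.integrable_bound[OF i])
    show "(\<lambda>x. (norm (f x))\<^sup>2 * \<omega> x) \<in> borel_measurable dA" by measurable
    have "norm ((norm (f x))\<^sup>2 * \<omega> x) \<le> norm (A * ((norm (g x))\<^sup>2 * \<omega> x) + B * ((norm (h x))\<^sup>2 * \<omega> x))" if "x \<in> unit_disk" for x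
      using b'[OF that] omega_pos[OF that] by (simp add: abs_mult)
    then show "AE x in dA. norm ((norm (f x))\<^sup>2 * \<omega> x) \<le> norm (A * ((norm (g x))\<^sup>2 * \<omega> x) + B * ((norm (h x))\<^sup>2 * \<omega> x))"
      by (intro AE_I2) auto
  qed
  then show "L2 f" using f by (simp add: L2_def)
  have "sq f \<le> (LINT x|dA. A * ((norm (g x))\<^sup>2 * \<omega> x) + B * ((norm (h x))\<^sup>2 * \<omega> x))"
    unfolding sq_def by (rule integral_mono[OF fi i]) (use b' in auto)
  also have "\<dots> = A * sq g + B * sq h"
    using g h by (simp add: L2_def sq_def)
  finally show "sq f \<le> A * sq g + B * sq h" .
qed

lemma L2_mono:
  assumes "f \<in> borel_measurable dA" "L2 g" "\<And>x. x \<in> unit_disk \<Longrightarrow> norm (f x) \<le> norm (g x)"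
  shows "L2 f" "sq f \<le> sq g" "nrm f \<le> nrm g"
proof -
  have b: "(norm (f x))\<^sup>2 \<le> 1 * (norm (g x))\<^sup>2 + 0 * (norm (g x))\<^sup>2" if "x \<in> unit_disk" for x
    using power_mono[OF assms(3)[OF that], of 2] by simp
  from L2_bound[OF assms(1) assms(2,2) b] show "L2 f" "sq f \<le> sq g" by auto
  then show "nrm f \<le> nrm g" by (simp add: nrm_def)
qed

lemma L2_mult_bounded:
  assumes "g \<in> borel_measurable dA" "L2 f" "\<And>x. x \<in> unit_disk \<Longrightarrow> norm (g x) \<le> M"
  shows "L2 (\<lambda>x. g x * f x)" "sq (\<lambda>x. g x * f x) \<le> M\<^sup>2 * sq f"
proof -
  have [measurable]: "g \<in> borel_measurable dA" "f \<in> borel_measurable dA" using assms by (auto simp: L2_meas)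
  have "(norm (g x * f x))\<^sup>2 \<le> M\<^sup>2 * (norm (f x))\<^sup>2 + 0 * (norm (f x))\<^sup>2" if "x \<in> unit_disk" for x
    using assms(3)[OF that] by (simp add: norm_mult power_mult_distrib mult_right_mono power_mono)
  from L2_bound[OF _ assms(2,2) this] show "L2 (\<lambda>x. g x * f x)" "sq (\<lambda>x. g x * f x) \<le> M\<^sup>2 * sq f" by auto
qed

lemma L2_add: assumes "L2 f" "L2 g" shows "L2 (\<lambda>x. f x + g x)"
proof (rule L2_bound(1)[OF _ assms])
  show "(\<lambda>x. f x + g x) \<in> borel_measurable dA" by (intro borel_measurable_add L2_meas assms)
  fix x
  have "(norm (f x + g x))\<^sup>2 \<le> (norm (f x) + norm (g x))\<^sup>2"
    by (intro power_mono norm_triangle_ineq) simp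
  also have "\<dots> \<le> 2 * (norm (f x))\<^sup>2 + 2 * (norm (g x))\<^sup>2"
    using sum_squares_bound[of "norm (f x)" "norm (g x)"] by (simp add: power2_sum)
  finally show "(norm (f x + g x))\<^sup>2 \<le> 2 * (norm (f x))\<^sup>2 + 2 * (norm (g x))\<^sup>2" .
qed

lemma L2_cmult: assumes "L2 f" shows "L2 (\<lambda>x. c * f x)"
  by (rule L2_mult_bounded(1)[OF _ assms, where M="norm c"]) auto

lemma L2_minus: "L2 f \<Longrightarrow> L2 (\<lambda>x. - f x)"
  using L2_cmult[of f "-1"] by simp

lemma L2_diff: "L2 f \<Longrightarrow> L2 g \<Longrightarrow> L2 (\<lambda>x. f x - g x)"
  using L2_add[of f "\<lambda>x. - g x"] L2_minus[of g] by simp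

lemma L2_vanish:
  assumes "continuous_on unit_disk f" "vanish f"
  shows "L2 f"
proof -
  obtain M where M: "\<And>x. x \<in> unit_disk \<Longrightarrow> norm (f x) \<le> M" using vanish_bounded[OF assms] by blast
  have one: "L2 (\<lambda>_. 1)" using omega_int by (simp add: L2_def)
  show ?thesis
    using L2_mult_bounded(1)[OF continuous_imp_measurable_dA[OF assms(1)] one M] by simp
qed

lemma sq_nonneg: "0 \<le> sq f"
  unfolding sq_def
  by (rule Bochner_Integration.integral_nonneg_AE) (auto intro!: AE_I2 mult_nonneg_nonneg less_imp_le[OF omega_pos])

lemma nrm_nonneg: "0 \<le> nrm f"
  by (simp add: nrm_def sq_nonneg)

lemma nrm_sq: "(nrm f)\<^sup>2 = sq f"
  by (simp add: nrm_def sq_nonneg)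

lemma sq_cong: "(\<And>x. x \<in> unit_disk \<Longrightarrow> norm (f x) = norm (g x)) \<Longrightarrow> sq f = sq g"
  unfolding sq_def by (rule Bochner_Integration.integral_cong) auto

lemma nrm_cong: "(\<And>x. x \<in> unit_disk \<Longrightarrow> norm (f x) = norm (g x)) \<Longrightarrow> nrm f = nrm g"
  unfolding nrm_def using sq_cong by metis

lemma nrm_cmult: "nrm (\<lambda>x. c * f x) = norm c * nrm f"
proof -
  have "sq (\<lambda>x. c * f x) = (norm c)\<^sup>2 * sq f"
    unfolding sq_def by (simp add: norm_mult power_mult_distrib mult.assoc)
  then show ?thesis by (simp add: nrm_def real_sqrt_mult)
qed

section \<open>Inner product, the Cauchy-Schwarz inequality and the norm\<close>

lemma prod_bound: "\<bar>a * b\<bar> \<le> (s * a\<^sup>2 + b\<^sup>2 / s) / 2" if "0 < s" for a b s :: real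
proof -
  have e: "(s * x - y)\<^sup>2 / s = s * x\<^sup>2 + y\<^sup>2 / s - 2 * (x * y)" for x y
    using that by (simp add: power2_eq_square field_simps)
  have "0 \<le> (s * \<bar>a\<bar> - \<bar>b\<bar>)\<^sup>2 / s" using that by simp
  then have "0 \<le> s * a\<^sup>2 + b\<^sup>2 / s - 2 * \<bar>a * b\<bar>" unfolding e by (simp add: abs_mult)
  then show ?thesis by simp
qed

lemma ip_integrable:
  assumes "L2 f" "L2 g"
  shows "integrable dA (\<lambda>x. norm (f x) * norm (g x) * \<omega> x)"
    and "integrable dA (\<lambda>x. f x * cnj (g x) * of_real (\<omega> x))"
proof -
  have [measurable]: "f \<in> borel_measurable dA" "g \<in> borel_measurable dA" using assms by (auto simp: L2_meas)
  have i: "integrable dA (\<lambda>x. ((norm (f x))\<^sup>2 * \<omega> x + (norm (g x))\<^sup>2 * \<omega> x))"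
    using assms by (simp add: L2_def)
  have b: "norm (f x) * norm (g x) * \<omega> x \<le> (norm (f x))\<^sup>2 * \<omega> x + (norm (g x))\<^sup>2 * \<omega> x" if "x \<in> unit_disk" for x
  proof -
    have "2 * (norm (f x) * norm (g x)) \<le> (norm (f x))\<^sup>2 + (norm (g x))\<^sup>2"
      using sum_squares_bound[of "norm (f x)" "norm (g x)"] by simp
    then have "norm (f x) * norm (g x) \<le> (norm (f x))\<^sup>2 + (norm (g x))\<^sup>2"
      using mult_nonneg_nonneg[OF norm_ge_zero norm_ge_zero, of "f x" "g x"] by linarith
    from mult_right_mono[OF this, of "\<omega> x"] omega_pos[OF that] show ?thesis by (simp add: algebra_simps)
  qed
  show "integrable dA (\<lambda>x. norm (f x) * norm (g x) * \<omega> x)"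
  proof (rule Bochner_Integration.integrable_bound[OF i])
    show "AE x in dA. norm (norm (f x) * norm (g x) * \<omega> x) \<le> norm ((norm (f x))\<^sup>2 * \<omega> x + (norm (g x))\<^sup>2 * \<omega> x)"
      using b omega_pos by (intro AE_I2) (force simp: abs_mult)
  qed measurable
  show "integrable dA (\<lambda>x. f x * cnj (g x) * of_real (\<omega> x))"
  proof (rule Bochner_Integration.integrable_bound[OF i])
    show "AE x in dA. norm (f x * cnj (g x) * of_real (\<omega> x)) \<le> norm ((norm (f x))\<^sup>2 * \<omega> x + (norm (g x))\<^sup>2 * \<omega> x)"
      using b omega_pos by (intro AE_I2) (force simp: norm_mult)
  qed measurable
qed

text \<open>The pointwise bound \<open>prod_bound\<close> is integrated and the free parameter
  \<open>s\<close> optimized. The integral of the moduli is estimated too, since the kernel bounds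
  need absolute values inside.\<close>

lemma Cauchy_Schwarz:
  assumes "L2 f" "L2 g"
  shows "(LINT x|dA. norm (f x) * norm (g x) * \<omega> x) \<le> nrm f * nrm g"
    and "norm (ip f g) \<le> nrm f * nrm g"
proof -
  let ?X = "LINT x|dA. norm (f x) * norm (g x) * \<omega> x"
  have X: "?X \<le> (s * sq f + sq g / s) / 2" if s: "0 < s" for s
  proof -
    have i: "integrable dA (\<lambda>x. (s * ((norm (f x))\<^sup>2 * \<omega> x) + ((norm (g x))\<^sup>2 * \<omega> x) / s) / 2)"
      using assms by (simp add: L2_def)
    have "?X \<le> (LINT x|dA. (s * ((norm (f x))\<^sup>2 * \<omega> x) + ((norm (g x))\<^sup>2 * \<omega> x) / s) / 2)"
    proof (rule integral_mono[OF ip_integrable(1)[OF assms] i])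
      fix x assume x: "x \<in> space dA"
      have "norm (f x) * norm (g x) \<le> (s * (norm (f x))\<^sup>2 + (norm (g x))\<^sup>2 / s) / 2"
        using prod_bound[OF s, of "norm (f x)" "norm (g x)"] by simp
      from mult_right_mono[OF this, of "\<omega> x"]
      show "norm (f x) * norm (g x) * \<omega> x \<le> (s * ((norm (f x))\<^sup>2 * \<omega> x) + ((norm (g x))\<^sup>2 * \<omega> x) / s) / 2"
        using omega_pos[of x] x by (simp add: algebra_simps)
    qed
    also have "\<dots> = (s * sq f + sq g / s) / 2"
      using assms by (simp add: L2_def sq_def)
    finally show ?thesis .
  qed
  \<comment> \<open>The optimal parameter is the quotient of the norms. Adding \<open>e\<close> to
    both keeps it meaningful when a norm is 0, and \<open>e\<close> tends to 0 afterwards.\<close>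
  have Y: "?X \<le> (nrm f + e) * (nrm g + e)" if e: "0 < e" for e
  proof -
    define a b where "a = nrm f + e" and "b = nrm g + e"
    have ab: "0 < a" "0 < b" "sq f \<le> a\<^sup>2" "sq g \<le> b\<^sup>2"
      using e nrm_nonneg[of f] nrm_nonneg[of g]
      by (auto simp: a_def b_def nrm_sq[symmetric] intro!: power_mono)
    have "?X \<le> ((b / a) * sq f + sq g / (b / a)) / 2" by (rule X) (use ab in simp)
    also have "\<dots> \<le> ((b / a) * a\<^sup>2 + b\<^sup>2 / (b / a)) / 2"
      using ab by (intro divide_right_mono add_mono mult_left_mono) auto
    also have "\<dots> = a * b" using ab by (simp add: power2_eq_square)
    finally show ?thesis by (simp add: a_def b_def)
  qed
  show 1: "?X \<le> nrm f * nrm g"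
  proof (rule tendsto_lowerbound)
    show "((\<lambda>e. (nrm f + e) * (nrm g + e)) \<longlongrightarrow> nrm f * nrm g) (at_right 0)"
      by (rule tendsto_eq_intros | simp)+
    show "\<forall>\<^sub>F e in at_right 0. ?X \<le> (nrm f + e) * (nrm g + e)"
      unfolding eventually_at_filter using Y by (intro always_eventually) auto
  qed simp
  have "norm (ip f g) \<le> (LINT x|dA. norm (f x * cnj (g x) * of_real (\<omega> x)))"
    unfolding A2_inner_def by (rule integral_norm_bound)
  also have "\<dots> = ?X"
    by (rule Bochner_Integration.integral_cong) (simp_all add: norm_mult abs_of_pos omega_pos)
  finally show "norm (ip f g) \<le> nrm f * nrm g" using 1 by simp
qed

lemma ip_add_left: "L2 f \<Longrightarrow> L2 g \<Longrightarrow> L2 h \<Longrightarrow> ip (\<lambda>x. f x + g x) h = ip f h + ip g h"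
  using ip_integrable(2)[of f h] ip_integrable(2)[of g h] by (simp add: A2_inner_def distrib_right)

lemma ip_add_right: "L2 f \<Longrightarrow> L2 g \<Longrightarrow> L2 h \<Longrightarrow> ip h (\<lambda>x. f x + g x) = ip h f + ip h g"
  using ip_integrable(2)[of h f] ip_integrable(2)[of h g] by (simp add: A2_inner_def distrib_left distrib_right)

lemma ip_cmult_left: "ip (\<lambda>x. c * f x) h = c * ip f h"
  by (simp add: A2_inner_def mult.assoc)

lemma ip_cmult_right: "ip h (\<lambda>x. c * f x) = cnj c * ip h f"
proof -
  have "(\<lambda>x. h x * cnj (c * f x) * of_real (\<omega> x)) = (\<lambda>x. cnj c * (h x * cnj (f x) * of_real (\<omega> x)))"
    by (auto simp: mult_ac)
  then show ?thesis by (simp add: A2_inner_def)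
qed

lemma ip_diff_left: "L2 f \<Longrightarrow> L2 g \<Longrightarrow> L2 h \<Longrightarrow> ip (\<lambda>x. f x - g x) h = ip f h - ip g h"
  using ip_add_left[of f "\<lambda>x. - 1 * g x" h] L2_minus[of g] ip_cmult_left[of "-1" g h] by simp

lemma ip_diff_right: "L2 f \<Longrightarrow> L2 g \<Longrightarrow> L2 h \<Longrightarrow> ip h (\<lambda>x. f x - g x) = ip h f - ip h g"
  using ip_add_right[of f "\<lambda>x. - 1 * g x" h] L2_minus[of g] ip_cmult_right[of h "-1" g] by simp

lemma ip_cnj: "cnj (ip f g) = ip g f"
proof -
  have "cnj (ip f g) = (LINT x|dA. cnj (f x * cnj (g x) * of_real (\<omega> x)))"
    unfolding A2_inner_def by (rule Bochner_Integration.integral_cnj[symmetric])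
  also have "\<dots> = ip g f" unfolding A2_inner_def by (simp add: mult.commute mult.left_commute)
  finally show ?thesis .
qed

lemma ip_self: "ip f f = of_real (sq f)"
proof -
  have "ip f f = (LINT x|dA. complex_of_real ((norm (f x))\<^sup>2 * \<omega> x))"
    unfolding A2_inner_def by (simp only: complex_norm_square of_real_mult)
  then show ?thesis by (simp only: sq_def integral_complex_of_real)
qed

lemma sq_add:
  assumes "L2 f" "L2 g"
  shows "sq (\<lambda>x. f x + g x) = sq f + 2 * Re (ip f g) + sq g"
proof -
  have "complex_of_real (sq (\<lambda>x. f x + g x)) = ip f f + ip f g + ip g f + ip g g"
    using assms by (simp add: ip_self[symmetric] ip_add_left ip_add_right L2_add)
  also have "ip g f = cnj (ip f g)" by (simp add: ip_cnj)
  finally have "complex_of_real (sq (\<lambda>x. f x + g x)) = of_real (sq f + 2 * Re (ip f g) + sq g)"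
    by (simp add: ip_self complex_eq_iff)
  then show ?thesis using of_real_eq_iff by blast
qed

lemma nrm_triangle:
  assumes "L2 f" "L2 g"
  shows "nrm (\<lambda>x. f x + g x) \<le> nrm f + nrm g"
proof (rule power2_le_imp_le)
  have "(nrm (\<lambda>x. f x + g x))\<^sup>2 = sq f + 2 * Re (ip f g) + sq g"
    by (simp add: nrm_sq sq_add assms)
  also have "\<dots> \<le> sq f + 2 * (nrm f * nrm g) + sq g"
    using Cauchy_Schwarz(2)[OF assms] complex_Re_le_cmod[of "ip f g"] by linarith
  also have "\<dots> = (nrm f + nrm g)\<^sup>2" by (simp add: power2_sum nrm_sq)
  finally show "(nrm (\<lambda>x. f x + g x))\<^sup>2 \<le> (nrm f + nrm g)\<^sup>2" .
qed (simp add: nrm_nonneg)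

lemma nrm_triangle_diff:
  assumes "L2 f" "L2 g"
  shows "nrm (\<lambda>x. f x - g x) \<le> nrm f + nrm g"
  using nrm_triangle[OF assms(1) L2_minus[OF assms(2)]] nrm_cmult[of "-1" g] by simp

lemma nrm_triangle_sub:
  assumes "L2 f" "L2 g"
  shows "nrm f \<le> nrm (\<lambda>x. f x - g x) + nrm g"
  using nrm_triangle[OF L2_diff[OF assms] assms(2)] by simp

end

section \<open>The basic inequality for the adjoint of the d-bar operator\<close>

locale exp_weight =
  fixes \<phi> \<omega> \<tau> :: "complex \<Rightarrow> real" and C c1 c2 :: real
  assumes phi_C2: "C_on 2 unit_disk \<phi>"
    and omega_eq: "\<And>x. x \<in> unit_disk \<Longrightarrow> \<omega> x = exp (- 2 * \<phi> x)"
    and omega_integrable: "integrable dA \<omega>"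
    and C_pos: "0 < C"
    and lap_pos: "\<And>x. x \<in> unit_disk \<Longrightarrow> 0 < laplacian \<phi> x"
    and lap_cmp: "\<And>x. x \<in> unit_disk \<Longrightarrow> inverse C * \<tau> x \<le> laplacian \<phi> x powr (- 1 / 2)"
      "\<And>x. x \<in> unit_disk \<Longrightarrow> laplacian \<phi> x powr (- 1 / 2) \<le> C * \<tau> x"
    and tau_pos: "\<And>x. x \<in> unit_disk \<Longrightarrow> 0 < \<tau> x"
    and tau_le: "\<And>x. x \<in> unit_disk \<Longrightarrow> \<tau> x \<le> c1 * (1 - norm x)"
    and tau_lip: "\<And>x y. x \<in> unit_disk \<Longrightarrow> y \<in> unit_disk \<Longrightarrow> \<bar>\<tau> x - \<tau> y\<bar> \<le> c2 * norm (x - y)"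
    and tau_E: "\<And>m::nat. 1 \<le> m \<Longrightarrow> \<exists>b t. 0 < b \<and> 0 < t \<and> t < 1 / real m \<and>
        (\<forall>x\<in>unit_disk. \<forall>y\<in>unit_disk. b * \<tau> y < norm (x - y) \<longrightarrow> \<tau> x \<le> \<tau> y + t * norm (x - y))"
begin

definition cphi :: "complex \<Rightarrow> complex" where
  "cphi x = of_real (\<phi> x)"

lemma cphi_C2: "Ck 2 unit_disk cphi"
  using Ck_of_real[OF open_ball phi_C2] by (simp add: cphi_def[abs_def])

lemma cphi_C1: "Ck 1 unit_disk cphi" "Ck 1 unit_disk (dz cphi)" "Ck 1 unit_disk (dzb cphi)"
  using cphi_C2 Ck_le[OF cphi_C2, of 1] by (simp_all add: numeral_2_eq_2)

lemma phi_cont: "continuous_on unit_disk \<phi>"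
proof -
  have "continuous_on unit_disk (\<lambda>x. Re (cphi x))"
    by (intro continuous_intros Ck_continuous[OF cphi_C2])
  then show ?thesis by (simp add: cphi_def)
qed

sublocale disk_weight \<omega>
proof
  have "continuous_on unit_disk (\<lambda>x. exp (- 2 * \<phi> x))"
    by (intro continuous_intros phi_cont)
  then show "continuous_on unit_disk \<omega>"
    using continuous_on_cong[of unit_disk unit_disk \<omega> "\<lambda>x. exp (- 2 * \<phi> x)"] omega_eq by simp
qed (auto simp: omega_eq omega_integrable)

lemma differentiable_disk:
  "f differentiable_on unit_disk \<Longrightarrow> x \<in> unit_disk \<Longrightarrow> f differentiable (at x)"
  unfolding differentiable_on_def by (metis at_within_open open_ball)

text \<open>Both facts express that \<phi> is real. The second is one quarter of the Laplacian once
  the two mixed second partials are known to agree.\<close>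

lemma dz_dzb_cphi:
  assumes x: "x \<in> unit_disk"
  shows "dzb cphi x = cnj (dz cphi x)" "dzb (dz cphi) x = of_real (laplacian \<phi> x / 4)"
proof -
  have d0: "\<phi> differentiable (at y)" if "y \<in> unit_disk" for y
    using phi_C2 that by (intro differentiable_disk) (auto simp: numeral_2_eq_2)
  have d1: "partial_deriv 1 \<phi> differentiable (at x)" "partial_deriv \<i> \<phi> differentiable (at x)"
    using phi_C2 x by (auto intro!: differentiable_disk simp: numeral_2_eq_2 Basis_complex_def)
  note W = has_wirtinger_of_real[OF d0, folded cphi_def]
  have W0: "has_wirtinger cphi (of_real (partial_deriv 1 \<phi> y) * (1/2) + of_real (partial_deriv \<i> \<phi> y) * (- \<i>/2))
      (of_real (partial_deriv 1 \<phi> y) * (1/2) + of_real (partial_deriv \<i> \<phi> y) * (\<i>/2)) y" if "y \<in> unit_disk" for y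
    using W[OF that] unfolding cphi_def[abs_def] .
  show "dzb cphi x = cnj (dz cphi x)"
    by (simp add: has_wirtinger_imp[OF W0[OF x]])
  let ?p = "\<lambda>a b. complex_of_real (partial_deriv a (partial_deriv b \<phi>) x)"
  note h = has_wirtinger_of_real[OF d1(1)] has_wirtinger_of_real[OF d1(2)]
  have A: "has_wirtinger (dz cphi) (dz (dz cphi) x)
     (((?p 1 1 * (1/2) + ?p \<i> 1 * (\<i>/2)) * (1/2) + of_real (partial_deriv 1 \<phi> x) * 0)
      + ((?p 1 \<i> * (1/2) + ?p \<i> \<i> * (\<i>/2)) * (- \<i>/2) + of_real (partial_deriv \<i> \<phi> x) * 0)) x"
  proof -
    note * = has_wirtinger_transform[OF has_wirtinger_add[OF has_wirtinger_mult[OF h(1) has_wirtinger_const[of "1/2"]]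
          has_wirtinger_mult[OF h(2) has_wirtinger_const[of "- \<i>/2"]]] open_ball x, of "dz cphi"]
    have **: "dz cphi y = of_real (partial_deriv 1 \<phi> y) * (1/2) + of_real (partial_deriv \<i> \<phi> y) * (- \<i>/2)" if "y \<in> unit_disk" for y
      using has_wirtinger_imp(2)[OF W0[OF that]] .
    from *[OF **] has_wirtinger_imp[OF *[OF **]] show ?thesis by simp
  qed
  have B: "dz (dzb cphi) x =
     (((?p 1 1 * (1/2) + ?p \<i> 1 * (- \<i>/2)) * (1/2) + of_real (partial_deriv 1 \<phi> x) * 0)
      + ((?p 1 \<i> * (1/2) + ?p \<i> \<i> * (- \<i>/2)) * (\<i>/2) + of_real (partial_deriv \<i> \<phi> x) * 0))"
  proof -
    note * = has_wirtinger_transform[OF has_wirtinger_add[OF has_wirtinger_mult[OF h(1) has_wirtinger_const[of "1/2"]]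
          has_wirtinger_mult[OF h(2) has_wirtinger_const[of "\<i>/2"]]] open_ball x, of "dzb cphi"]
    have **: "dzb cphi y = of_real (partial_deriv 1 \<phi> y) * (1/2) + of_real (partial_deriv \<i> \<phi> y) * (\<i>/2)" if "y \<in> unit_disk" for y
      using has_wirtinger_imp(3)[OF W0[OF that]] .
    from has_wirtinger_imp(2)[OF *[OF **]] show ?thesis by simp
  qed
  \<comment> \<open>The real parts of \<open>dzb (dz cphi)\<close> and \<open>dz (dzb cphi)\<close>
    coincide automatically; equality of the imaginary parts is the symmetry of the mixed
    partials.\<close>
  have "partial_deriv \<i> (partial_deriv 1 \<phi>) x = partial_deriv 1 (partial_deriv \<i> \<phi>) x"
    using dz_dzb_commute[OF cphi_C2 x] unfolding has_wirtinger_imp(3)[OF A] B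
    by (simp add: complex_eq_iff)
  then show "dzb (dz cphi) x = of_real (laplacian \<phi> x / 4)"
    unfolding has_wirtinger_imp(3)[OF A]
    by (simp add: laplacian_def Basis_complex_def complex_eq_iff)
qed

lemma lap_cont: "continuous_on unit_disk (laplacian \<phi>)"
proof -
  have "continuous_on unit_disk (\<lambda>x. 4 * Re (dzb (dz cphi) x))"
    using cphi_C1 by (intro continuous_intros) auto
  then show ?thesis by (rule continuous_on_eq) (simp add: dz_dzb_cphi(2))
qed

lemma lap_bounds:
  assumes x: "x \<in> unit_disk"
  shows "1 / (C\<^sup>2 * (\<tau> x)\<^sup>2) \<le> laplacian \<phi> x" "laplacian \<phi> x \<le> C\<^sup>2 / (\<tau> x)\<^sup>2"
proof -
  define l where "l = laplacian \<phi> x"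
  have l: "0 < l" using lap_pos[OF x] by (simp add: l_def)
  have p: "l powr (- 1 / 2) = 1 / sqrt l"
    using l by (simp add: powr_minus_divide powr_half_sqrt[symmetric])
  have a: "1 / sqrt l \<le> C * \<tau> x" "inverse C * \<tau> x \<le> 1 / sqrt l"
    using lap_cmp[OF x, folded l_def] unfolding p by auto
  have "(1 / sqrt l)\<^sup>2 \<le> (C * \<tau> x)\<^sup>2" by (rule power_mono[OF a(1)]) (use l in simp)
  then have "1 / l \<le> C\<^sup>2 * (\<tau> x)\<^sup>2" using l by (simp add: power_divide power_mult_distrib)
  then show "1 / (C\<^sup>2 * (\<tau> x)\<^sup>2) \<le> laplacian \<phi> x"
    using l C_pos tau_pos[OF x] by (simp add: l_def[symmetric] field_simps)
  have "(inverse C * \<tau> x)\<^sup>2 \<le> (1 / sqrt l)\<^sup>2" by (rule power_mono[OF a(2)]) (use C_pos tau_pos[OF x] in simp)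
  then have "(\<tau> x)\<^sup>2 / C\<^sup>2 \<le> 1 / l" using l by (simp add: power_divide power_mult_distrib divide_inverse power_inverse mult.commute)
  then show "laplacian \<phi> x \<le> C\<^sup>2 / (\<tau> x)\<^sup>2"
    using l C_pos tau_pos[OF x] by (simp add: l_def[symmetric] field_simps)
qed

lemma tau_cont: "continuous_on unit_disk \<tau>"
proof (rule lipschitz_on_continuous_on)
  show "\<bar>c2\<bar>-lipschitz_on unit_disk \<tau>"
  proof (rule lipschitz_onI)
    fix x y assume "x \<in> unit_disk" "y \<in> unit_disk"
    then have "\<bar>\<tau> x - \<tau> y\<bar> \<le> c2 * norm (x - y)" by (rule tau_lip)
    also have "\<dots> \<le> \<bar>c2\<bar> * norm (x - y)" by (intro mult_right_mono) auto
    finally show "dist (\<tau> x) (\<tau> y) \<le> \<bar>c2\<bar> * dist x y" by (simp add: dist_real_def dist_norm)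
  qed simp
qed

definition comega :: "complex \<Rightarrow> complex" where
  "comega x = of_real (\<omega> x)"

lemma wirtinger_comega:
  assumes x: "x \<in> unit_disk"
  shows "has_wirtinger comega (- 2 * dz cphi x * \<omega> x) (- 2 * cnj (dz cphi x) * \<omega> x) x"
proof -
  have "has_wirtinger (\<lambda>x. (- 2) * cphi x) (0 * cphi x + (- 2) * dz cphi x) (0 * cphi x + (- 2) * dzb cphi x) x"
    by (rule has_wirtinger_mult[OF has_wirtinger_const has_wirtinger_dz_dzb]) (use cphi_C1 x in auto)
  from has_wirtinger_compose[OF this DERIV_exp]
  have "has_wirtinger (\<lambda>x. exp ((- 2) * cphi x)) (exp ((- 2) * cphi x) * (0 * cphi x + (- 2) * dz cphi x)) (exp ((- 2) * cphi x) * (0 * cphi x + (- 2) * dzb cphi x)) x" .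
  moreover have e: "comega y = exp ((- 2) * cphi y)" if "y \<in> unit_disk" for y
    using that by (simp add: comega_def cphi_def omega_eq exp_of_real[symmetric])
  ultimately have "has_wirtinger comega (exp ((- 2) * cphi x) * (0 * cphi x + (- 2) * dz cphi x)) (exp ((- 2) * cphi x) * (0 * cphi x + (- 2) * dzb cphi x)) x"
    using x by (elim has_wirtinger_transform[where U=unit_disk]) auto
  moreover have "exp ((- 2) * cphi x) = \<omega> x" using e[OF x] by (simp add: comega_def)
  ultimately show ?thesis by (simp add: dz_dzb_cphi(1)[OF x] mult_ac)
qed

lemma comega_C2: "Ck 2 unit_disk comega"
proof (rule Ck_cong[OF open_ball])
  show "comega y = exp ((- 2) * cphi y)" if "y \<in> unit_disk" for y
    using that by (simp add: comega_def cphi_def omega_eq exp_of_real[symmetric])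
  show "Ck 2 unit_disk (\<lambda>y. exp ((- 2) * cphi y))"
    by (intro Ck_exp Ck_mult Ck_const cphi_C2 open_ball)
qed

text \<open>The adjoint of \<open>dzb\<close> with respect to the weight.\<close>

definition delta :: "(complex \<Rightarrow> complex) \<Rightarrow> complex \<Rightarrow> complex" where
  "delta a x = - dz a x + 2 * dz cphi x * a x"

text \<open>The order is recorded because it drops by one under \<open>delta\<close> and
  \<open>dzb\<close>: the basic identity consumes two derivatives, a pairing only one, and
  \<open>peak\<close> offers none.\<close>

definition test :: "nat \<Rightarrow> (complex \<Rightarrow> complex) \<Rightarrow> bool" where
  "test k a \<longleftrightarrow> Ck k unit_disk a \<and> vanish a"

lemma test_le: "test n a \<Longrightarrow> m \<le> n \<Longrightarrow> test m a"
  using Ck_le[of n unit_disk a m] by (auto simp: test_def)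

lemma test_mult: "test k a \<Longrightarrow> Ck k unit_disk g \<Longrightarrow> test k (\<lambda>x. g x * a x)"
  by (auto simp: test_def intro: Ck_mult vanish_mult_left)

lemma test_add: "test k a \<Longrightarrow> test k b \<Longrightarrow> test k (\<lambda>x. a x + b x)"
  by (auto simp: test_def intro: Ck_add vanish_add)

lemma test_dzb: "test 2 a \<Longrightarrow> test 1 (dzb a)"
  using Ck_le[of 2 unit_disk a 1] by (auto simp: test_def numeral_2_eq_2 wirtinger_vanish)

lemma test_L2: "test k a \<Longrightarrow> L2 a"
  by (auto simp: test_def intro: L2_vanish Ck_continuous)

lemma Ck1_wirtinger: "Ck 1 unit_disk f \<Longrightarrow> x \<in> unit_disk \<Longrightarrow> has_wirtinger f (dz f x) (dzb f x) x"
  using has_wirtinger_dz_dzb[of f x] by simp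

lemma test1_Ck1: "test k a \<Longrightarrow> 1 \<le> k \<Longrightarrow> Ck 1 unit_disk a"
  using Ck_le[of k unit_disk a 1] by (auto simp: test_def)

lemma delta_mult:
  assumes "test 1 a" "Ck 1 unit_disk g" "x \<in> unit_disk"
  shows "delta (\<lambda>x. g x * a x) x = g x * delta a x - dz g x * a x"
proof -
  have "dz (\<lambda>x. g x * a x) x = dz g x * a x + g x * dz a x"
    using has_wirtinger_imp(2)[OF has_wirtinger_mult[OF Ck1_wirtinger[OF assms(2,3)] Ck1_wirtinger[OF test1_Ck1[OF assms(1) order_refl] assms(3)]]] .
  then show ?thesis by (simp add: delta_def algebra_simps)
qed

lemma delta_add:
  assumes "test 1 a" "test 1 b" "x \<in> unit_disk"
  shows "delta (\<lambda>x. a x + c * b x) x = delta a x + c * delta b x"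
proof -
  have "dz (\<lambda>x. a x + c * b x) x = dz a x + (0 * b x + c * dz b x)"
    using has_wirtinger_imp(2)[OF has_wirtinger_add[OF Ck1_wirtinger[OF test1_Ck1[OF assms(1) order_refl] assms(3)]
      has_wirtinger_mult[OF has_wirtinger_const Ck1_wirtinger[OF test1_Ck1[OF assms(2) order_refl] assms(3)]]]] .
  then show ?thesis by (simp add: delta_def algebra_simps)
qed

lemma delta_test0: "test 1 a \<Longrightarrow> test 0 (delta a)"
proof -
  assume a: "test 1 a"
  then have 1: "Ck 1 unit_disk a" "vanish a" by (auto simp: test_def)
  have "vanish (\<lambda>x. - dz a x + 2 * dz cphi x * a x)"
    using wirtinger_vanish[OF 1] 1 by (intro vanish_add vanish_mult_left vanish_comp[where h=uminus]) auto
  moreover have "continuous_on unit_disk (\<lambda>x. - dz a x + 2 * dz cphi x * a x)"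
    using 1 Ck_continuous[OF 1(1)] Ck_continuous[OF cphi_C1(2)] by (intro continuous_intros) auto
  ultimately show ?thesis by (simp add: test_def delta_def[abs_def])
qed

lemma delta_test1: "test 2 a \<Longrightarrow> test 1 (delta a)"
proof -
  assume a: "test 2 a"
  have 1: "Ck 1 unit_disk a" "Ck 1 unit_disk (dz a)"
    using a test1_Ck1[OF a] by (auto simp: test_def numeral_2_eq_2)
  have "Ck 1 unit_disk (\<lambda>x. - dz a x + 2 * dz cphi x * a x)"
    by (intro Ck_add Ck_minus Ck_mult Ck_const 1 cphi_C1 open_ball)
  then show ?thesis using delta_test0[OF test_le[OF a]] by (simp add: test_def delta_def[abs_def])
qed

lemma delta_L2: "test 1 a \<Longrightarrow> L2 (delta a)"
  using delta_test0 test_L2[of 0] by simp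

text \<open>Differentiating the weight produces the factor -2 \<open>cnj (dz cphi)\<close>, exactly
  the zeroth-order term of \<open>delta\<close>. This is why \<open>delta\<close> is the
  adjoint.\<close>

lemma dzb_comega_mult:
  assumes "Ck 1 unit_disk a" "x \<in> unit_disk"
  shows "dzb (\<lambda>x. cnj (a x) * comega x) x = - cnj (delta a x) * comega x"
proof -
  have "dzb (\<lambda>x. cnj (a x) * comega x) x = cnj (dz a x) * comega x + cnj (a x) * (- 2 * cnj (dz cphi x) * \<omega> x)"
    using has_wirtinger_imp(3)[OF has_wirtinger_mult[OF has_wirtinger_cnj[OF Ck1_wirtinger[OF assms]] wirtinger_comega[OF assms(2)]]] .
  then show ?thesis by (simp add: delta_def comega_def algebra_simps)
qed

text \<open>Compact support is asked of \<open>a\<close> alone, so that \<open>f\<close> may be any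
  holomorphic function on the disk.\<close>

lemma ip_delta:
  assumes f: "Ck 1 unit_disk f" and a: "test 1 a"
  shows "ip f (delta a) = (LINT x|dA. dzb f x * cnj (a x) * of_real (\<omega> x))"
proof -
  have g: "Ck 1 unit_disk (\<lambda>x. cnj (a x) * comega x)" "vanish (\<lambda>x. cnj (a x) * comega x)"
    using a Ck_le[OF comega_C2, of 1]
    by (auto simp: test_def simp del: Ck.simps intro!: Ck_mult Ck_cnj vanish_mult_right vanish_comp[where h=cnj])
  have "ip f (delta a) = - (LINT x|dA. f x * dzb (\<lambda>x. cnj (a x) * comega x) x)"
    unfolding A2_inner_def Bochner_Integration.integral_minus[symmetric]
  proof (rule Bochner_Integration.integral_cong[OF refl])
    fix x assume "x \<in> space dA"
    then have x: "x \<in> unit_disk" by simp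
    show "f x * cnj (delta a x) * of_real (\<omega> x) = - (f x * dzb (\<lambda>x. cnj (a x) * comega x) x)"
      unfolding dzb_comega_mult[OF test1_Ck1[OF a order_refl] x] by (simp add: comega_def)
  qed
  also have "\<dots> = (LINT x|dA. dzb f x * (cnj (a x) * comega x))"
    using integration_by_parts(2)[OF f g] by simp
  finally show ?thesis by (simp add: comega_def mult.assoc)
qed

lemma holomorphic_orthogonal:
  assumes f: "f holomorphic_on unit_disk" and a: "test 1 a"
  shows "ip f (delta a) = 0"
proof -
  have "dzb f x = 0" if "x \<in> unit_disk" for x
    using has_wirtinger_imp(3)[OF has_wirtinger_field_derivative[OF holomorphic_derivI[OF f open_ball that]]] .
  then have "(LINT x|dA. dzb f x * cnj (a x) * of_real (\<omega> x)) = (LINT x|dA. 0)"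
    by (intro Bochner_Integration.integral_cong) auto
  then show ?thesis using ip_delta[OF Ck_holomorphic[OF open_ball f] a] by simp
qed

text \<open>The commutator of \<open>dzb\<close> and \<open>delta\<close> is multiplication by 2
  \<open>dzb (dz cphi)\<close>, half the Laplacian of \<phi>. Moving \<open>delta\<close> across the
  inner product twice turns this into an identity of norms, in which both terms on the right are
  nonnegative.\<close>

lemma basic_identity:
  assumes a: "test 2 a"
  shows "sq (delta a) = (LINT x|dA. laplacian \<phi> x / 2 * (norm (a x))\<^sup>2 * \<omega> x) + sq (dzb a)"
    and "integrable dA (\<lambda>x. laplacian \<phi> x / 2 * (norm (a x))\<^sup>2 * \<omega> x)"
proof -
  have a1: "test 1 a" using test_le[OF a] by simp
  have b: "test 1 (dzb a)" by (rule test_dzb[OF a])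
  have Cka: "Ck 1 unit_disk a" "Ck 1 unit_disk (dz a)" "Ck 1 unit_disk (dzb a)"
    using a test1_Ck1[OF a] by (auto simp: test_def numeral_2_eq_2)
  \<comment> \<open>The commutator formula; the second-order terms match by symmetry of the mixed
    derivatives of \<open>a\<close>.\<close>
  have pt: "dzb (delta a) x = delta (dzb a) x + of_real (laplacian \<phi> x / 2) * a x" if x: "x \<in> unit_disk" for x
  proof -
    have "has_wirtinger (\<lambda>x. (- 1) * dz a x + (2 * dz cphi x) * a x)
      ((0 * dz a x + (- 1) * dz (dz a) x) + ((0 * dz cphi x + 2 * dz (dz cphi) x) * a x + (2 * dz cphi x) * dz a x))
      ((0 * dz a x + (- 1) * dzb (dz a) x) + ((0 * dz cphi x + 2 * dzb (dz cphi) x) * a x + (2 * dz cphi x) * dzb a x)) x"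
      by (intro has_wirtinger_add has_wirtinger_mult has_wirtinger_const Ck1_wirtinger Cka cphi_C1 x)
    moreover have "(\<lambda>x. (- 1) * dz a x + (2 * dz cphi x) * a x) = delta a" by (auto simp: delta_def)
    ultimately have "dzb (delta a) x = (0 * dz a x + (- 1) * dzb (dz a) x) + ((0 * dz cphi x + 2 * dzb (dz cphi) x) * a x + (2 * dz cphi x) * dzb a x)"
      using has_wirtinger_imp(3) by simp
    also have "\<dots> = - dz (dzb a) x + 2 * dz cphi x * dzb a x + of_real (laplacian \<phi> x / 2) * a x"
    proof -
      have "2 * dzb (dz cphi) x = of_real (laplacian \<phi> x / 2)" unfolding dz_dzb_cphi(2)[OF x] by simp
      moreover have "dzb (dz a) x = dz (dzb a) x" using dz_dzb_commute[of a x] a x by (simp add: test_def del: Ck.simps)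
      ultimately show ?thesis by simp
    qed
    finally show ?thesis by (simp add: delta_def)
  qed
  have lc: "continuous_on unit_disk (\<lambda>x. of_real (laplacian \<phi> x) :: complex)"
    by (intro continuous_intros lap_cont)
  have ca: "continuous_on unit_disk a" "vanish a" using Ck_continuous[OF Cka(1)] a by (auto simp: test_def)
  have cw: "continuous_on unit_disk (\<lambda>x. complex_of_real (\<omega> x))" by (intro continuous_intros omega_cont)
  have i1: "integrable dA (\<lambda>x. delta (dzb a) x * cnj (a x) * of_real (\<omega> x))"
    by (rule ip_integrable(2)[OF delta_L2[OF b] test_L2[OF a]])
  have i2: "integrable dA (\<lambda>x. of_real (laplacian \<phi> x / 2) * (a x * cnj (a x)) * complex_of_real (\<omega> x))"
    using lc by (intro vanish_integrable continuous_intros ca cw vanish_mult_right vanish_mult_left) (auto simp: of_real_divide intro!: continuous_intros)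
  have e2: "of_real (laplacian \<phi> x / 2) * (a x * cnj (a x)) * complex_of_real (\<omega> x) = complex_of_real (laplacian \<phi> x / 2 * (norm (a x))\<^sup>2 * \<omega> x)" for x
    by (simp only: complex_norm_square[symmetric] of_real_mult of_real_power)
  show i3: "integrable dA (\<lambda>x. laplacian \<phi> x / 2 * (norm (a x))\<^sup>2 * \<omega> x)"
    using i2 unfolding e2 by (simp only: complex_of_real_integrable_eq)
  have "complex_of_real (sq (delta a)) = (LINT x|dA. dzb (delta a) x * cnj (a x) * of_real (\<omega> x))"
    using ip_delta[OF test1_Ck1[OF delta_test1[OF a]] a1] by (simp add: ip_self)
  also have "\<dots> = (LINT x|dA. delta (dzb a) x * cnj (a x) * of_real (\<omega> x) + of_real (laplacian \<phi> x / 2) * (a x * cnj (a x)) * complex_of_real (\<omega> x))"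
    by (rule Bochner_Integration.integral_cong) (simp_all add: pt algebra_simps)
  also have "\<dots> = ip (delta (dzb a)) a + (LINT x|dA. complex_of_real (laplacian \<phi> x / 2 * (norm (a x))\<^sup>2 * \<omega> x))"
    unfolding A2_inner_def using Bochner_Integration.integral_add[OF i1 i2] unfolding e2 .
  \<comment> \<open>The second integration by parts, with \<open>dzb a\<close> as the compactly
    supported factor, yields the norm of \<open>dzb a\<close>.\<close>
  also have "ip (delta (dzb a)) a = cnj (ip a (delta (dzb a)))" by (simp add: ip_cnj)
  also have "ip a (delta (dzb a)) = ip (dzb a) (dzb a)"
    by (subst ip_delta[OF Cka(1) b]) (simp only: A2_inner_def)
  also have "\<dots> = of_real (sq (dzb a))" by (rule ip_self)
  also have "(LINT x|dA. complex_of_real (laplacian \<phi> x / 2 * (norm (a x))\<^sup>2 * \<omega> x)) = of_real (LINT x|dA. laplacian \<phi> x / 2 * (norm (a x))\<^sup>2 * \<omega> x)"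
    by (rule integral_complex_of_real)
  finally have "complex_of_real (sq (delta a)) = of_real ((LINT x|dA. laplacian \<phi> x / 2 * (norm (a x))\<^sup>2 * \<omega> x) + sq (dzb a))"
    by (simp add: add.commute)
  then show "sq (delta a) = (LINT x|dA. laplacian \<phi> x / 2 * (norm (a x))\<^sup>2 * \<omega> x) + sq (dzb a)"
    using of_real_eq_iff by blast
qed

lemma div_tau_L2:
  assumes "test k a"
  shows "L2 (\<lambda>x. a x / of_real (\<tau> x))"
proof (rule L2_vanish)
  show "continuous_on unit_disk (\<lambda>x. a x / of_real (\<tau> x))"
    using assms tau_pos by (intro continuous_intros tau_cont) (force simp: test_def intro: Ck_continuous)+
  show "vanish (\<lambda>x. a x / of_real (\<tau> x))"
    using assms vanish_mult_right[of a "\<lambda>x. inverse (of_real (\<tau> x))"] by (simp add: test_def divide_inverse)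
qed

text \<open>The term with \<open>dzb a\<close> is dropped, and the Laplacian is at least 1 / (C
  \<tau>)^2. The sharp constant of this argument is C times the square root of 2, rounded up to 2
  C.\<close>

lemma basic_inequality:
  assumes a: "test 2 a"
  shows "nrm (\<lambda>x. a x / of_real (\<tau> x)) \<le> 2 * C * nrm (delta a)"
proof -
  have i: "integrable dA (\<lambda>x. (norm (a x / of_real (\<tau> x)))\<^sup>2 * \<omega> x)"
    using div_tau_L2[OF a] by (simp add: L2_def)
  have "sq (\<lambda>x. a x / of_real (\<tau> x)) \<le> (LINT x|dA. (2 * C\<^sup>2) * (laplacian \<phi> x / 2 * (norm (a x))\<^sup>2 * \<omega> x))"
    unfolding sq_def
  proof (rule integral_mono[OF i])
    show "integrable dA (\<lambda>x. (2 * C\<^sup>2) * (laplacian \<phi> x / 2 * (norm (a x))\<^sup>2 * \<omega> x))"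
      using basic_identity(2)[OF a] by (intro Bochner_Integration.integrable_mult_right)
    fix x assume "x \<in> space dA"
    then have x: "x \<in> unit_disk" by simp
    have "1 / (\<tau> x)\<^sup>2 \<le> C\<^sup>2 * laplacian \<phi> x"
      using mult_left_mono[OF lap_bounds(1)[OF x], of "C\<^sup>2"] C_pos by simp
    then have "1 / (\<tau> x)\<^sup>2 * ((norm (a x))\<^sup>2 * \<omega> x) \<le> C\<^sup>2 * laplacian \<phi> x * ((norm (a x))\<^sup>2 * \<omega> x)"
      using omega_pos[OF x] by (intro mult_right_mono) auto
    then show "(norm (a x / of_real (\<tau> x)))\<^sup>2 * \<omega> x \<le> (2 * C\<^sup>2) * (laplacian \<phi> x / 2 * (norm (a x))\<^sup>2 * \<omega> x)"
      by (simp add: norm_divide power_divide mult.assoc)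
  qed
  also have "\<dots> = 2 * C\<^sup>2 * (LINT x|dA. laplacian \<phi> x / 2 * (norm (a x))\<^sup>2 * \<omega> x)"
    by (rule integral_mult_right_zero)
  also have "\<dots> \<le> 2 * C\<^sup>2 * sq (delta a)"
    using basic_identity(1)[OF a] sq_nonneg[of "dzb a"] by (intro mult_left_mono) auto
  also have "\<dots> \<le> (2 * C * nrm (delta a))\<^sup>2"
    using sq_nonneg[of "delta a"] by (simp add: power_mult_distrib nrm_sq mult_right_mono)
  finally have "(nrm (\<lambda>x. a x / of_real (\<tau> x)))\<^sup>2 \<le> (2 * C * nrm (delta a))\<^sup>2" by (simp add: nrm_sq)
  then show ?thesis
    by (rule power2_le_imp_le) (use C_pos nrm_nonneg[of "delta a"] in simp)
qed

text \<open>This is where class E enters. Far from \<open>z\<close> its condition bounds \<tau> by a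
  small slope times the distance; near \<open>z\<close> the Lipschitz condition bounds \<tau>(x) by
  a multiple of \<tau>(z), which a large \<open>B\<close> absorbs. It will say that the gradient of
  \<open>growth\<close> is small against \<open>growth / \<tau>\<close>.\<close>

lemma tau_slow:
  assumes e: "0 < e"
  shows "\<exists>B>0. \<forall>z\<in>unit_disk. \<forall>x\<in>unit_disk. \<tau> x * norm (x - z) \<le> e * ((B * \<tau> z)\<^sup>2 + (norm (x - z))\<^sup>2)"
proof -
  \<comment> \<open>The slope in the far region must be below \<open>e / 2\<close>, the other half
    of \<open>e\<close> being spent on the term with \<tau>(z).\<close>
  obtain m :: nat where m: "2 / e < real m" using reals_Archimedean2 by blast
  then have m0: "0 < real m" using e by (meson divide_pos_pos less_trans zero_less_numeral)
  then have m1: "1 \<le> m" by simp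
  have m2: "1 / real m < e / 2" using m m0 e by (simp add: field_simps)
  obtain b t where bt: "0 < b" "0 < t" "t < 1 / real m"
    and E: "\<And>x y. x \<in> unit_disk \<Longrightarrow> y \<in> unit_disk \<Longrightarrow> b * \<tau> y < norm (x - y) \<Longrightarrow> \<tau> x \<le> \<tau> y + t * norm (x - y)"
    using tau_E[OF m1] by blast
  \<comment> \<open>Within distance \<open>b * \<tau> z\<close> of \<open>z\<close>, the Lipschitz
    condition gives \<tau>(x) \<le> \<open>(1 + \<bar>c2\<bar> * b) * \<tau> z\<close>, and this is
    \<open>e * s\<close> by the choice of \<open>B\<close>.\<close>
  define B where "B = (1 + \<bar>c2\<bar> * b) / e"
  have B: "0 < B" "1 + \<bar>c2\<bar> * b = e * B" "1 \<le> e * B"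
    using e bt by (auto simp: B_def intro!: divide_pos_pos add_pos_nonneg)
  have "\<tau> x * norm (x - z) \<le> e * ((B * \<tau> z)\<^sup>2 + (norm (x - z))\<^sup>2)" if z: "z \<in> unit_disk" and x: "x \<in> unit_disk" for x z
  proof -
    define d where "d = norm (x - z)"
    define s where "s = B * \<tau> z"
    have d: "0 \<le> d" and s: "0 < s" using B tau_pos[OF z] by (auto simp: d_def s_def)
    have sd: "2 * s * d \<le> s\<^sup>2 + d\<^sup>2" by (rule sum_squares_bound)
    show ?thesis
    proof (cases "b * \<tau> z < d")
      case True
      have "\<tau> x \<le> \<tau> z + t * d" using E[OF x z] True by (simp add: d_def)
      also have "\<dots> \<le> e * s + (e / 2) * d"
      proof (rule add_mono)
        show "\<tau> z \<le> e * s" using mult_right_mono[OF B(3), of "\<tau> z"] tau_pos[OF z] by (simp add: s_def mult.assoc)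
        show "t * d \<le> (e / 2) * d" using bt m2 d by (intro mult_right_mono) auto
      qed
      finally have "\<tau> x * d \<le> (e * s + (e / 2) * d) * d" using d by (rule mult_right_mono)
      also have "\<dots> = e / 2 * (2 * s * d) + e / 2 * d\<^sup>2" by (simp add: power2_eq_square algebra_simps)
      also have "\<dots> \<le> e / 2 * (s\<^sup>2 + d\<^sup>2) + e / 2 * d\<^sup>2" using sd e by (intro add_right_mono mult_left_mono) auto
      also have "\<dots> \<le> e * (s\<^sup>2 + d\<^sup>2)" using e by (simp add: algebra_simps)
      finally show ?thesis by (simp add: d_def s_def)
    next
      case False
      have "\<tau> x \<le> \<tau> z + c2 * d" using tau_lip[OF x z] by (simp add: d_def)
      also have "\<dots> \<le> \<tau> z + \<bar>c2\<bar> * (b * \<tau> z)"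
        using False d by (intro add_left_mono mult_mono) auto
      also have "\<dots> = e * s" using B(2) by (simp add: s_def algebra_simps) (metis distrib_right mult.assoc mult_1)
      finally have "\<tau> x * d \<le> e * s * d" using d by (rule mult_right_mono)
      also have "\<dots> \<le> e * (2 * s * d)" using e s d by simp
      also have "\<dots> \<le> e * (s\<^sup>2 + d\<^sup>2)" using sd e by (intro mult_left_mono) auto
      finally show ?thesis by (simp add: d_def s_def)
    qed
  qed
  then show ?thesis using B(1) by blast
qed

text \<open>The lowest growth that works: smooth across \<open>z\<close>, with a gradient linear in
  x - z, and with an inverse square that is integrable over the plane.\<close>

definition growth :: "complex \<Rightarrow> real \<Rightarrow> complex \<Rightarrow> real" where
  "growth z s x = 1 + (norm (x - z))\<^sup>2 / s\<^sup>2"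

lemma growth_cont: "continuous_on U (growth z s)"
  unfolding growth_def divide_inverse by (intro continuous_intros)

lemma growth_ge_1: "1 \<le> growth z s x"
  by (simp add: growth_def)

lemma growth_bounded:
  assumes "x \<in> unit_disk" "z \<in> unit_disk"
  shows "growth z s x \<le> 1 + 4 / s\<^sup>2"
proof -
  have "norm (x - z) \<le> 2" using norm_triangle_ineq4[of x z] assms by simp
  then have "(norm (x - z))\<^sup>2 \<le> 2\<^sup>2" by (rule power_mono) simp
  then show ?thesis by (simp add: growth_def divide_right_mono)
qed

lemma growth_wirtinger:
  "has_wirtinger (\<lambda>x. of_real (growth z s x)) (cnj (x - z) / of_real (s\<^sup>2)) ((x - z) / of_real (s\<^sup>2)) x"
  "Ck k unit_disk (\<lambda>x. of_real (growth z s x))"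
proof -
  have e: "(\<lambda>x. complex_of_real (growth z s x)) = (\<lambda>x. 1 + inverse (of_real (s\<^sup>2)) * ((x - z) * cnj (x - z)))"
    by (simp only: complex_norm_square[symmetric] growth_def) (simp add: divide_inverse mult.commute)
  have id: "has_wirtinger (\<lambda>x. x - z) 1 0 x"
    by (rule has_wirtinger_field_derivative) (rule derivative_eq_intros refl | simp)+
  have "has_wirtinger (\<lambda>x. 1 + inverse (of_real (s\<^sup>2)) * ((x - z) * cnj (x - z)))
    (0 + (0 * ((x - z) * cnj (x - z)) + inverse (of_real (s\<^sup>2)) * (1 * cnj (x - z) + (x - z) * cnj 0)))
    (0 + (0 * ((x - z) * cnj (x - z)) + inverse (of_real (s\<^sup>2)) * (0 * cnj (x - z) + (x - z) * cnj 1))) x"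
    by (intro has_wirtinger_add has_wirtinger_mult has_wirtinger_const has_wirtinger_cnj id)
  then show "has_wirtinger (\<lambda>x. of_real (growth z s x)) (cnj (x - z) / of_real (s\<^sup>2)) ((x - z) / of_real (s\<^sup>2)) x"
    unfolding e by (simp add: divide_inverse mult.commute)
  show "Ck k unit_disk (\<lambda>x. of_real (growth z s x))"
    unfolding e by (intro Ck_add Ck_mult Ck_const Ck_cnj open_ball Ck_holomorphic holomorphic_intros)
qed

lemma growth_L2:
  assumes "L2 f" "z \<in> unit_disk"
  shows "L2 (\<lambda>x. of_real (growth z s x) * f x)"
proof (rule L2_mult_bounded(1)[OF _ assms(1)])
  show "(\<lambda>x. complex_of_real (growth z s x)) \<in> borel_measurable dA"
    by (intro continuous_imp_measurable_dA continuous_intros growth_cont)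
  show "\<And>x. x \<in> unit_disk \<Longrightarrow> norm (complex_of_real (growth z s x)) \<le> 1 + 4 / s\<^sup>2"
    using growth_bounded[OF _ assms(2)] growth_ge_1 by (simp add: order_trans[OF zero_le_one])
qed

text \<open>The weight \<open>growth\<close> varies so slowly on the scale of \<open>\<tau>\<close> that its derivative is absorbed
  by the basic inequality applied to \<open>growth * a\<close>.\<close>

lemma weighted_estimate:
  assumes z: "z \<in> unit_disk" and s: "0 < s"
    and slow: "\<And>x. x \<in> unit_disk \<Longrightarrow> \<tau> x * norm (x - z) \<le> 1 / (16 * C) * (s\<^sup>2 + (norm (x - z))\<^sup>2)"
    and K: "K holomorphic_on unit_disk" "L2 K" and a: "test 2 a"
  shows "nrm (\<lambda>x. of_real (growth z s x) * K x) \<le> 4 * nrm (\<lambda>x. of_real (growth z s x) * (K x - delta a x))"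
proof -
  let ?X = "\<lambda>x. complex_of_real (growth z s x)"
  define D where "D x = cnj (x - z) / of_real (s\<^sup>2)" for x
  define Q where "Q x = ?X x * a x / of_real (\<tau> x)" for x
  have a1: "test 1 a" by (rule test_le[OF a]) simp
  have X1: "Ck k unit_disk ?X" for k by (rule growth_wirtinger)
  have dX: "dz ?X x = D x" for x
    using has_wirtinger_imp(2)[OF growth_wirtinger(1)] by (simp add: D_def)
  have Xa: "test 2 (\<lambda>x. ?X x * a x)" by (rule test_mult[OF a X1])
  have Xa1: "test 1 (\<lambda>x. ?X x * a x)" by (rule test_mult[OF a1 X1])
  have D: "Ck k unit_disk D" for k
    unfolding D_def[abs_def] divide_inverse by (intro Ck_mult Ck_const Ck_cnj open_ball Ck_holomorphic holomorphic_intros)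
  have Da: "test 2 (\<lambda>x. D x * a x)" by (rule test_mult[OF a D])
  have QL: "L2 Q" unfolding Q_def using div_tau_L2[OF Xa] .
  note L = delta_L2[OF a1] test_L2[OF Da] K(2)
  define W where "W = nrm (\<lambda>x. ?X x * delta a x)"
  \<comment> \<open>The assumption \<open>slow\<close> says pointwise that |D| is at most
    \<open>growth / \<tau>\<close> times 1 / (16 C).\<close>
  have Q: "nrm (\<lambda>x. D x * a x) \<le> 1 / (16 * C) * nrm Q"
  proof -
    have "nrm (\<lambda>x. D x * a x) \<le> nrm (\<lambda>x. of_real (1 / (16 * C)) * Q x)"
    proof (rule L2_mono(3)[OF L2_meas[OF L(2)] L2_cmult[OF QL]])
      fix x assume x: "x \<in> unit_disk"
      have t: "0 < \<tau> x" by (rule tau_pos[OF x])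
      have "norm (x - z) * \<tau> x \<le> 1 / (16 * C) * growth z s x * s\<^sup>2"
        using slow[OF x] s by (simp add: growth_def algebra_simps)
      then have "norm (x - z) / s\<^sup>2 \<le> 1 / (16 * C) * growth z s x / \<tau> x"
        using t s C_pos by (simp add: field_simps)
      from mult_right_mono[OF this norm_ge_zero[of "a x"]]
      show "norm (D x * a x) \<le> norm (of_real (1 / (16 * C)) * Q x)"
        using t C_pos growth_ge_1[of z s x] by (simp add: D_def Q_def norm_mult norm_divide norm_power flip: complex_cnj_diff)
    qed
    then show ?thesis unfolding nrm_cmult norm_of_real using C_pos by simp
  qed
  have QW: "nrm Q \<le> 4 * C * W"
  proof -
    have q1: "nrm Q \<le> 2 * C * nrm (delta (\<lambda>x. ?X x * a x))"
      unfolding Q_def by (rule basic_inequality[OF Xa])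
    have q2: "nrm (delta (\<lambda>x. ?X x * a x)) = nrm (\<lambda>x. ?X x * delta a x - D x * a x)"
      by (rule nrm_cong) (simp only: delta_mult[OF a1 X1] dX)
    have q3: "nrm (\<lambda>x. ?X x * delta a x - D x * a x) \<le> W + nrm (\<lambda>x. D x * a x)"
      unfolding W_def by (rule nrm_triangle_diff[OF growth_L2[OF L(1) z] L(2)])
    have "2 * C * nrm (delta (\<lambda>x. ?X x * a x)) \<le> 2 * C * (W + 1 / (16 * C) * nrm Q)"
      using q2 q3 Q C_pos by (intro mult_left_mono) auto
    also have "\<dots> = 2 * C * W + nrm Q / 8" using C_pos by (simp add: field_simps)
    \<comment> \<open>The constant 16 C leaves 1/8 of \<open>nrm Q\<close> on the right, which is
      absorbed on the left.\<close>
    finally have "nrm Q \<le> (16 / 7) * (C * W)" using q1 by simp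
    also have "\<dots> \<le> 4 * (C * W)" using C_pos nrm_nonneg by (intro mult_right_mono) (auto simp: W_def)
    finally show ?thesis by simp
  qed
  have DW: "nrm (\<lambda>x. D x * a x) \<le> W / 4"
  proof -
    have "1 / (16 * C) * nrm Q \<le> 1 / (16 * C) * (4 * C * W)" using QW C_pos by (intro mult_left_mono) auto
    then show ?thesis using Q C_pos by simp
  qed
  define U where "U x = delta a x - K x" for x
  have UL: "L2 U" unfolding U_def by (rule L2_diff[OF L(1,3)])
  \<comment> \<open>Testing with the square of the weight lets one factor move to the other side of
    the inner product, and \<open>K\<close> stays orthogonal to \<open>delta X2a\<close> because
    \<open>X2a\<close> is again a test function.\<close>
  define X2a where "X2a x = ?X x * (?X x * a x)" for x
  have X2a: "test 2 X2a" "test 1 X2a"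
    unfolding X2a_def[abs_def] by (rule test_mult[OF Xa X1], rule test_mult[OF Xa1 X1])
  have dX2a: "delta X2a x = ?X x * (?X x * delta a x) - 2 * (?X x * (D x * a x))" if "x \<in> unit_disk" for x
    unfolding X2a_def[abs_def] delta_mult[OF Xa1 X1 that] delta_mult[OF a1 X1 that] dX by (simp add: algebra_simps)
  note XL = growth_L2[OF L(1) z] growth_L2[OF L(2) z]
  note XXL = growth_L2[OF XL(1) z]
  have move: "ip u (\<lambda>x. ?X x * v x) = ip (\<lambda>x. ?X x * u x) v" for u v
    unfolding A2_inner_def by (simp add: mult_ac)
  have ipd: "ip u (delta X2a) = ip (\<lambda>x. ?X x * u x) (\<lambda>x. ?X x * delta a x) - 2 * ip (\<lambda>x. ?X x * u x) (\<lambda>x. D x * a x)" if u: "L2 u" for u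
  proof -
    have "ip u (delta X2a) = ip u (\<lambda>x. ?X x * (?X x * delta a x) - 2 * (?X x * (D x * a x)))"
      unfolding A2_inner_def by (rule Bochner_Integration.integral_cong) (simp_all add: dX2a)
    also have "\<dots> = ip u (\<lambda>x. ?X x * (?X x * delta a x)) - cnj 2 * ip u (\<lambda>x. ?X x * (D x * a x))"
      by (subst ip_diff_right[OF XXL L2_cmult[OF XL(2)] u]) (simp only: ip_cmult_right)
    finally show ?thesis by (simp add: move)
  qed
  have orth: "ip K (delta X2a) = 0" by (rule holomorphic_orthogonal[OF K(1) X2a(2)])
  \<comment> \<open>The unknown \<open>delta a\<close> is traded for \<open>U\<close>, the error to
    be controlled by; \<open>K\<close> drops out.\<close>
  have "ip (delta a) (delta X2a) = ip U (delta X2a)"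
    unfolding U_def by (subst ip_diff_left[OF L(1,3) delta_L2[OF X2a(2)]]) (simp add: orth)
  then have "complex_of_real (W\<^sup>2) = 2 * ip (\<lambda>x. ?X x * delta a x) (\<lambda>x. D x * a x)
     + (ip (\<lambda>x. ?X x * U x) (\<lambda>x. ?X x * delta a x) - 2 * ip (\<lambda>x. ?X x * U x) (\<lambda>x. D x * a x))"
    unfolding ipd[OF L(1)] ipd[OF UL] W_def nrm_sq ip_self by (simp add: algebra_simps)
  then have "W\<^sup>2 = norm (2 * ip (\<lambda>x. ?X x * delta a x) (\<lambda>x. D x * a x)
     + (ip (\<lambda>x. ?X x * U x) (\<lambda>x. ?X x * delta a x) - 2 * ip (\<lambda>x. ?X x * U x) (\<lambda>x. D x * a x)))"
    by (metis abs_of_nonneg norm_of_real zero_le_power2)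
  also have "\<dots> \<le> norm (2 * ip (\<lambda>x. ?X x * delta a x) (\<lambda>x. D x * a x))
     + (norm (ip (\<lambda>x. ?X x * U x) (\<lambda>x. ?X x * delta a x)) + norm (2 * ip (\<lambda>x. ?X x * U x) (\<lambda>x. D x * a x)))"
    by (intro order_trans[OF norm_triangle_ineq] add_left_mono norm_triangle_ineq4)
  also have "\<dots> \<le> 2 * (W * (W / 4)) + (nrm (\<lambda>x. ?X x * U x) * W + 2 * (nrm (\<lambda>x. ?X x * U x) * (W / 4)))"
  proof -
    have "norm (ip (\<lambda>x. ?X x * delta a x) (\<lambda>x. D x * a x)) \<le> W * (W / 4)"
      using order_trans[OF Cauchy_Schwarz(2)[OF XL(1) L(2)] mult_left_mono[OF DW nrm_nonneg]] by (simp add: W_def)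
    moreover have "norm (ip (\<lambda>x. ?X x * U x) (\<lambda>x. D x * a x)) \<le> nrm (\<lambda>x. ?X x * U x) * (W / 4)"
      using order_trans[OF Cauchy_Schwarz(2)[OF growth_L2[OF UL z] L(2)] mult_left_mono[OF DW nrm_nonneg]] by simp
    moreover have "norm (ip (\<lambda>x. ?X x * U x) (\<lambda>x. ?X x * delta a x)) \<le> nrm (\<lambda>x. ?X x * U x) * W"
      using Cauchy_Schwarz(2)[OF growth_L2[OF UL z] XL(1)] by (simp add: W_def)
    ultimately show ?thesis by (simp add: norm_mult algebra_simps)
  qed
  \<comment> \<open>The term \<open>2 * W * (W / 4)\<close> is half of W^2 and moves to the left;
    the remaining factor 1 + 1/2 doubles to 3.\<close>
  finally have "W * W \<le> 3 * nrm (\<lambda>x. ?X x * U x) * W" by (simp add: power2_eq_square algebra_simps)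
  moreover have W0: "0 \<le> W" by (simp add: W_def nrm_nonneg)
  ultimately have W3: "W \<le> 3 * nrm (\<lambda>x. ?X x * U x)"
    using nrm_nonneg[of "\<lambda>x. ?X x * U x"] by (cases "W = 0") (auto dest: mult_right_le_imp_le)
  have eU: "nrm (\<lambda>x. ?X x * U x) = nrm (\<lambda>x. ?X x * (K x - delta a x))"
    by (rule nrm_cong) (simp add: U_def norm_mult norm_minus_commute)
  have "nrm (\<lambda>x. ?X x * K x) \<le> nrm (\<lambda>x. ?X x * K x - ?X x * delta a x) + W"
    unfolding W_def by (rule nrm_triangle_sub[OF growth_L2[OF L(3) z] XL(1)])
  also have "nrm (\<lambda>x. ?X x * K x - ?X x * delta a x) = nrm (\<lambda>x. ?X x * (K x - delta a x))"
    by (rule nrm_cong) (simp add: right_diff_distrib)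
  finally show ?thesis using W3 eU by simp
qed

section \<open>Local representers of point evaluations\<close>

definition seg :: "complex \<Rightarrow> complex \<Rightarrow> real \<Rightarrow> complex" where
  "seg z x t = z + of_real t * (x - z)"

lemma seg_norm:
  assumes "t \<in> {0..1}"
  shows "norm (seg z x t - z) \<le> norm (x - z)"
  using assms by (simp add: seg_def norm_mult mult_left_le_one_le)

lemma seg_in_disk:
  assumes "z \<in> unit_disk" "x \<in> unit_disk" "t \<in> {0..1}"
  shows "seg z x t \<in> unit_disk"
proof -
  have "(1 - t) *\<^sub>R z + t *\<^sub>R x \<in> unit_disk"
    by (rule convexD[OF convex_ball]) (use assms in auto)
  moreover have "(1 - t) *\<^sub>R z + t *\<^sub>R x = seg z x t"
    by (simp add: seg_def scaleR_conv_of_real algebra_simps)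
  ultimately show ?thesis by simp
qed

lemma seg_cont: "continuous_on S (\<lambda>(x, t). seg z x t)"
  unfolding seg_def split_def by (intro continuous_intros)

lemma cont_seg_compose:
  assumes "continuous_on unit_disk F" "z \<in> unit_disk"
  shows "continuous_on (unit_disk \<times> {0..1}) (\<lambda>(x, t). F (seg z x t))"
proof -
  have "continuous_on (unit_disk \<times> {0..1}) (\<lambda>p. F (case p of (x, t) \<Rightarrow> seg z x t))"
    by (rule continuous_on_compose2[OF assms(1) seg_cont]) (use seg_in_disk[OF assms(2)] in auto)
  then show ?thesis by (simp add: split_def)
qed

lemma cont_fix_fst:
  assumes "continuous_on (U \<times> S) (\<lambda>(x, t). F x t)" "x \<in> U"
  shows "continuous_on S (F x)"
proof -
  have "continuous_on S (\<lambda>t. (x, t))" by (intro continuous_intros)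
  from continuous_on_compose2[OF assms(1) this] show ?thesis
    using assms(2) by (simp add: image_subset_iff)
qed

text \<open>If \<open>\<phi>\<close> were harmonic, this would be a holomorphic function with real part \<open>\<phi> x - \<phi> z\<close>; in general
  the real part is the same, and the \<open>dzb\<close>-derivative only involves the Laplacian of \<open>\<phi>\<close>.\<close>

definition gauge_log :: "complex \<Rightarrow> complex \<Rightarrow> complex" where
  "gauge_log z x = integral {0..1} (\<lambda>t. 2 * dz cphi (seg z x t) * (x - z))"

text \<open>The factor of x - z in the d-bar derivative of \<open>gauge_log\<close>: the chain rule
  along the segment contributes \<open>t\<close>, and 2 times a quarter of the Laplacian contributes
  1/2.\<close>

definition lap_avg :: "complex \<Rightarrow> complex \<Rightarrow> real" where
  "lap_avg z x = integral {0..1} (\<lambda>t. t * laplacian \<phi> (seg z x t) / 2)"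

lemma gauge_log_integrand_cont:
  "z \<in> unit_disk \<Longrightarrow> continuous_on (unit_disk \<times> {0..1}) (\<lambda>(x, t). 2 * dz cphi (seg z x t) * (x - z))"
  using cont_seg_compose[OF Ck_continuous[OF cphi_C1(2)], of z]
  unfolding split_def by (intro continuous_intros)

text \<open>As \<phi> is real, its derivative along the segment is the real part of the integrand,
  so the fundamental theorem of calculus applies.\<close>

lemma Re_gauge_log:
  assumes z: "z \<in> unit_disk" and x: "x \<in> unit_disk"
  shows "Re (gauge_log z x) = \<phi> x - \<phi> z"
proof -
  let ?I = "\<lambda>t. 2 * dz cphi (seg z x t) * (x - z)"
  have "continuous_on {0..1} ?I"
    using cont_fix_fst[OF gauge_log_integrand_cont[OF z] x] .
  then have "(?I has_integral gauge_log z x) {0..1}"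
    unfolding gauge_log_def by (intro integrable_integral integrable_continuous_real)
  from has_integral_linear[OF this bounded_linear_Re]
  have 1: "((\<lambda>t. Re (?I t)) has_integral Re (gauge_log z x)) {0..1}" by (simp add: o_def)
  have "((\<lambda>t. Re (?I t)) has_integral (\<phi> (seg z x 1) - \<phi> (seg z x 0))) {0..1}"
  proof (rule fundamental_theorem_of_calculus)
    fix t :: real assume t: "t \<in> {0..1}"
    let ?a = "dz cphi (seg z x t)"
    have p: "seg z x t \<in> unit_disk" by (rule seg_in_disk[OF z x t])
    have "has_wirtinger cphi ?a (cnj ?a) (seg z x t)"
      using Ck1_wirtinger[OF cphi_C1(1) p] dz_dzb_cphi(1)[OF p] by simp
    then have d: "(cphi has_derivative (\<lambda>h. ?a * h + cnj ?a * cnj h)) (at (seg z x t))"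
      by (simp add: has_wirtinger_def)
    have s: "(seg z x has_derivative (\<lambda>h. of_real h * (x - z))) (at t)"
      unfolding seg_def by (auto intro!: derivative_eq_intros)
    have "((\<lambda>t. Re (cphi (seg z x t))) has_derivative (\<lambda>h. Re (?a * (of_real h * (x - z)) + cnj ?a * cnj (of_real h * (x - z))))) (at t)"
      by (rule has_derivative_Re[OF has_derivative_compose[OF s d]])
    moreover have "(\<lambda>h::real. Re (?a * (of_real h * (x - z)) + cnj ?a * cnj (of_real h * (x - z)))) = (\<lambda>h. h *\<^sub>R Re (?I t))"
      by (auto simp: fun_eq_iff algebra_simps)
    ultimately have "((\<lambda>t. \<phi> (seg z x t)) has_vector_derivative Re (?I t)) (at t)"
      by (simp add: has_vector_derivative_def cphi_def)
    then show "((\<lambda>t. \<phi> (seg z x t)) has_vector_derivative Re (?I t)) (at t within {0..1})"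
      by (rule has_vector_derivative_at_within)
  qed simp
  from has_integral_unique[OF 1 this] show ?thesis by (simp add: seg_def)
qed

lemma lap_avg_cont:
  assumes z: "z \<in> unit_disk"
  shows "continuous_on unit_disk (lap_avg z)"
proof -
  have "continuous_on (unit_disk \<times> cbox 0 1) (\<lambda>(x, t). t * laplacian \<phi> (seg z x t) / 2)"
    using cont_seg_compose[OF lap_cont z] unfolding split_def by (auto intro!: continuous_intros)
  from integral_continuous_on_param[OF this] show ?thesis unfolding lap_avg_def by simp
qed

lemma lap_avg_bounds:
  assumes z: "z \<in> unit_disk" and x: "x \<in> unit_disk"
    and K: "\<And>t. t \<in> {0..1} \<Longrightarrow> laplacian \<phi> (seg z x t) \<le> K"
  shows "0 \<le> lap_avg z x" "lap_avg z x \<le> K"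
proof -
  have c: "continuous_on (unit_disk \<times> {0..1}) (\<lambda>(x, t). t * laplacian \<phi> (seg z x t) / 2)"
    using cont_seg_compose[OF lap_cont z] unfolding split_def by (auto intro!: continuous_intros)
  have i: "(\<lambda>t. t * laplacian \<phi> (seg z x t) / 2) integrable_on {0..1}"
    by (rule integrable_continuous_real[OF cont_fix_fst[OF c x]])
  have l: "0 \<le> laplacian \<phi> (seg z x t)" if "t \<in> {0..1}" for t
    using lap_pos[OF seg_in_disk[OF z x that]] by simp
  show "0 \<le> lap_avg z x" unfolding lap_avg_def
    by (rule integral_nonneg[OF i]) (use l in auto)
  have "lap_avg z x \<le> integral {0..1} (\<lambda>t::real. K)" unfolding lap_avg_def
  proof (rule integral_le[OF i])
    fix t :: real assume t: "t \<in> {0..1}"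
    have "t * laplacian \<phi> (seg z x t) \<le> 1 * laplacian \<phi> (seg z x t)"
      using t l[OF t] by (intro mult_right_mono) auto
    then show "t * laplacian \<phi> (seg z x t) / 2 \<le> K" using K[OF t] l[OF t] by simp
  qed (rule integrable_const_ivl)
  then show "lap_avg z x \<le> K" by simp
qed

text \<open>A pair of Wirtinger derivatives as a bounded real-linear operator, the form in which
  differentiation under the integral sign requires a continuous family of derivatives.\<close>

definition wblinfun :: "complex \<Rightarrow> complex \<Rightarrow> complex \<Rightarrow>\<^sub>L complex" where
  "wblinfun a b = blinfun_mult_right a + (blinfun_mult_right b o\<^sub>L Blinfun cnj)"

lemma wblinfun_apply: "blinfun_apply (wblinfun a b) = (\<lambda>h. a * h + b * cnj h)"
  by (auto simp: wblinfun_def blinfun.add_left bounded_linear_Blinfun_apply[OF bounded_linear_cnj])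

lemma wblinfun_cont:
  assumes "continuous_on S f" "continuous_on S g"
  shows "continuous_on S (\<lambda>x. wblinfun (f x) (g x))"
  unfolding wblinfun_def
  by (intro continuous_intros assms bounded_linear.continuous_on[OF bounded_linear_blinfun_mult_right]
      bounded_bilinear.continuous_on[OF bounded_bilinear_blinfun_compose])

text \<open>Differentiation under the integral over the segment, which uses up both derivatives of
  \<phi>. Of the holomorphic derivative only continuity matters later; the other one isolates the
  Laplacian.\<close>

lemma gauge_log_wirtinger:
  assumes z: "z \<in> unit_disk"
  obtains A where "continuous_on unit_disk A"
    "\<And>x. x \<in> unit_disk \<Longrightarrow> has_wirtinger (gauge_log z) (A x) ((x - z) * of_real (lap_avg z x)) x"
proof -
  define a where "a x t = 2 * (of_real t * dz (dz cphi) (seg z x t)) * (x - z) + 2 * dz cphi (seg z x t)" for x and t :: real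
  define b where "b x t = (x - z) * of_real (t * laplacian \<phi> (seg z x t) / 2)" for x and t :: real
  define A where "A x = integral (cbox 0 1) (a x)" for x
  have ca: "continuous_on (unit_disk \<times> cbox 0 1) (\<lambda>(x, t). a x t)"
  proof -
    have "continuous_on unit_disk (dz (dz cphi))" using cphi_C1(2) by auto
    from cont_seg_compose[OF this z] cont_seg_compose[OF Ck_continuous[OF cphi_C1(2)] z]
    show ?thesis unfolding a_def split_def by (auto intro!: continuous_intros)
  qed
  have cb: "continuous_on (unit_disk \<times> cbox 0 1) (\<lambda>(x, t). b x t)"
    using cont_seg_compose[OF lap_cont z] unfolding b_def split_def by (auto intro!: continuous_intros)
  have cA: "continuous_on unit_disk A"
    unfolding A_def by (rule integral_continuous_on_param[OF ca])
  have "has_wirtinger (gauge_log z) (A x) ((x - z) * of_real (lap_avg z x)) x" if x: "x \<in> unit_disk" for x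
  proof -
    have cont1: "continuous_on {0..1} (a x)" "continuous_on {0..1} (b x)"
      using cont_fix_fst[OF ca x] cont_fix_fst[OF cb x] by simp_all
    have int1: "a x integrable_on {0..1}" "b x integrable_on {0..1}"
      using cont1 by (auto intro: integrable_continuous_real)
    have "((\<lambda>x. integral (cbox 0 1) (\<lambda>t. 2 * dz cphi (seg z x t) * (x - z))) has_derivative
        integral (cbox 0 1) (\<lambda>t. wblinfun (a x t) (b x t))) (at x within unit_disk)"
    proof (rule leibniz_rule[OF _ _ _ x convex_ball])
      fix y :: complex and t :: real assume y: "y \<in> unit_disk" and "t \<in> cbox 0 1"
      then have t: "t \<in> {0..1}" by simp
      have p: "seg z y t \<in> unit_disk" by (rule seg_in_disk[OF z y t])
      have d: "(dz cphi has_derivative (\<lambda>h. dz (dz cphi) (seg z y t) * h + of_real (laplacian \<phi> (seg z y t) / 4) * cnj h)) (at (seg z y t))"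
        using Ck1_wirtinger[OF cphi_C1(2) p] unfolding dz_dzb_cphi(2)[OF p] has_wirtinger_def .
      have s: "((\<lambda>y. seg z y t) has_derivative (\<lambda>h. of_real t * h)) (at y)"
        unfolding seg_def by (auto intro!: derivative_eq_intros)
      have "((\<lambda>y. dz cphi (seg z y t)) has_derivative (\<lambda>h. dz (dz cphi) (seg z y t) * (of_real t * h) + of_real (laplacian \<phi> (seg z y t) / 4) * cnj (of_real t * h))) (at y)"
        by (rule has_derivative_compose[OF s d])
      then have w: "has_wirtinger (\<lambda>y. dz cphi (seg z y t)) (of_real t * dz (dz cphi) (seg z y t)) (of_real (t * laplacian \<phi> (seg z y t) / 4)) y"
        unfolding has_wirtinger_def by (rule has_derivative_eq_rhs) (auto simp: algebra_simps)
      have i: "has_wirtinger (\<lambda>y. y - z) 1 0 y"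
        by (rule has_wirtinger_field_derivative) (rule derivative_eq_intros refl | simp)+
      have "has_wirtinger (\<lambda>y. 2 * dz cphi (seg z y t) * (y - z)) (a y t) (b y t) y"
        using has_wirtinger_mult[OF has_wirtinger_mult[OF has_wirtinger_const[of 2] w] i]
        by (simp add: a_def b_def mult_ac)
      then show "((\<lambda>x. 2 * dz cphi (seg z x t) * (x - z)) has_derivative blinfun_apply (wblinfun (a y t) (b y t))) (at y within unit_disk)"
        unfolding has_wirtinger_def wblinfun_apply by (rule has_derivative_at_withinI)
    next
      fix y assume y: "y \<in> unit_disk"
      show "(\<lambda>t. 2 * dz cphi (seg z y t) * (y - z)) integrable_on cbox 0 1"
        using integrable_continuous_real[OF cont_fix_fst[OF gauge_log_integrand_cont[OF z] y]] by simp
    next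
      show "continuous_on (unit_disk \<times> cbox 0 1) (\<lambda>(x, t). wblinfun (a x t) (b x t))"
        using wblinfun_cont[OF ca cb] by (simp add: split_def)
    qed
    then have D: "(gauge_log z has_derivative blinfun_apply (integral {0..1} (\<lambda>t. wblinfun (a x t) (b x t)))) (at x)"
      using at_within_open[OF x open_ball] by (simp add: gauge_log_def[abs_def])
    have wi: "(\<lambda>t. wblinfun (a x t) (b x t)) integrable_on {0..1}"
      by (intro integrable_continuous_real wblinfun_cont cont1)
    have "blinfun_apply (integral {0..1} (\<lambda>t. wblinfun (a x t) (b x t))) h = A x * h + (x - z) * of_real (lap_avg z x) * cnj h" for h
    proof -
      have "blinfun_apply (integral {0..1} (\<lambda>t. wblinfun (a x t) (b x t))) h
          = integral {0..1} (\<lambda>t. blinfun_apply (wblinfun (a x t) (b x t)) h)"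
        using integral_linear[OF wi blinfun.bounded_linear_left[of h]] by (simp add: o_def)
      also have "\<dots> = integral {0..1} (\<lambda>t. a x t * h + b x t * cnj h)" by (simp only: wblinfun_apply)
      also have "\<dots> = integral {0..1} (\<lambda>t. a x t * h) + integral {0..1} (\<lambda>t. b x t * cnj h)"
        using int1 by (intro Henstock_Kurzweil_Integration.integral_add integrable_on_mult_left)
      also have "\<dots> = A x * h + integral {0..1} (b x) * cnj h"
        by (simp add: A_def)
      also have "integral {0..1} (b x) = (x - z) * integral {0..1} (\<lambda>t. complex_of_real (t * laplacian \<phi> (seg z x t) / 2))"
        unfolding b_def[abs_def] by (rule Henstock_Kurzweil_Integration.integral_mult_right)
      also have "integral {0..1} (\<lambda>t. complex_of_real (t * laplacian \<phi> (seg z x t) / 2)) = of_real (lap_avg z x)"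
      proof -
        have c: "continuous_on (unit_disk \<times> {0..1}) (\<lambda>(x, t). t * laplacian \<phi> (seg z x t) / 2)"
          using cont_seg_compose[OF lap_cont z] unfolding split_def by (auto intro!: continuous_intros)
        have i: "(\<lambda>t. t * laplacian \<phi> (seg z x t) / 2) integrable_on {0..1}"
          by (rule integrable_continuous_real[OF cont_fix_fst[OF c x]])
        show ?thesis unfolding lap_avg_def using integral_linear[OF i bounded_linear_of_real[where 'a=complex]] by (simp add: o_def)
      qed
      finally show ?thesis .
    qed
    then have "blinfun_apply (integral {0..1} (\<lambda>t. wblinfun (a x t) (b x t))) = (\<lambda>h. A x * h + (x - z) * of_real (lap_avg z x) * cnj h)" by auto
    with D show ?thesis by (simp add: has_wirtinger_def)
  qed
  with cA show ?thesis by (rule that)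
qed

section \<open>The local gauge and a reproducing formula on small disks\<close>

definition gauge :: "complex \<Rightarrow> complex \<Rightarrow> complex" where
  "gauge z x = exp (- gauge_log z x)"

lemma gauge_wirtinger:
  assumes z: "z \<in> unit_disk"
  shows "Ck 1 unit_disk (gauge z)"
    and "x \<in> unit_disk \<Longrightarrow> dzb (gauge z) x = - gauge z x * ((x - z) * of_real (lap_avg z x))"
proof -
  obtain A where A: "continuous_on unit_disk A"
    "\<And>x. x \<in> unit_disk \<Longrightarrow> has_wirtinger (gauge_log z) (A x) ((x - z) * of_real (lap_avg z x)) x"
    by (rule gauge_log_wirtinger[OF z]) blast
  have "Ck (Suc 0) unit_disk (gauge_log z)"
    by (rule Ck_SucI[OF open_ball A(2)]) (use A(1) lap_avg_cont[OF z] in \<open>auto intro!: continuous_intros\<close>)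
  then show "Ck 1 unit_disk (gauge z)"
    unfolding gauge_def[abs_def] One_nat_def by (intro Ck_exp Ck_minus open_ball)
  show "dzb (gauge z) x = - gauge z x * ((x - z) * of_real (lap_avg z x))" if x: "x \<in> unit_disk"
  proof -
    have "((\<lambda>w. exp (- w)) has_field_derivative (- exp (- gauge_log z x))) (at (gauge_log z x))"
      by (rule derivative_eq_intros refl | simp)+
    from has_wirtinger_imp(3)[OF has_wirtinger_compose[OF A(2)[OF x] this]]
    show ?thesis by (simp add: gauge_def[abs_def])
  qed
qed

text \<open>The reason for introducing the gauge: dividing its square modulus by \<omega>(x) leaves
  the constant 1 / \<omega>(z), so the weight is frozen at \<open>z\<close> with no comparison of
  values of \<omega>.\<close>

lemma norm_gauge:
  assumes "z \<in> unit_disk" "x \<in> unit_disk"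
  shows "(norm (gauge z x))\<^sup>2 = \<omega> x / \<omega> z"
proof -
  have "norm (gauge z x) = exp (\<phi> z - \<phi> x)" by (simp add: gauge_def norm_exp_eq_Re Re_gauge_log[OF assms])
  then have "(norm (gauge z x))\<^sup>2 = exp (2 * (\<phi> z - \<phi> x))" by (simp only: exp_double)
  also have "\<dots> = \<omega> x / \<omega> z"
    unfolding omega_eq[OF assms(1)] omega_eq[OF assms(2)] exp_diff[symmetric] by (simp add: algebra_simps)
  finally show ?thesis .
qed

text \<open>A Cauchy-Pompeiu formula for \<open>u = f * gauge\<close>. Integration by parts against
  \<open>chi_primitive\<close> trades the mollifier of a small radius for that of radius
  \<open>r\<close>; the defect of holomorphy, \<open>- u * (x - z) * lap_avg\<close>, adds the term
  with \<open>bump ^ 4\<close>, and then the small radius tends to 0.\<close>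

lemma local_reproducing:
  assumes z: "z \<in> unit_disk" and r: "0 < r" "norm z + r < 1" and f: "f holomorphic_on unit_disk"
  shows "of_real bump_mass * f z = (LINT x|dA. f x * gauge z x * of_real (chi z r x + lap_avg z x * bump z r x ^ 4))"
proof -
  define u where "u x = f x * gauge z x" for x
  have Cf: "Ck k unit_disk f" for k by (rule Ck_holomorphic[OF open_ball f])
  have Cu: "Ck 1 unit_disk u" unfolding u_def[abs_def] by (intro Ck_mult Cf gauge_wirtinger z open_ball)
  have cu: "continuous_on unit_disk u" by (rule Ck_continuous[OF Cu])
  have cM: "continuous_on unit_disk (lap_avg z)" by (rule lap_avg_cont[OF z])
  have du: "dzb u x = - u x * ((x - z) * of_real (lap_avg z x))" if x: "x \<in> unit_disk" for x
  proof -
    have wf: "has_wirtinger f (deriv f x) 0 x"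
      by (rule has_wirtinger_field_derivative[OF holomorphic_derivI[OF f open_ball x]])
    show ?thesis
      unfolding u_def[abs_def]
      using has_wirtinger_imp(3)[OF has_wirtinger_mult[OF wf Ck1_wirtinger[OF gauge_wirtinger(1)[OF z] x]]] gauge_wirtinger(2)[OF z x]
      by simp
  qed
  \<comment> \<open>Starting at r / 2 keeps every inner radius strictly below
    \<open>r\<close>.\<close>
  define s where "s n = r / real (Suc (Suc n))" for n
  have s: "0 < s n" "s n < r" for n using r(1) by (auto simp: s_def field_simps intro: add_pos_nonneg)
  have slim: "s \<longlonglongrightarrow> 0"
  proof -
    have "(\<lambda>n. r * inverse (real (Suc (Suc n)))) \<longlonglongrightarrow> r * 0"
      by (intro tendsto_mult tendsto_const LIMSEQ_Suc[OF LIMSEQ_inverse_real_of_nat])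
    then show ?thesis by (simp add: s_def[abs_def] divide_inverse)
  qed
  have nz: "norm z + s n < 1" for n using s[of n] r by linarith
  have vb: "vanish (\<lambda>x. complex_of_real (bump z t x ^ 4))" if "0 < t" "norm z + t < 1" for t
    by (rule vanish_near[OF that(2)]) (use that in \<open>simp add: bump_eq_0\<close>)
  have vc: "vanish (\<lambda>x. complex_of_real (chi z t x))" if "0 < t" "norm z + t < 1" for t
    by (rule vanish_comp[OF vanish_chi[OF that]]) simp
  have ib: "integrable dA (\<lambda>x. u x * of_real (lap_avg z x * bump z t x ^ 4))" if "0 < t" "norm z + t < 1" for t
  proof (rule vanish_integrable)
    have "vanish (\<lambda>x. u x * of_real (lap_avg z x) * complex_of_real (bump z t x ^ 4))"
      by (rule vanish_mult_left[OF vb[OF that]])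
    then show "vanish (\<lambda>x. u x * complex_of_real (lap_avg z x * bump z t x ^ 4))" by (simp add: mult.assoc)
  qed (intro continuous_intros cu cM)
  have ic: "integrable dA (\<lambda>x. u x * of_real (chi z t x))" if "0 < t" "norm z + t < 1" for t
    by (rule vanish_integrable) (intro continuous_intros cu, rule vanish_mult_left[OF vc[OF that]])
  have key: "(LINT x|dA. u x * of_real (chi z (s n) x))
      = (LINT x|dA. u x * of_real (chi z r x + lap_avg z x * bump z r x ^ 4)) - (LINT x|dA. u x * of_real (lap_avg z x * bump z (s n) x ^ 4))" for n
  proof -
    have k: "Ck 1 unit_disk (chi_primitive z r (s n))" "vanish (chi_primitive z r (s n))"
      using Ck_le[OF wirtinger_ker(2)[OF s], of unit_disk 1] vanish_ker[OF s r(2)] by auto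
    have "(LINT x|dA. dzb u x * chi_primitive z r (s n) x) = - (LINT x|dA. u x * dzb (chi_primitive z r (s n)) x)"
      by (rule integration_by_parts(2)[OF Cu k])
    also have "(LINT x|dA. dzb u x * chi_primitive z r (s n) x) = (LINT x|dA. u x * of_real (lap_avg z x * bump z (s n) x ^ 4) - u x * of_real (lap_avg z x * bump z r x ^ 4))"
    proof (rule Bochner_Integration.integral_cong[OF refl])
      fix x assume "x \<in> space dA"
      then have x: "x \<in> unit_disk" by simp
      have e: "(x - z) * chi_primitive z r (s n) x = of_real (bump z r x ^ 4 - bump z (s n) x ^ 4)"
        by (cases "x = z") (simp_all add: chi_primitive_def bump_def)
      have "dzb u x * chi_primitive z r (s n) x = - u x * of_real (lap_avg z x) * ((x - z) * chi_primitive z r (s n) x)"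
        by (simp add: du[OF x])
      then show "dzb u x * chi_primitive z r (s n) x = u x * of_real (lap_avg z x * bump z (s n) x ^ 4) - u x * of_real (lap_avg z x * bump z r x ^ 4)"
        unfolding e by (simp add: algebra_simps)
    qed
    also have "\<dots> = (LINT x|dA. u x * of_real (lap_avg z x * bump z (s n) x ^ 4)) - (LINT x|dA. u x * of_real (lap_avg z x * bump z r x ^ 4))"
      by (rule Bochner_Integration.integral_diff) (use ib s nz r in auto)
    also have "(LINT x|dA. u x * dzb (chi_primitive z r (s n)) x) = (LINT x|dA. u x * of_real (chi z (s n) x) - u x * of_real (chi z r x))"
      by (rule Bochner_Integration.integral_cong[OF refl])
         (simp add: has_wirtinger_imp(3)[OF wirtinger_ker(1)[OF s]] right_diff_distrib)
    also have "\<dots> = (LINT x|dA. u x * of_real (chi z (s n) x)) - (LINT x|dA. u x * of_real (chi z r x))"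
      by (rule Bochner_Integration.integral_diff) (use ic s nz r in auto)
    finally have "(LINT x|dA. u x * of_real (chi z (s n) x)) = (LINT x|dA. u x * of_real (chi z r x)) + (LINT x|dA. u x * of_real (lap_avg z x * bump z r x ^ 4)) - (LINT x|dA. u x * of_real (lap_avg z x * bump z (s n) x ^ 4))"
      by (simp add: algebra_simps)
    also have "(LINT x|dA. u x * of_real (chi z r x)) + (LINT x|dA. u x * of_real (lap_avg z x * bump z r x ^ 4)) = (LINT x|dA. u x * of_real (chi z r x + lap_avg z x * bump z r x ^ 4))"
      unfolding of_real_add distrib_left
      by (rule Bochner_Integration.integral_add[symmetric]) (use ib ic r in auto)
    finally show ?thesis .
  qed
  \<comment> \<open>Since \<open>bump ^ 4\<close> is at most \<open>bump ^ 3\<close>, which is s^2 /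
    4 times \<open>chi\<close>, the term is at most s^2 / 4 times a mollification of a continuous
    function, and that converges.\<close>
  have small: "(\<lambda>n. LINT x|dA. u x * of_real (lap_avg z x * bump z (s n) x ^ 4)) \<longlonglongrightarrow> 0"
  proof (rule Lim_null_comparison)
    define v where "v x = complex_of_real (norm (u x) * \<bar>lap_avg z x\<bar>)" for x
    have cv: "continuous_on unit_disk v" unfolding v_def by (intro continuous_intros cu cM)
    have "(\<lambda>n. (s n)\<^sup>2 / 4 * norm (LINT x|dA. v x * of_real (chi z (s n) x))) \<longlonglongrightarrow> 0\<^sup>2 / 4 * norm (of_real bump_mass * v z)"
      by (intro tendsto_mult tendsto_divide tendsto_power slim tendsto_norm chi_tendsto[OF cv z s(1) slim] tendsto_const) simp
    then show "(\<lambda>n. (s n)\<^sup>2 / 4 * norm (LINT x|dA. v x * of_real (chi z (s n) x))) \<longlonglongrightarrow> 0" by simp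
    have iv: "integrable dA (\<lambda>x. v x * of_real (chi z (s n) x))" for n
      by (rule vanish_integrable) (intro continuous_intros cv, rule vanish_mult_left[OF vc[OF s(1) nz]])
    have "norm (LINT x|dA. u x * of_real (lap_avg z x * bump z (s n) x ^ 4)) \<le> (s n)\<^sup>2 / 4 * norm (LINT x|dA. v x * of_real (chi z (s n) x))" for n
    proof -
      have vr: "v x * of_real (chi z (s n) x) = complex_of_real (norm (u x) * \<bar>lap_avg z x\<bar> * chi z (s n) x)" for x
        by (simp add: v_def)
      have iv': "integrable dA (\<lambda>x. norm (u x) * \<bar>lap_avg z x\<bar> * chi z (s n) x)"
        using iv[of n] unfolding vr complex_of_real_integrable_eq .
      have "norm (LINT x|dA. u x * of_real (lap_avg z x * bump z (s n) x ^ 4)) \<le> (LINT x|dA. norm (u x * of_real (lap_avg z x * bump z (s n) x ^ 4)))"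
        by (rule integral_norm_bound)
      also have "\<dots> \<le> (LINT x|dA. (s n)\<^sup>2 / 4 * (norm (u x) * \<bar>lap_avg z x\<bar> * chi z (s n) x))"
      proof (rule integral_mono)
        show "integrable dA (\<lambda>x. norm (u x * of_real (lap_avg z x * bump z (s n) x ^ 4)))"
          using ib[OF s(1) nz] by (rule integrable_norm)
        show "integrable dA (\<lambda>x. (s n)\<^sup>2 / 4 * (norm (u x) * \<bar>lap_avg z x\<bar> * chi z (s n) x))"
          using iv' by (rule Bochner_Integration.integrable_mult_right)
        fix x
        have "bump z (s n) x ^ 4 \<le> bump z (s n) x ^ 3"
          using bump_bounds[of z "s n" x] by (intro power_decreasing) auto
        also have "\<dots> = (s n)\<^sup>2 / 4 * chi z (s n) x" using s[of n] by (simp add: chi_def)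
        finally have "norm (u x) * \<bar>lap_avg z x\<bar> * bump z (s n) x ^ 4 \<le> norm (u x) * \<bar>lap_avg z x\<bar> * ((s n)\<^sup>2 / 4 * chi z (s n) x)"
          by (intro mult_left_mono) auto
        then show "norm (u x * of_real (lap_avg z x * bump z (s n) x ^ 4)) \<le> (s n)\<^sup>2 / 4 * (norm (u x) * \<bar>lap_avg z x\<bar> * chi z (s n) x)"
          using bump_bounds(1)[of z "s n" x] by (simp add: norm_mult abs_mult norm_power mult_ac)
      qed
      also have "\<dots> = (s n)\<^sup>2 / 4 * (LINT x|dA. norm (u x) * \<bar>lap_avg z x\<bar> * chi z (s n) x)"
        by (rule integral_mult_right_zero)
      also have "(LINT x|dA. norm (u x) * \<bar>lap_avg z x\<bar> * chi z (s n) x) \<le> norm (LINT x|dA. v x * of_real (chi z (s n) x))"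
        unfolding vr integral_complex_of_real norm_of_real by simp
      finally show ?thesis by (simp add: mult_left_mono)
    qed
    then show "\<forall>\<^sub>F n in sequentially. norm (LINT x|dA. u x * of_real (lap_avg z x * bump z (s n) x ^ 4)) \<le> (s n)\<^sup>2 / 4 * norm (LINT x|dA. v x * of_real (chi z (s n) x))"
      by (intro always_eventually) auto
  qed
  have "(\<lambda>n. LINT x|dA. u x * of_real (chi z (s n) x)) \<longlonglongrightarrow> (LINT x|dA. u x * of_real (chi z r x + lap_avg z x * bump z r x ^ 4)) - 0"
    unfolding key by (intro tendsto_diff tendsto_const small)
  moreover have "(\<lambda>n. LINT x|dA. u x * of_real (chi z (s n) x)) \<longlonglongrightarrow> of_real bump_mass * u z"
    by (rule chi_tendsto[OF cu z s(1) slim])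
  ultimately have "of_real bump_mass * u z = (LINT x|dA. u x * of_real (chi z r x + lap_avg z x * bump z r x ^ 4))"
    using LIMSEQ_unique by fastforce
  \<comment> \<open>At the centre the segment degenerates, so \<open>gauge_log z z\<close> is 0 and
    the gauge is 1.\<close>
  moreover have "u z = f z" by (simp add: u_def gauge_def gauge_log_def)
  ultimately have "of_real bump_mass * f z = (LINT x|dA. u x * of_real (chi z r x + lap_avg z x * bump z r x ^ 4))"
    by (simp only:)
  then show ?thesis unfolding u_def .
qed

section \<open>Peak functions on disks of radius comparable to \<tau>(z)\<close>

definition dlt :: real where
  "dlt = 1 / (2 * (1 + \<bar>c1\<bar> + \<bar>c2\<bar>))"

definition rad :: "complex \<Rightarrow> real" where
  "rad z = dlt * \<tau> z"

lemma dlt_pos: "0 < dlt"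
  by (simp add: dlt_def add_pos_nonneg)

lemma rad:
  assumes z: "z \<in> unit_disk"
  shows "0 < rad z" "norm z + rad z < 1"
    and "norm (x - z) \<le> rad z \<Longrightarrow> x \<in> unit_disk"
    and "norm (x - z) \<le> rad z \<Longrightarrow> \<tau> z / 2 \<le> \<tau> x"
proof -
  have t: "0 < \<tau> z" by (rule tau_pos[OF z])
  show p: "0 < rad z" using t dlt_pos by (simp add: rad_def)
  \<comment> \<open>The two demands that fix \<open>dlt\<close>: the disk stays within half the
    distance to the unit circle, and on it \<tau> does not fall below half its value at
    \<open>z\<close>.\<close>
  have d: "dlt * \<bar>c1\<bar> \<le> 1/2" "dlt * \<bar>c2\<bar> \<le> 1/2"
    by (simp_all add: dlt_def field_simps)
  have z1: "0 < 1 - norm z" using z by simp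
  have "rad z \<le> dlt * (\<bar>c1\<bar> * (1 - norm z))"
    unfolding rad_def using dlt_pos z1 order_trans[OF tau_le[OF z] mult_right_mono[OF abs_ge_self, of "1 - norm z" c1]]
    by (intro mult_left_mono) auto
  also have "\<dots> \<le> 1/2 * (1 - norm z)"
    unfolding mult.assoc[symmetric] using z1 by (intro mult_right_mono d) auto
  finally show n: "norm z + rad z < 1" using z1 by (simp add: field_simps)
  show x: "x \<in> unit_disk" if "norm (x - z) \<le> rad z"
    using norm_triangle_ineq[of "x - z" z] that n by simp
  show "\<tau> z / 2 \<le> \<tau> x" if r: "norm (x - z) \<le> rad z"
  proof -
    have "\<tau> z - \<tau> x \<le> c2 * norm (z - x)" using tau_lip[OF z x[OF r]] by simp
    also have "\<dots> \<le> \<bar>c2\<bar> * rad z"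
      using r by (intro mult_mono) (auto simp: norm_minus_commute)
    also have "\<dots> = (dlt * \<bar>c2\<bar>) * \<tau> z" by (simp add: rad_def)
    also have "\<dots> \<le> 1/2 * \<tau> z" using d(2) t by (intro mult_right_mono) auto
    finally show ?thesis by simp
  qed
qed

text \<open>A function concentrated near \<open>z\<close> that represents evaluation at \<open>z\<close> on holomorphic functions;
  the Bergman kernel is its orthogonal projection.\<close>

definition peak :: "complex \<Rightarrow> complex \<Rightarrow> complex" where
  "peak z x = cnj (gauge z x) * of_real ((chi z (rad z) x + lap_avg z x * bump z (rad z) x ^ 4) / (bump_mass * \<omega> x))"

text \<open>In the bound for \<open>peak\<close>, both \<open>4 / r\<^sup>2\<close> and the
  Laplacian scale as \<tau>(z)^(-2); the square root of the area contributes
  \<open>dlt * \<tau> z\<close>, leaving one factor 1 / \<tau>(z).\<close>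

definition CH :: real where
  "CH = (4 / dlt\<^sup>2 + 4 * C\<^sup>2) * dlt / bump_mass"

lemma CH_pos: "0 < CH"
  using dlt_pos bump_mass_pos C_pos by (simp add: CH_def add_pos_nonneg)

lemma peak_vanish: "z \<in> unit_disk \<Longrightarrow> x \<in> unit_disk \<Longrightarrow> rad z \<le> norm (x - z) \<Longrightarrow> peak z x = 0"
  using rad(1)[of z] by (simp add: peak_def chi_eq_0 bump_eq_0)

lemma peak_test: "z \<in> unit_disk \<Longrightarrow> test 0 (peak z)"
  unfolding test_def Ck.simps
proof
  assume z: "z \<in> unit_disk"
  show "continuous_on unit_disk (peak z)"
    unfolding peak_def
    by (intro continuous_intros Ck_continuous[OF gauge_wirtinger(1)] lap_avg_cont z omega_cont)
       (use bump_mass_pos omega_pos in force)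
  show "vanish (peak z)" by (rule vanish_near[OF rad(2)[OF z]]) (rule peak_vanish[OF z])
qed

lemma peak_L2: "z \<in> unit_disk \<Longrightarrow> L2 (peak z)"
  using peak_test test_L2 by blast

lemma peak_reproducing:
  assumes z: "z \<in> unit_disk" and f: "f holomorphic_on unit_disk"
  shows "ip f (peak z) = f z"
proof -
  have "ip f (peak z) = (LINT x|dA. inverse (of_real bump_mass) * (f x * gauge z x * of_real (chi z (rad z) x + lap_avg z x * bump z (rad z) x ^ 4)))"
    unfolding A2_inner_def
  proof (rule Bochner_Integration.integral_cong[OF refl])
    fix x assume "x \<in> space dA"
    then have "0 < \<omega> x" using omega_pos by simp
    then show "f x * cnj (peak z x) * of_real (\<omega> x) = inverse (of_real bump_mass) * (f x * gauge z x * of_real (chi z (rad z) x + lap_avg z x * bump z (rad z) x ^ 4))"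
      using bump_mass_pos by (simp add: peak_def field_simps)
  qed
  also have "\<dots> = inverse (of_real bump_mass) * (of_real bump_mass * f z)"
    using local_reproducing[OF z rad(1,2)[OF z] f] by simp
  also have "\<dots> = f z" using bump_mass_pos by simp
  finally show ?thesis .
qed

text \<open>On the support everything is comparable to its value at \<open>z\<close>: the gauge
  trades \<omega>(x) for \<omega>(z), and \<tau> \<ge> \<tau>(z) / 2 controls the Laplacian. So a
  sup bound times the area of the disk suffices.\<close>

lemma peak_bound:
  assumes z: "z \<in> unit_disk"
  shows "sq (peak z) \<le> CH\<^sup>2 / (\<omega> z * (\<tau> z)\<^sup>2)"
proof -
  define K where "K = 4 * C\<^sup>2 / (\<tau> z)\<^sup>2"
  define r where "r = rad z"
  have t: "0 < \<tau> z" and wz: "0 < \<omega> z" and r0: "0 < r" using tau_pos omega_pos rad z by (auto simp: r_def)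
  define B where "B = (4 / r\<^sup>2 + K)\<^sup>2 / (bump_mass\<^sup>2 * \<omega> z)"
  have B0: "0 \<le> B" using wz by (simp add: B_def)
  have pt: "(norm (peak z x))\<^sup>2 * \<omega> x \<le> B * indicator (cball z r \<inter> unit_disk) x" if x: "x \<in> unit_disk" for x
  proof (cases "norm (x - z) \<le> r")
    case True
    have wx: "0 < \<omega> x" by (rule omega_pos[OF x])
    \<comment> \<open>The segment stays in the disk about \<open>z\<close>, where C^2 / \<tau>^2 is
      at most C^2 / (\<tau>(z) / 2)^2; hence the factor 4 in \<open>K\<close>.\<close>
    have "laplacian \<phi> (seg z x t) \<le> K" if "t \<in> {0..1}" for t
    proof -
      have n: "norm (seg z x t - z) \<le> rad z" using seg_norm[OF that, of z x] True by (simp add: r_def)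
      note y = rad(3,4)[OF z n]
      have "(\<tau> z / 2)\<^sup>2 \<le> (\<tau> (seg z x t))\<^sup>2" using y t tau_pos[OF z] by (intro power_mono) auto
      then have "C\<^sup>2 / (\<tau> (seg z x t))\<^sup>2 \<le> C\<^sup>2 / (\<tau> z / 2)\<^sup>2"
        using tau_pos[OF z] by (intro divide_left_mono mult_pos_pos) (auto simp: tau_pos[OF y(1)])
      also have "\<dots> = K" by (simp add: K_def power_divide)
      finally show ?thesis using lap_bounds(2)[OF y(1)] by simp
    qed
    note Mb = lap_avg_bounds[OF z x this]
    define c where "c = chi z r x + lap_avg z x * bump z r x ^ 4"
    have "lap_avg z x * bump z r x ^ 4 \<le> K * 1"
      using Mb bump_bounds[of z r x] by (intro mult_mono power_le_one) auto
    then have c: "0 \<le> c" "c \<le> 4 / r\<^sup>2 + K"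
      using Mb bump_bounds[of z r x] chi_nonneg[of z r x] chi_le[OF r0, of z x] by (auto simp: c_def)
    have "(norm (peak z x))\<^sup>2 * \<omega> x = (norm (gauge z x))\<^sup>2 * (c / (bump_mass * \<omega> x))\<^sup>2 * \<omega> x"
      by (simp only: peak_def c_def r_def norm_mult norm_of_real power_mult_distrib power2_abs complex_mod_cnj)
    also have "\<dots> = c\<^sup>2 / (bump_mass\<^sup>2 * \<omega> z)"
      unfolding norm_gauge[OF z x] using wx by (simp add: power2_eq_square)
    also have "\<dots> \<le> B" unfolding B_def
      using c wz by (intro divide_right_mono power_mono) auto
    finally show ?thesis using True x by (simp add: dist_norm norm_minus_commute)
  next
    case False
    then have "peak z x = 0" using peak_vanish[OF z x] by (simp add: r_def)
    then show ?thesis using B0 by simp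
  qed
  have ms: "cball z r \<inter> unit_disk \<in> sets dA" by (simp add: sets_dA sets_restrict_space_iff)
  have em: "emeasure dA (cball z r \<inter> unit_disk) < \<infinity>"
    using emeasure_dA_le[of r z] r0 by (auto simp: less_top[symmetric] dest: neq_top_trans[rotated])
  have i: "integrable dA (indicator (cball z r \<inter> unit_disk) :: complex \<Rightarrow> real)"
    using ms em by (rule integrable_real_indicator)
  have "sq (peak z) \<le> (LINT x|dA. B * indicator (cball z r \<inter> unit_disk) x)"
    unfolding sq_def
    by (rule integral_mono) (use peak_L2[OF z] i pt in \<open>auto simp: L2_def\<close>)
  also have "\<dots> = B * measure dA (cball z r \<inter> unit_disk)"
    using ms by (simp add: Int_absorb2)
  also have "measure dA (cball z r \<inter> unit_disk) \<le> r\<^sup>2"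
    using emeasure_dA_le[of r z] r0 by (simp add: measure_def enn2real_leI)
  also have "B * r\<^sup>2 = CH\<^sup>2 / (\<omega> z * (\<tau> z)\<^sup>2)"
    using t dlt_pos wz bump_mass_pos
    by (simp add: B_def K_def r_def rad_def CH_def power_divide power_mult_distrib divide_simps)
  finally show ?thesis using B0 by (simp add: mult_left_mono)
qed

lemma peak_nrm:
  assumes z: "z \<in> unit_disk"
  shows "nrm (peak z) \<le> CH / (sqrt (\<omega> z) * \<tau> z)"
proof -
  have "nrm (peak z) \<le> sqrt (CH\<^sup>2 / (\<omega> z * (\<tau> z)\<^sup>2))"
    unfolding nrm_def by (rule real_sqrt_le_mono[OF peak_bound[OF z]])
  also have "\<dots> = CH / (sqrt (\<omega> z) * \<tau> z)"
    using CH_pos tau_pos[OF z] by (simp add: real_sqrt_divide real_sqrt_mult)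
  finally show ?thesis .
qed

end

section \<open>Weakly holomorphic limits\<close>

text \<open>Taylor's formula for the cube of the positive part. Its second derivative is at most 6
  on arguments not exceeding 1, and half of that is the constant; the sign cases replace an argument
  by derivatives at the kink.\<close>

lemma cube_max_remainder:
  fixes u v :: real
  assumes "u \<le> 1" "v \<le> 1"
  shows "\<bar>max 0 v ^ 3 - max 0 u ^ 3 - 3 * max 0 u ^ 2 * (v - u)\<bar> \<le> 3 * (v - u)\<^sup>2"
proof -
  consider "0 \<le> u" "0 \<le> v" | "0 \<le> u" "v < 0" | "u < 0" "0 \<le> v" | "u < 0" "v < 0" by linarith
  then show ?thesis
  proof cases
    case 1
    have "v ^ 3 - u ^ 3 - 3 * u ^ 2 * (v - u) = (v - u)\<^sup>2 * (v + 2 * u)"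
      by (simp add: power2_eq_square power3_eq_cube algebra_simps)
    moreover have "(v - u)\<^sup>2 * (v + 2 * u) \<le> (v - u)\<^sup>2 * 3" using 1 assms by (intro mult_left_mono) auto
    moreover have "0 \<le> (v - u)\<^sup>2 * (v + 2 * u)" using 1 by simp
    ultimately show ?thesis using 1 by simp
  next
    case 2
    define w where "w = - v"
    have w: "0 < w" using 2 by (simp add: w_def)
    have "- (u ^ 3) - 3 * u ^ 2 * (v - u) = 2 * u ^ 3 + 3 * (u ^ 2 * w)"
      by (simp add: w_def power2_eq_square power3_eq_cube algebra_simps)
    moreover have "0 \<le> 2 * u ^ 3 + 3 * (u ^ 2 * w)" using 2 w by simp
    moreover have "2 * u ^ 3 + 3 * (u ^ 2 * w) \<le> 2 * u ^ 2 + 3 * (u * w)"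
      using 2 assms w by (intro add_mono mult_left_mono mult_right_mono power_decreasing) (auto simp: power2_eq_square mult_left_le)
    moreover have "2 * u ^ 2 + 3 * (u * w) \<le> 3 * (v - u)\<^sup>2"
    proof -
      have "(v - u)\<^sup>2 = u\<^sup>2 + 2 * (u * w) + w\<^sup>2" by (simp add: w_def power2_eq_square algebra_simps)
      moreover have "0 \<le> u * w" using 2 w by simp
      ultimately show ?thesis using zero_le_power2[of u] zero_le_power2[of w] by linarith
    qed
    ultimately show ?thesis using 2 by simp
  next
    case 3
    have "v ^ 3 \<le> v ^ 2" using 3 assms by (intro power_decreasing) auto
    also have "\<dots> \<le> (v - u)\<^sup>2" using 3 by (intro power_mono) auto
    finally have "v ^ 3 \<le> 3 * (v - u)\<^sup>2" using zero_le_power2[of "v - u"] by linarith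
    then show ?thesis using 3 by simp
  next
    case 4
    then show ?thesis by simp
  qed
qed

lemma chi_sym: "chi w r x = chi x r w"
  by (simp add: chi_def bump_def norm_minus_commute)

text \<open>A first-order expansion of the mollifier in its centre, with a remainder uniform in
  \<open>x\<close>. It lets the mollification of a mere L^2 function be differentiated in the
  centre.\<close>

lemma chi_first_order:
  assumes r: "0 < r" and x: "norm (x - w) \<le> 2" and t: "norm t \<le> 1"
  shows "\<bar>chi (w + t) r x - chi w r x - 12 * bump w r x ^ 2 / r ^ 4 * (2 * Re (cnj t * (x - w)))\<bar>
      \<le> 4 / r\<^sup>2 * (75 / r ^ 4 + 3 / r\<^sup>2) * (norm t)\<^sup>2"
proof -
  define u where "u = 1 - (norm (x - w))\<^sup>2 / r\<^sup>2"
  define v where "v = 1 - (norm (x - (w + t)))\<^sup>2 / r\<^sup>2"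
  define l where "l = 2 * Re (cnj t * (x - w))"
  have b: "bump w r x = max 0 u" "bump (w + t) r x = max 0 v" by (simp_all add: bump_def u_def v_def)
  have nn: "(norm (x - (w + t)))\<^sup>2 = (norm (x - w))\<^sup>2 - l + (norm t)\<^sup>2"
    unfolding l_def cmod_power2 by (simp add: power2_eq_square algebra_simps)
  have vu: "v - u = l / r\<^sup>2 - (norm t)\<^sup>2 / r\<^sup>2"
    unfolding v_def u_def nn by (simp add: diff_divide_distrib add_divide_distrib)
  have "\<bar>l\<bar> \<le> 2 * (norm t * norm (x - w))"
    using abs_Re_le_cmod[of "cnj t * (x - w)"] by (simp add: l_def norm_mult)
  also have "\<dots> \<le> 2 * (norm t * 2)" using x by (intro mult_left_mono) auto
  finally have l: "\<bar>l\<bar> \<le> 4 * norm t" by simp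
  have t2: "(norm t)\<^sup>2 \<le> norm t" using t by (simp add: power2_eq_square mult_left_le)
  have "\<bar>v - u\<bar> = \<bar>l - (norm t)\<^sup>2\<bar> / r\<^sup>2" unfolding vu by (simp add: diff_divide_distrib[symmetric])
  \<comment> \<open>The linear part gives 4 |t| and the quadratic part at most |t|. Then 3 (5 |t| /
    r^2)^2 gives the constant 75.\<close>
  also have "\<dots> \<le> 5 * norm t / r\<^sup>2"
  proof (rule divide_right_mono)
    show "\<bar>l - (norm t)\<^sup>2\<bar> \<le> 5 * norm t" using l t2 zero_le_power2[of "norm t"] by linarith
  qed simp
  finally have "(v - u)\<^sup>2 \<le> (5 * norm t / r\<^sup>2)\<^sup>2"
    using abs_le_square_iff[of "v - u" "5 * norm t / r\<^sup>2"] by simp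
  then have 1: "3 * (v - u)\<^sup>2 \<le> 75 / r ^ 4 * (norm t)\<^sup>2"
    by (simp add: power_divide power_mult_distrib)
  have 2: "\<bar>max 0 v ^ 3 - max 0 u ^ 3 - 3 * max 0 u ^ 2 * (v - u)\<bar> \<le> 3 * (v - u)\<^sup>2"
    by (rule cube_max_remainder) (auto simp: u_def v_def)
  have 3: "3 * max 0 u ^ 2 * ((norm t)\<^sup>2 / r\<^sup>2) \<le> 3 / r\<^sup>2 * (norm t)\<^sup>2"
  proof -
    have "max 0 u ^ 2 \<le> 1" by (rule power_le_one) (auto simp: u_def)
    then have "3 * max 0 u ^ 2 * ((norm t)\<^sup>2 / r\<^sup>2) \<le> 3 * 1 * ((norm t)\<^sup>2 / r\<^sup>2)"
      by (intro mult_right_mono mult_left_mono) auto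
    then show ?thesis by simp
  qed
  have e: "chi (w + t) r x - chi w r x - 12 * bump w r x ^ 2 / r ^ 4 * l
      = 4 / r\<^sup>2 * ((max 0 v ^ 3 - max 0 u ^ 3 - 3 * max 0 u ^ 2 * (v - u)) - 3 * max 0 u ^ 2 * ((norm t)\<^sup>2 / r\<^sup>2))"
    unfolding chi_def b vu by (simp add: algebra_simps diff_divide_distrib power4_eq_xxxx power2_eq_square)
  have "\<bar>(max 0 v ^ 3 - max 0 u ^ 3 - 3 * max 0 u ^ 2 * (v - u)) - 3 * max 0 u ^ 2 * ((norm t)\<^sup>2 / r\<^sup>2)\<bar>
      \<le> 3 * (v - u)\<^sup>2 + 3 * max 0 u ^ 2 * ((norm t)\<^sup>2 / r\<^sup>2)"
    using 2 abs_triangle_ineq4[of "max 0 v ^ 3 - max 0 u ^ 3 - 3 * max 0 u ^ 2 * (v - u)" "3 * max 0 u ^ 2 * ((norm t)\<^sup>2 / r\<^sup>2)"]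
    by (simp add: abs_mult)
  also have "\<dots> \<le> (75 / r ^ 4 + 3 / r\<^sup>2) * (norm t)\<^sup>2" using 1 3 by (simp add: distrib_right)
  finally show ?thesis unfolding l_def[symmetric] e abs_mult using r
    by (simp only: mult.assoc) (intro mult_mono, auto)
qed

lemma measurable_id_dA [measurable]: "(\<lambda>x. x) \<in> dA \<rightarrow>\<^sub>M borel"
  by (rule borel_imp_measurable_dA) simp

text \<open>Mollification is bounded on L^2 locally, by Cauchy-Schwarz against the measure
  \<open>chi\<close> and Fubini. One factor \<open>bump_mass\<close> comes from each; the symmetry
  \<open>chi_sym\<close> makes the second integration the same as the first. The radius is limited
  so that mass from radius R spreads at most to (1 + R) / 2.\<close>

lemma chi_convolution_bound:
  fixes u :: "complex \<Rightarrow> complex"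
  assumes u: "continuous_on unit_disk u" and R: "0 \<le> R" "R < 1" and r: "0 < r" "r \<le> (1 - R) / 2"
  shows "(\<integral>\<^sup>+w. ennreal ((norm (LINT x|dA. u x * of_real (chi w r x)))\<^sup>2) * indicator (cball 0 R) w \<partial>dA)
     \<le> ennreal (bump_mass\<^sup>2) * (\<integral>\<^sup>+x. ennreal ((norm (u x))\<^sup>2) * indicator (cball 0 ((1 + R) / 2)) x \<partial>dA)"
proof -
  have [measurable]: "u \<in> borel_measurable dA" by (rule continuous_imp_measurable_dA[OF u])
  have [measurable]: "(\<lambda>(w, x). chi w r x) \<in> borel_measurable (dA \<Otimes>\<^sub>M dA)"
    unfolding chi_def bump_def by measurable
  have [measurable]: "cball (0::complex) t \<in> sets borel" for t by simp
  interpret pair_sigma_finite dA dA ..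
  have pt: "ennreal ((norm (LINT x|dA. u x * of_real (chi w r x)))\<^sup>2) * indicator (cball 0 R) w
      \<le> ennreal bump_mass * (\<integral>\<^sup>+x. ennreal ((norm (u x))\<^sup>2 * chi w r x) * indicator (cball 0 R) w \<partial>dA)" if w: "w \<in> unit_disk" for w
  proof (cases "norm w \<le> R")
    case True
    have wr: "norm w + r < 1" using True r R by (simp add: field_simps)
    have [measurable]: "chi w r \<in> borel_measurable dA"
      by (rule continuous_imp_measurable_dA[OF continuous_on_chi])
    note vc = vanish_chi[OF r(1) wr]
    have ic: "integrable dA (chi w r)" by (rule vanish_integrable[OF continuous_on_chi vc])
    have "norm (LINT x|dA. u x * of_real (chi w r x)) \<le> (LINT x|dA. norm (u x * of_real (chi w r x)))"
      by (rule integral_norm_bound)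
    also have "(LINT x|dA. norm (u x * of_real (chi w r x))) = (LINT x|dA. norm (u x) * chi w r x)"
      by (simp add: norm_mult chi_nonneg)
    finally have 1: "ennreal (norm (LINT x|dA. u x * of_real (chi w r x))) \<le> ennreal (LINT x|dA. norm (u x) * chi w r x)"
      by (rule ennreal_leI)
    have iu: "integrable dA (\<lambda>x. norm (u x) * chi w r x)"
      by (rule vanish_integrable) (intro continuous_intros u, rule vanish_mult_left[OF vc])
    have 2: "ennreal (LINT x|dA. norm (u x) * chi w r x) = (\<integral>\<^sup>+x. ennreal (norm (u x) * chi w r x) \<partial>dA)"
      by (rule nn_integral_eq_integral[symmetric, OF iu]) (auto intro!: AE_I2 mult_nonneg_nonneg chi_nonneg)
    \<comment> \<open>Splitting off a square root prepares Cauchy-Schwarz so that one of the two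
      factors integrates to \<open>bump_mass\<close>.\<close>
    have 3: "(\<integral>\<^sup>+x. ennreal (norm (u x) * chi w r x) \<partial>dA) = (\<integral>\<^sup>+x. ennreal (norm (u x) * sqrt (chi w r x)) * ennreal (sqrt (chi w r x)) \<partial>dA)"
      by (rule nn_integral_cong) (simp add: ennreal_mult[symmetric] chi_nonneg mult.assoc)
    have 4: "(\<integral>\<^sup>+x. ennreal (sqrt (chi w r x)) ^ 2 \<partial>dA) = ennreal bump_mass"
    proof -
      have "(\<integral>\<^sup>+x. ennreal (sqrt (chi w r x)) ^ 2 \<partial>dA) = (\<integral>\<^sup>+x. ennreal (chi w r x) \<partial>dA)"
        by (rule nn_integral_cong) (simp add: ennreal_power chi_nonneg)
      also have "\<dots> = ennreal (LINT x|dA. chi w r x)"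
        by (rule nn_integral_eq_integral[OF ic]) (auto intro!: AE_I2 chi_nonneg)
      finally show ?thesis using integral_chi[OF r(1)] wr by simp
    qed
    have 5: "(\<integral>\<^sup>+x. ennreal (norm (u x) * sqrt (chi w r x)) ^ 2 \<partial>dA) = (\<integral>\<^sup>+x. ennreal ((norm (u x))\<^sup>2 * chi w r x) \<partial>dA)"
      by (rule nn_integral_cong) (simp add: ennreal_power chi_nonneg power_mult_distrib)
    have "ennreal ((norm (LINT x|dA. u x * of_real (chi w r x)))\<^sup>2) = (ennreal (norm (LINT x|dA. u x * of_real (chi w r x))))\<^sup>2"
      by (simp add: ennreal_power)
    also have "\<dots> \<le> (\<integral>\<^sup>+x. ennreal (norm (u x) * sqrt (chi w r x)) * ennreal (sqrt (chi w r x)) \<partial>dA)\<^sup>2"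
      using 1 unfolding 2 3 by (intro power_mono) auto
    also have "\<dots> \<le> (\<integral>\<^sup>+x. ennreal (norm (u x) * sqrt (chi w r x)) ^ 2 \<partial>dA) * (\<integral>\<^sup>+x. ennreal (sqrt (chi w r x)) ^ 2 \<partial>dA)"
      by (rule Cauchy_Schwarz_nn_integral) measurable
    finally show ?thesis using True unfolding 4 5 by (simp add: mult.commute)
  qed (use w in simp)
  have "(\<integral>\<^sup>+w. ennreal ((norm (LINT x|dA. u x * of_real (chi w r x)))\<^sup>2) * indicator (cball 0 R) w \<partial>dA)
     \<le> (\<integral>\<^sup>+w. ennreal bump_mass * (\<integral>\<^sup>+x. ennreal ((norm (u x))\<^sup>2 * chi w r x) * indicator (cball 0 R) w \<partial>dA) \<partial>dA)"
    by (rule nn_integral_mono) (use pt in simp)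
  also have "\<dots> = ennreal bump_mass * (\<integral>\<^sup>+w. (\<integral>\<^sup>+x. ennreal ((norm (u x))\<^sup>2 * chi w r x) * indicator (cball 0 R) w \<partial>dA) \<partial>dA)"
    by (rule nn_integral_cmult) measurable
  also have "(\<integral>\<^sup>+w. (\<integral>\<^sup>+x. ennreal ((norm (u x))\<^sup>2 * chi w r x) * indicator (cball 0 R) w \<partial>dA) \<partial>dA)
      = (\<integral>\<^sup>+x. (\<integral>\<^sup>+w. ennreal ((norm (u x))\<^sup>2 * chi w r x) * indicator (cball 0 R) w \<partial>dA) \<partial>dA)"
    by (rule Fubini'[symmetric]) measurable
  also have "\<dots> \<le> (\<integral>\<^sup>+x. ennreal bump_mass * (ennreal ((norm (u x))\<^sup>2) * indicator (cball 0 ((1 + R) / 2)) x) \<partial>dA)"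
  proof (rule nn_integral_mono)
    fix x assume "x \<in> space dA"
    show "(\<integral>\<^sup>+w. ennreal ((norm (u x))\<^sup>2 * chi w r x) * indicator (cball 0 R) w \<partial>dA) \<le> ennreal bump_mass * (ennreal ((norm (u x))\<^sup>2) * indicator (cball 0 ((1 + R) / 2)) x)"
    proof (cases "norm x \<le> (1 + R) / 2")
      case True
      have xr: "norm x + r \<le> 1" using True r by (simp add: field_simps)
      have [measurable]: "chi x r \<in> borel_measurable dA"
        by (rule continuous_imp_measurable_dA[OF continuous_on_chi])
      have "integrable dA (chi x r)"
        using xr r
        by (intro dA.integrable_const_bound[where B="4 / r\<^sup>2"]) (auto simp: chi_nonneg chi_le)
      then have m: "(\<integral>\<^sup>+w. ennreal (chi x r w) \<partial>dA) = ennreal bump_mass"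
        using integral_chi[OF r(1) xr] by (subst nn_integral_eq_integral) (auto intro!: AE_I2 chi_nonneg)
      have "(\<integral>\<^sup>+w. ennreal ((norm (u x))\<^sup>2 * chi w r x) * indicator (cball 0 R) w \<partial>dA) \<le> (\<integral>\<^sup>+w. ennreal ((norm (u x))\<^sup>2) * ennreal (chi x r w) \<partial>dA)"
        by (rule nn_integral_mono) (auto simp: ennreal_mult chi_nonneg chi_sym[of _ r x] split: split_indicator)
      also have "\<dots> = ennreal ((norm (u x))\<^sup>2) * ennreal bump_mass"
        unfolding m[symmetric] by (rule nn_integral_cmult) measurable
      finally show ?thesis using True by (simp add: mult.commute)
    next
      case False
      have "chi w r x * indicator (cball 0 R) w = 0" for w
      proof (cases "norm w \<le> R")
        case True
        have "norm x \<le> norm (x - w) + norm w" using norm_triangle_ineq[of "x - w" w] by simp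
        then have "r \<le> norm (x - w)" using True False r by (simp add: field_simps)
        then show ?thesis using chi_eq_0[OF r(1)] by simp
      qed simp
      then have "ennreal ((norm (u x))\<^sup>2 * chi w r x) * indicator (cball 0 R) w = 0" for w
        by (auto split: split_indicator dest: meta_spec[of _ w])
      then show ?thesis by (simp only: nn_integral_const) simp
    qed
  qed
  also have "\<dots> = ennreal bump_mass * (\<integral>\<^sup>+x. ennreal ((norm (u x))\<^sup>2) * indicator (cball 0 ((1 + R) / 2)) x \<partial>dA)"
    by (rule nn_integral_cmult) measurable
  finally show ?thesis
    using bump_mass_pos by (simp add: mult_left_mono mult.assoc[symmetric] ennreal_mult[symmetric] power2_eq_square)
qed

context exp_weight
begin

section \<open>Unweighted pairings with test functions, and a Weyl lemma\<close>

lemma omega_nz: "x \<in> unit_disk \<Longrightarrow> \<omega> x \<noteq> 0"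
  using omega_pos[of x] by simp

text \<open>Choosing \<open>b\<close> so that \<open>cnj b * \<omega> = g\<close> turns
  orthogonality to the range of \<open>delta\<close> into the plain distributional d-bar equation.
  The factor \<open>exp (2 * cphi)\<close> is C^2 because \<phi> is.\<close>

lemma dual_test:
  assumes g: "test 2 g"
  obtains b where "test 2 b" "\<And>v. ip v (delta b) = - (LINT x|dA. v x * dzb g x)"
proof -
  define b where "b x = cnj (g x) * exp (2 * cphi x)" for x
  have b: "test 2 b" unfolding test_def
  proof
    show "Ck 2 unit_disk b" unfolding b_def[abs_def] using g
      by (intro Ck_mult Ck_cnj Ck_exp Ck_const cphi_C2 open_ball) (simp add: test_def)
    show "vanish b" unfolding b_def[abs_def] using g
      by (intro vanish_mult_right vanish_comp[where h=cnj]) (auto simp: test_def)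
  qed
  have eq: "cnj (b x) * comega x = g x" if x: "x \<in> unit_disk" for x
  proof -
    have "exp (2 * cnj (cphi x)) * comega x = 1"
      by (simp add: comega_def cphi_def omega_eq[OF x] exp_of_real[symmetric] exp_minus)
    then show ?thesis by (simp add: b_def exp_cnj mult.assoc)
  qed
  have "cnj (delta b x) * of_real (\<omega> x) = - dzb g x" if x: "x \<in> unit_disk" for x
  proof -
    have "has_wirtinger (\<lambda>x. cnj (b x) * comega x) (dz g x) (dzb g x) x"
      by (rule has_wirtinger_transform[OF Ck1_wirtinger[OF test1_Ck1[OF g] x] open_ball x eq]) auto
    then show ?thesis
      using has_wirtinger_imp(3) dzb_comega_mult[OF test1_Ck1[OF b] x] by (simp add: comega_def)
  qed
  then have "ip v (delta b) = (LINT x|dA. - (v x * dzb g x))" for v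
    unfolding A2_inner_def by (intro Bochner_Integration.integral_cong refl) (simp add: mult.assoc)
  then have "ip v (delta b) = - (LINT x|dA. v x * dzb g x)" for v by simp
  with b show ?thesis by (rule that)
qed

lemma div_omega_test:
  assumes "test 0 g"
  shows "test 0 (\<lambda>x. cnj (g x) / of_real (\<omega> x))"
  unfolding test_def Ck.simps
proof
  show "continuous_on unit_disk (\<lambda>x. cnj (g x) / of_real (\<omega> x))"
    using assms omega_pos by (intro continuous_intros omega_cont) (force simp: test_def)+
  have "vanish (\<lambda>x. cnj (g x) * inverse (of_real (\<omega> x)))"
    using assms by (intro vanish_mult_right vanish_comp[where h=cnj]) (auto simp: test_def)
  then show "vanish (\<lambda>x. cnj (g x) / of_real (\<omega> x))" by (simp add: divide_inverse)
qed

text \<open>A compactly supported \<open>g\<close> can be divided by \<omega>, so unweighted testing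
  is a continuous functional on the weighted L^2 space.\<close>

lemma pairing:
  assumes g: "test 0 g"
  shows "(LINT x|dA. v x * g x) = ip v (\<lambda>x. cnj (g x) / of_real (\<omega> x))"
  unfolding A2_inner_def
  by (rule Bochner_Integration.integral_cong) (simp_all add: omega_nz)

lemma pairing_bound:
  assumes g: "test 0 g" and v: "L2 v"
  shows "norm (LINT x|dA. v x * g x) \<le> nrm v * nrm (\<lambda>x. cnj (g x) / of_real (\<omega> x))"
    and "integrable dA (\<lambda>x. v x * g x)"
    and "(LINT x|dA. norm (v x * g x)) \<le> nrm v * nrm (\<lambda>x. cnj (g x) / of_real (\<omega> x))"
proof -
  have w: "L2 (\<lambda>x. cnj (g x) / of_real (\<omega> x))" by (rule test_L2[OF div_omega_test[OF g]])
  show "norm (LINT x|dA. v x * g x) \<le> nrm v * nrm (\<lambda>x. cnj (g x) / of_real (\<omega> x))"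
    unfolding pairing[OF g] by (rule Cauchy_Schwarz(2)[OF v w])
  have "integrable dA (\<lambda>x. v x * g x) = integrable dA (\<lambda>x. v x * cnj (cnj (g x) / of_real (\<omega> x)) * of_real (\<omega> x))"
    by (rule Bochner_Integration.integrable_cong) (simp_all add: omega_nz)
  then show "integrable dA (\<lambda>x. v x * g x)" using ip_integrable(2)[OF v w] by simp
  have "(LINT x|dA. norm (v x * g x)) = (LINT x|dA. norm (v x) * norm (cnj (g x) / of_real (\<omega> x)) * \<omega> x)"
    by (rule Bochner_Integration.integral_cong) (simp_all add: norm_mult norm_divide omega_nz abs_of_pos omega_pos)
  then show "(LINT x|dA. norm (v x * g x)) \<le> nrm v * nrm (\<lambda>x. cnj (g x) / of_real (\<omega> x))"
    using Cauchy_Schwarz(1)[OF v w] by simp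
qed

lemma chi_test:
  assumes "0 < r" "norm w + r < 1"
  shows "test 2 (\<lambda>x. of_real (chi w r x))"
proof -
  have "Ck 2 unit_disk (\<lambda>x. of_real (4 / r\<^sup>2) * complex_of_real (bump w r x ^ Suc 2))"
    by (intro Ck_mult Ck_const Ck_bump open_ball)
  moreover have "(\<lambda>x. of_real (4 / r\<^sup>2) * complex_of_real (bump w r x ^ Suc 2)) = (\<lambda>x. of_real (chi w r x))"
    by (auto simp: chi_def numeral_eq_Suc)
  ultimately show ?thesis
    using vanish_comp[OF vanish_chi[OF assms], of complex_of_real] by (simp add: test_def del: Ck.simps)
qed

lemma dzb_chi:
  "dzb (\<lambda>x. of_real (chi w r x)) x = - of_real (12 * bump w r x ^ 2 / r ^ 4) * (x - w)"
proof -
  have "has_wirtinger (\<lambda>x. of_real (4 / r\<^sup>2) * complex_of_real (bump w r x ^ 3))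
    (0 * of_real (bump w r x ^ 3) + of_real (4 / r\<^sup>2) * (of_real (3 * bump w r x ^ 2) * (- cnj (x - w) / r\<^sup>2)))
    (0 * of_real (bump w r x ^ 3) + of_real (4 / r\<^sup>2) * (of_real (3 * bump w r x ^ 2) * (- (x - w) / r\<^sup>2))) x"
    by (intro has_wirtinger_mult has_wirtinger_const has_wirtinger_bump_cube)
  moreover have "(\<lambda>x. of_real (4 / r\<^sup>2) * complex_of_real (bump w r x ^ 3)) = (\<lambda>x. of_real (chi w r x))"
    by (auto simp: chi_def)
  ultimately have "dzb (\<lambda>x. of_real (chi w r x)) x = 0 * of_real (bump w r x ^ 3) + of_real (4 / r\<^sup>2) * (of_real (3 * bump w r x ^ 2) * (- (x - w) / r\<^sup>2))"
    using has_wirtinger_imp(3) by simp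
  then show ?thesis by (simp add: power4_eq_xxxx power2_eq_square divide_inverse algebra_simps)
qed

text \<open>A quantitative Weyl lemma. The limit is identified through mollification, whose
  result does not depend on the radius because differences of the mollifiers are \<open>dzb\<close>-derivatives
  of the test functions \<open>chi_primitive\<close>.\<close>

lemma weyl:
  assumes cont: "\<And>n. continuous_on unit_disk (v n)" and L2v: "\<And>n. L2 (v n)"
    and cauchy: "\<And>n m. n \<le> m \<Longrightarrow> sq (\<lambda>x. v m x - v n x) \<le> e n" and e: "e \<longlonglongrightarrow> 0"
    and weak: "\<And>b. test 2 b \<Longrightarrow> (\<lambda>n. ip (v n) (delta b)) \<longlonglongrightarrow> 0"
  shows "\<exists>F. F holomorphic_on unit_disk \<and> L2 F \<and> (\<forall>n. sq (\<lambda>x. F x - v n x) \<le> 2 * e n)"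
proof -
  have e0: "0 \<le> e n" for n using cauchy[of n n] sq_nonneg order_trans by blast
  define B where "B = nrm (v 0) + sqrt (e 0)"
  have nB: "nrm (v n) \<le> B" for n
  proof -
    have "nrm (v n) \<le> nrm (\<lambda>x. v n x - v 0 x) + nrm (v 0)" by (rule nrm_triangle_sub[OF L2v L2v])
    moreover have "nrm (\<lambda>x. v n x - v 0 x) \<le> sqrt (e 0)"
      unfolding nrm_def by (rule real_sqrt_le_mono[OF cauchy]) simp
    ultimately show ?thesis by (simp add: B_def)
  qed
  \<comment> \<open>The Cauchy property in norm is used only through pairings, so no limit in L^2
    has to be produced beforehand.\<close>
  have conv: "convergent (\<lambda>n. LINT x|dA. v n x * g x)" if g: "test 0 g" for g
  proof -
    define G where "G = nrm (\<lambda>x. cnj (g x) / of_real (\<omega> x))"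
    have G0: "0 \<le> G" by (simp add: G_def nrm_nonneg)
    have d: "norm ((LINT x|dA. v m x * g x) - (LINT x|dA. v n x * g x)) \<le> sqrt (e n) * G" if "n \<le> m" for n m
    proof -
      have "(LINT x|dA. v m x * g x) - (LINT x|dA. v n x * g x) = (LINT x|dA. (v m x - v n x) * g x)"
        using pairing_bound(2)[OF g L2v] by (simp add: left_diff_distrib)
      also have "norm \<dots> \<le> nrm (\<lambda>x. v m x - v n x) * G"
        unfolding G_def by (rule pairing_bound(1)[OF g L2_diff[OF L2v L2v]])
      also have "\<dots> \<le> sqrt (e n) * G"
        unfolding nrm_def by (intro mult_right_mono real_sqrt_le_mono cauchy that G0)
      finally show ?thesis .
    qed
    have "(\<lambda>n. sqrt (e n) * G) \<longlonglongrightarrow> sqrt 0 * G" by (intro tendsto_intros e)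
    then have lim: "(\<lambda>n. sqrt (e n) * G) \<longlonglongrightarrow> 0" by simp
    have "Cauchy (\<lambda>n. LINT x|dA. v n x * g x)"
    proof (rule metric_CauchyI)
      fix r :: real assume "0 < r"
      then obtain N where N: "sqrt (e N) * G < r / 2"
        using order_tendstoD(2)[OF lim, of "r / 2"] by (auto simp: eventually_sequentially)
      have "dist (LINT x|dA. v m x * g x) (LINT x|dA. v n x * g x) < r" if "N \<le> m" "N \<le> n" for m n
      proof -
        have "dist (LINT x|dA. v m x * g x) (LINT x|dA. v n x * g x) \<le> dist (LINT x|dA. v m x * g x) (LINT x|dA. v N x * g x) + dist (LINT x|dA. v n x * g x) (LINT x|dA. v N x * g x)"
          by (rule dist_triangle2)
        also have "\<dots> < r" using d[OF that(1)] d[OF that(2)] N by (simp add: dist_norm)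
        finally show ?thesis .
      qed
      then show "\<exists>M. \<forall>m\<ge>M. \<forall>n\<ge>M. dist (LINT x|dA. v m x * g x) (LINT x|dA. v n x * g x) < r" by blast
    qed
    then show ?thesis by (rule Cauchy_convergent)
  qed
  have null: "(\<lambda>n. LINT x|dA. v n x * dzb g x) \<longlonglongrightarrow> 0" if g: "test 2 g" for g
  proof -
    obtain b where b: "test 2 b" "\<And>v. ip v (delta b) = - (LINT x|dA. v x * dzb g x)"
      using dual_test[OF g] by blast
    show ?thesis using tendsto_minus[OF weak[OF b(1)]] by (simp add: b(2))
  qed
  define c where "c w r n = (LINT x|dA. v n x * of_real (chi w r x))" for w r n
  have chi0: "test 0 (\<lambda>x. of_real (chi w r x))" if "0 < r" "norm w + r < 1" for w r
    using test_le[OF chi_test[OF that]] by simp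
  \<comment> \<open>The difference of the mollifiers is \<open>dzb\<close> of
    \<open>chi_primitive\<close>, against which the sequence tends to 0 weakly. This plays the part
    of the mean value property.\<close>
  have indep: "(\<lambda>n. c w s n - c w r n) \<longlonglongrightarrow> 0" if "0 < s" "s < r" "norm w + r < 1" for w r s
  proof -
    have k: "test 2 (chi_primitive w r s)"
      using wirtinger_ker(2)[OF that(1,2) open_ball] vanish_ker[OF that] by (simp add: test_def del: Ck.simps)
    have "(LINT x|dA. v n x * dzb (chi_primitive w r s) x) = c w s n - c w r n" for n
    proof -
      have "(LINT x|dA. v n x * dzb (chi_primitive w r s) x) = (LINT x|dA. v n x * of_real (chi w s x) - v n x * of_real (chi w r x))"
        by (rule Bochner_Integration.integral_cong[OF refl])
           (simp add: has_wirtinger_imp(3)[OF wirtinger_ker(1)[OF that(1,2)]] right_diff_distrib)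
      also have "\<dots> = c w s n - c w r n" unfolding c_def
        by (rule Bochner_Integration.integral_diff) (use pairing_bound(2)[OF chi0 L2v] that in auto)
      finally show ?thesis .
    qed
    then show ?thesis using null[OF k] by simp
  qed
  \<comment> \<open>The radius is merely one admissible choice at each point; by
    \<open>indep\<close> every other one gives the same limit, so one radius can serve for all
    points near a given \<open>w\<close>.\<close>
  define F where "F w = lim (c w ((1 - norm w) / 2)) / of_real bump_mass" for w
  have mass0: "complex_of_real bump_mass \<noteq> 0" using bump_mass_pos by simp
  have F: "c w r \<longlonglongrightarrow> of_real bump_mass * F w" if r: "0 < r" "norm w + r < 1" for w r
  proof -
    define s where "s = (1 - norm w) / 2"
    have s: "0 < s" "norm w + s < 1" using r by (auto simp: s_def field_simps)
    have "c w s \<longlonglongrightarrow> lim (c w s)"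
      using conv[OF chi0[OF s]] unfolding c_def[abs_def] convergent_LIMSEQ_iff .
    then have cs: "c w s \<longlonglongrightarrow> of_real bump_mass * F w"
      using mass0 by (simp add: F_def s_def)
    consider "r = s" | "r < s" | "s < r" by linarith
    then show ?thesis
    proof cases
      case 2
      from tendsto_add[OF indep[OF r(1) 2 s(2)] cs] show ?thesis by simp
    next
      case 3
      from tendsto_diff[OF cs indep[OF s(1) 3 r(2)]] show ?thesis by simp
    qed (use cs in simp)
  qed
  have holo: "F holomorphic_on unit_disk"
  proof -
    have "\<exists>D. (F has_field_derivative D) (at w)" if w: "w \<in> unit_disk" for w
    proof -
      \<comment> \<open>Room is left for the radius 3 r, the support of the majorant
        \<open>k\<close> below.\<close>
      define r where "r = (1 - norm w) / 4"
      have r: "0 < r" "norm w + 3 * r < 1" "r < 1" using w by (auto simp: r_def field_simps add_nonneg_pos)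
      have wr: "norm w + r < 1" using r by simp
      \<comment> \<open>The coefficient of \<open>t\<close> in the expansion of the mollifier. The
        coefficient of \<open>cnj t\<close> is \<open>- dzb\<close> of the mollifier, whose pairings
        tend to 0; this is why the limit is complex differentiable.\<close>
      define G where "G x = of_real (12 * bump w r x ^ 2 / r ^ 4) * cnj (x - w)" for x
      have G: "test 0 G"
        unfolding test_def Ck.simps
      proof
        show "continuous_on unit_disk G"
          unfolding G_def divide_inverse by (intro continuous_intros)
        show "vanish G" by (rule vanish_near[OF wr]) (use r in \<open>simp add: G_def bump_eq_0\<close>)
      qed
      obtain D where D: "(\<lambda>n. LINT x|dA. v n x * G x) \<longlonglongrightarrow> D"
        using conv[OF G] by (auto simp: convergent_def)
      \<comment> \<open>A continuous majorant of the indicator of the disk of radius 2 r, which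
        contains both mollifiers' supports: there the bump of radius 3 r is at least 1 - 4/9 =
        5/9.\<close>
      define k where "k x = complex_of_real (9 / 5 * bump w (3 * r) x)" for x
      have k: "test 0 k"
        unfolding test_def Ck.simps
      proof
        show "continuous_on unit_disk k" unfolding k_def by (intro continuous_intros)
        show "vanish k" by (rule vanish_near[OF r(2)]) (use r in \<open>simp add: k_def bump_eq_0\<close>)
      qed
      define Cr where "Cr = 4 / r\<^sup>2 * (75 / r ^ 4 + 3 / r\<^sup>2)"
      have Cr0: "0 \<le> Cr" by (simp add: Cr_def)
      define Q where "Q = Cr * (B * nrm (\<lambda>x. cnj (k x) / of_real (\<omega> x)))"
      \<comment> \<open>The remainder is estimated for each \<open>v n\<close> with a constant free
        of \<open>n\<close>, by the uniform bound \<open>B\<close> on the norms, before passing to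
        the limit.\<close>
      have quad: "norm (of_real bump_mass * F (w + t) - of_real bump_mass * F w - t * D) \<le> Q * (norm t)\<^sup>2" if t: "norm t < r" for t
      proof -
        have wt: "norm (w + t) + r < 1"
          using norm_triangle_ineq[of w t] t r by linarith
        define E where "E x = complex_of_real (chi (w + t) r x) - of_real (chi w r x) - t * G x - cnj t * (- dzb (\<lambda>x. of_real (chi w r x)) x)" for x
        have Ebound: "norm (E x) \<le> Cr * (norm t)\<^sup>2 * norm (k x)" if x: "x \<in> unit_disk" for x
        proof -
          have "E x = of_real (chi (w + t) r x - chi w r x - 12 * bump w r x ^ 2 / r ^ 4 * (2 * Re (cnj t * (x - w))))"
          proof -
            have "complex_of_real (2 * Re (cnj t * (x - w))) = t * cnj (x - w) + cnj t * (x - w)"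
              by (simp add: complex_eq_iff algebra_simps)
            moreover define C' where "C' = complex_of_real (12 * bump w r x ^ 2 / r ^ 4)"
            ultimately have eqc: "complex_of_real (12 * bump w r x ^ 2 / r ^ 4 * (2 * Re (cnj t * (x - w)))) = C' * (t * cnj (x - w) + cnj t * (x - w))"
              by (simp only: of_real_mult)
            show ?thesis unfolding E_def G_def dzb_chi of_real_diff eqc C'_def[symmetric] by (simp add: algebra_simps)
          qed
          note eq = this
          show ?thesis
          proof (cases "norm (x - w) < 2 * r")
            case True
            have xw: "norm (x - w) \<le> 2" using norm_triangle_ineq4[of x w] x w by simp
            have "norm (E x) \<le> Cr * (norm t)\<^sup>2"
              unfolding eq norm_of_real Cr_def by (rule chi_first_order[OF r(1) xw]) (use t r in simp)
            moreover have "1 \<le> norm (k x)"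
            proof -
              have "(norm (x - w))\<^sup>2 \<le> (2 * r)\<^sup>2" using True by (intro power_mono) auto
              then have "5 / 9 \<le> 1 - (norm (x - w))\<^sup>2 / (3 * r)\<^sup>2" using r by (simp add: power_mult_distrib field_simps)
              also have "\<dots> \<le> bump w (3 * r) x" by (simp add: bump_def)
              finally show ?thesis by (simp add: k_def norm_mult)
            qed
            ultimately show ?thesis
              using mult_left_mono[of 1 "norm (k x)" "Cr * (norm t)\<^sup>2"] Cr0 by simp
          next
            case False
            have "norm (x - w) \<le> norm (x - (w + t)) + norm t"
              using norm_triangle_ineq[of "x - (w + t)" t] by simp
            then have "r \<le> norm (x - (w + t))" using False t by simp
            then have "E x = 0" unfolding eq using False r chi_eq_0[OF r(1)] bump_eq_0[OF r(1)] by simp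
            then show ?thesis using Cr0 by simp
          qed
        qed
        have iE: "(LINT x|dA. v n x * E x) = c (w + t) r n - c w r n - t * (LINT x|dA. v n x * G x) + cnj t * (LINT x|dA. v n x * dzb (\<lambda>x. of_real (chi w r x)) x)"
          and intE: "integrable dA (\<lambda>x. v n x * E x)" for n
        proof -
          have d0: "test 0 (dzb (\<lambda>x. of_real (chi w r x)))"
            using test_le[OF test_dzb[OF chi_test[OF r(1) wr]]] by simp
          note i = pairing_bound(2)[OF chi0[OF r(1) wt] L2v[of n]] pairing_bound(2)[OF chi0[OF r(1) wr] L2v[of n]]
             pairing_bound(2)[OF G L2v[of n]] pairing_bound(2)[OF d0 L2v[of n]]
          have eq: "v n x * E x = v n x * of_real (chi (w + t) r x) - v n x * of_real (chi w r x) - t * (v n x * G x) + cnj t * (v n x * dzb (\<lambda>x. of_real (chi w r x)) x)" for x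
            by (simp add: E_def algebra_simps)
          show "integrable dA (\<lambda>x. v n x * E x)" unfolding eq using i by auto
          show "(LINT x|dA. v n x * E x) = c (w + t) r n - c w r n - t * (LINT x|dA. v n x * G x) + cnj t * (LINT x|dA. v n x * dzb (\<lambda>x. of_real (chi w r x)) x)"
            unfolding eq c_def using i by simp
        qed
        have lim: "(\<lambda>n. LINT x|dA. v n x * E x) \<longlonglongrightarrow> of_real bump_mass * F (w + t) - of_real bump_mass * F w - t * D + cnj t * 0"
          unfolding iE by (intro tendsto_intros F r wt wr D null chi_test)
        have "norm (LINT x|dA. v n x * E x) \<le> Q * (norm t)\<^sup>2" for n
        proof -
          have "norm (LINT x|dA. v n x * E x) \<le> (LINT x|dA. norm (v n x * E x))" by (rule integral_norm_bound)
          also have "\<dots> \<le> (LINT x|dA. (Cr * (norm t)\<^sup>2) * norm (v n x * k x))"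
          proof (rule integral_mono)
            show "integrable dA (\<lambda>x. norm (v n x * E x))" using intE by (rule integrable_norm)
            show "integrable dA (\<lambda>x. (Cr * (norm t)\<^sup>2) * norm (v n x * k x))"
              using pairing_bound(2)[OF k L2v[of n]] by (intro Bochner_Integration.integrable_mult_right integrable_norm)
            fix x assume "x \<in> space dA"
            then show "norm (v n x * E x) \<le> (Cr * (norm t)\<^sup>2) * norm (v n x * k x)"
              using mult_left_mono[OF Ebound[of x] norm_ge_zero[of "v n x"]] by (simp add: norm_mult mult_ac)
          qed
          also have "\<dots> = (Cr * (norm t)\<^sup>2) * (LINT x|dA. norm (v n x * k x))"
            by (rule integral_mult_right_zero)
          also have "\<dots> \<le> (Cr * (norm t)\<^sup>2) * (B * nrm (\<lambda>x. cnj (k x) / of_real (\<omega> x)))"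
            using Cr0 by (intro mult_left_mono order_trans[OF pairing_bound(3)[OF k L2v] mult_right_mono[OF nB]] nrm_nonneg) auto
          finally show ?thesis by (simp add: Q_def mult_ac)
        qed
        then show ?thesis
          using Lim_bounded[OF tendsto_norm[OF lim], of 0 "Q * (norm t)\<^sup>2"] by simp
      qed
      have "(F has_field_derivative (D / of_real bump_mass)) (at w)"
        unfolding DERIV_def
      proof (rule LIM_zero_cancel, rule Lim_null_comparison)
        show "\<forall>\<^sub>F t in at 0. norm ((F (w + t) - F w) / t - D / of_real bump_mass) \<le> Q / bump_mass * norm t"
        proof -
          have "norm ((F (w + t) - F w) / t - D / of_real bump_mass) \<le> Q / bump_mass * norm t" if "norm t < r" "t \<noteq> 0" for t
          proof -
            have "(F (w + t) - F w) / t - D / of_real bump_mass = (of_real bump_mass * F (w + t) - of_real bump_mass * F w - t * D) / (t * of_real bump_mass)"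
              using that mass0 by (simp add: field_simps)
            also have "norm \<dots> = norm (of_real bump_mass * F (w + t) - of_real bump_mass * F w - t * D) / (norm t * bump_mass)"
              using bump_mass_pos by (simp add: norm_divide norm_mult)
            also have "\<dots> \<le> Q * (norm t)\<^sup>2 / (norm t * bump_mass)"
              using bump_mass_pos by (intro divide_right_mono quad that) auto
            also have "\<dots> = Q / bump_mass * norm t" using that by (simp add: power2_eq_square)
            finally show ?thesis .
          qed
          then show ?thesis using r(1) by (auto simp: eventually_at intro!: exI[of _ r])
        qed
        show "((\<lambda>t. Q / bump_mass * norm t) \<longlongrightarrow> 0) (at 0)"
          by (rule tendsto_eq_intros | simp)+
      qed
      then show ?thesis by blast
    qed
    then show ?thesis by (auto simp: holomorphic_on_open)
  qed
  have Fm [measurable]: "F \<in> borel_measurable dA"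
    by (rule continuous_imp_measurable_dA[OF holomorphic_on_imp_continuous_on[OF holo]])
  have vm [measurable]: "v n \<in> borel_measurable dA" for n by (rule continuous_imp_measurable_dA[OF cont])
  have cbm [measurable]: "cball (0::complex) t \<in> sets borel" for t by simp
  \<comment> \<open>On a compact subdisk \<omega> is bounded below, so the weighted Cauchy property
    becomes an unweighted one, to which the mollification bound applies. The constant depends on R
    and is removed afterwards.\<close>
  have loc: "\<exists>A. 0 \<le> A \<and> (\<forall>n. (\<integral>\<^sup>+w. ennreal ((norm (F w - v n w))\<^sup>2) * indicator (cball 0 R) w \<partial>dA) \<le> ennreal (A * e n))" if R: "0 \<le> R" "R < 1" for R
  proof -
    define S where "S = (1 + R) / 2"
    have S: "0 \<le> S" "S < 1" "R < S" using R by (auto simp: S_def)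
    have "compact (\<omega> ` cball 0 S)" "\<omega> ` cball 0 S \<noteq> {}"
      by (intro compact_continuous_image continuous_on_subset[OF omega_cont]) (use S in auto)
    then obtain m where m: "m \<in> \<omega> ` cball 0 S" "\<And>y. y \<in> \<omega> ` cball 0 S \<Longrightarrow> m \<le> y"
      using compact_attains_inf by metis
    have m0: "0 < m" using m(1) omega_pos S by auto
    have fin: "(\<integral>\<^sup>+x. ennreal ((norm (v k x - v n x))\<^sup>2) * indicator (cball 0 S) x \<partial>dA) \<le> ennreal (e n / m)" if "n \<le> k" for n k
    proof -
      have "(\<integral>\<^sup>+x. ennreal ((norm (v k x - v n x))\<^sup>2) * indicator (cball 0 S) x \<partial>dA) \<le> (\<integral>\<^sup>+x. ennreal ((norm (v k x - v n x))\<^sup>2 * \<omega> x / m) \<partial>dA)"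
      proof (rule nn_integral_mono)
        fix x assume "x \<in> space dA"
        then have x: "x \<in> unit_disk" by simp
        show "ennreal ((norm (v k x - v n x))\<^sup>2) * indicator (cball 0 S) x \<le> ennreal ((norm (v k x - v n x))\<^sup>2 * \<omega> x / m)"
        proof (cases "x \<in> cball 0 S")
          case True
          then have "1 \<le> \<omega> x / m" using m(2)[of "\<omega> x"] m0 by simp
          from mult_left_mono[OF this, of "(norm (v k x - v n x))\<^sup>2"] show ?thesis using True by (simp add: ennreal_leI)
        qed simp
      qed
      also have "\<dots> = ennreal (LINT x|dA. (norm (v k x - v n x))\<^sup>2 * \<omega> x / m)"
        by (rule nn_integral_eq_integral)
           (use L2_diff[OF L2v L2v] m0 in \<open>auto simp: L2_def intro!: AE_I2 divide_nonneg_pos mult_nonneg_nonneg less_imp_le[OF omega_pos]\<close>)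
      also have "(LINT x|dA. (norm (v k x - v n x))\<^sup>2 * \<omega> x / m) = sq (\<lambda>x. v k x - v n x) / m"
        by (simp add: sq_def)
      also have "ennreal \<dots> \<le> ennreal (e n / m)"
        using m0 by (intro ennreal_leI divide_right_mono cauchy that) auto
      finally show ?thesis .
    qed
    define r where "r j = (1 - R) / 2 / real (Suc (Suc j))" for j
    have r: "0 < r j" "r j \<le> (1 - R) / 2" for j
    proof -
      show "0 < r j" using R by (simp add: r_def)
      have "(1 - R) / 2 / real (Suc (Suc j)) \<le> (1 - R) / 2 / 1"
        by (rule divide_left_mono) (use R in auto)
      then show "r j \<le> (1 - R) / 2" by (simp only: r_def div_by_1)
    qed
    have rlim: "r \<longlonglongrightarrow> 0"
    proof -
      have "(\<lambda>n. (1 - R) / 2 * inverse (real (Suc (Suc n)))) \<longlonglongrightarrow> (1 - R) / 2 * 0"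
        by (intro tendsto_mult tendsto_const LIMSEQ_Suc[OF LIMSEQ_inverse_real_of_nat])
      then show ?thesis by (simp only: r_def[abs_def] divide_inverse mult_zero_right)
    qed
    have wr: "norm w + r j < 1" if "w \<in> cball 0 R" for w j
      using that r(2)[of j] R by (simp add: field_simps)
    have cm [measurable]: "(\<lambda>w. c w s n) \<in> borel_measurable dA" for s n
    proof -
      have "(\<lambda>(w, x). v n x * complex_of_real (chi w s x)) \<in> borel_measurable (dA \<Otimes>\<^sub>M dA)"
        unfolding chi_def bump_def by measurable
      then show ?thesis unfolding c_def by (intro dA.borel_measurable_lebesgue_integral) (simp add: split_def)
    qed
    have step1: "(\<integral>\<^sup>+w. ennreal ((norm (c w (r j) k - c w (r j) n))\<^sup>2) * indicator (cball 0 R) w \<partial>dA) \<le> ennreal (bump_mass\<^sup>2 * (e n / m))" if nk: "n \<le> k" for j n k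
    proof -
      have "(\<integral>\<^sup>+w. ennreal ((norm (c w (r j) k - c w (r j) n))\<^sup>2) * indicator (cball 0 R) w \<partial>dA)
          = (\<integral>\<^sup>+w. ennreal ((norm (LINT x|dA. (v k x - v n x) * of_real (chi w (r j) x)))\<^sup>2) * indicator (cball 0 R) w \<partial>dA)"
      proof (rule nn_integral_cong)
        fix w
        show "ennreal ((norm (c w (r j) k - c w (r j) n))\<^sup>2) * indicator (cball 0 R) w = ennreal ((norm (LINT x|dA. (v k x - v n x) * of_real (chi w (r j) x)))\<^sup>2) * indicator (cball 0 R) w"
        proof (cases "w \<in> cball 0 R")
          case True
          note p = pairing_bound(2)[OF chi0[OF r(1) wr[OF True]] L2v]
          have "(LINT x|dA. (v k x - v n x) * of_real (chi w (r j) x)) = c w (r j) k - c w (r j) n"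
            unfolding c_def using p by (simp add: left_diff_distrib)
          then show ?thesis by simp
        qed simp
      qed
      also have "\<dots> \<le> ennreal (bump_mass\<^sup>2) * (\<integral>\<^sup>+x. ennreal ((norm (v k x - v n x))\<^sup>2) * indicator (cball 0 S) x \<partial>dA)"
        unfolding S_def by (rule chi_convolution_bound[OF continuous_on_diff[OF cont cont] R r])
      also have "\<dots> \<le> ennreal (bump_mass\<^sup>2) * ennreal (e n / m)"
        by (rule mult_left_mono[OF fin[OF nk]]) simp
      finally show ?thesis using e0[of n] m0 by (subst ennreal_mult) simp_all
    qed
    \<comment> \<open>Fatou's lemma in the index \<open>k\<close>, at a fixed mollification radius,
      where the pointwise limit is known to be \<open>F\<close>.\<close>
    have step2: "(\<integral>\<^sup>+w. ennreal ((norm (of_real bump_mass * F w - c w (r j) n))\<^sup>2) * indicator (cball 0 R) w \<partial>dA) \<le> ennreal (bump_mass\<^sup>2 * (e n / m))" for j n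
    proof -
      have "(\<integral>\<^sup>+w. ennreal ((norm (of_real bump_mass * F w - c w (r j) n))\<^sup>2) * indicator (cball 0 R) w \<partial>dA)
          = (\<integral>\<^sup>+w. liminf (\<lambda>k. ennreal ((norm (c w (r j) k - c w (r j) n))\<^sup>2) * indicator (cball 0 R) w) \<partial>dA)"
      proof (rule nn_integral_cong)
        fix w
        show "ennreal ((norm (of_real bump_mass * F w - c w (r j) n))\<^sup>2) * indicator (cball 0 R) w = liminf (\<lambda>k. ennreal ((norm (c w (r j) k - c w (r j) n))\<^sup>2) * indicator (cball 0 R) w)"
        proof (cases "w \<in> cball 0 R")
          case True
          have "(\<lambda>k. ennreal ((norm (c w (r j) k - c w (r j) n))\<^sup>2)) \<longlonglongrightarrow> ennreal ((norm (of_real bump_mass * F w - c w (r j) n))\<^sup>2)"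
            by (intro tendsto_ennrealI tendsto_power tendsto_norm tendsto_diff tendsto_const F r wr True)
          from lim_imp_Liminf[OF _ this] show ?thesis using True by simp
        qed (simp add: Liminf_const)
      qed
      also have "\<dots> \<le> liminf (\<lambda>k. \<integral>\<^sup>+w. ennreal ((norm (c w (r j) k - c w (r j) n))\<^sup>2) * indicator (cball 0 R) w \<partial>dA)"
        by (rule nn_integral_liminf) measurable
      also have "\<dots> \<le> ennreal (bump_mass\<^sup>2 * (e n / m))"
        by (rule Liminf_le) (use step1 in \<open>auto simp: eventually_sequentially\<close>)
      finally show ?thesis .
    qed
    \<comment> \<open>Fatou's lemma again, now as the radius tends to 0: the mollified
      \<open>v n\<close> tends to \<open>v n\<close> pointwise by continuity.\<close>
    have step3: "(\<integral>\<^sup>+w. ennreal ((norm (of_real bump_mass * F w - of_real bump_mass * v n w))\<^sup>2) * indicator (cball 0 R) w \<partial>dA) \<le> ennreal (bump_mass\<^sup>2 * (e n / m))" for n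
    proof -
      have "(\<integral>\<^sup>+w. ennreal ((norm (of_real bump_mass * F w - of_real bump_mass * v n w))\<^sup>2) * indicator (cball 0 R) w \<partial>dA)
          = (\<integral>\<^sup>+w. liminf (\<lambda>j. ennreal ((norm (of_real bump_mass * F w - c w (r j) n))\<^sup>2) * indicator (cball 0 R) w) \<partial>dA)"
      proof (rule nn_integral_cong)
        fix w assume "w \<in> space dA"
        then have w: "w \<in> unit_disk" by simp
        have "(\<lambda>j. c w (r j) n) \<longlonglongrightarrow> of_real bump_mass * v n w"
          unfolding c_def by (rule chi_tendsto[OF cont w r(1) rlim])
        then have "(\<lambda>j. ennreal ((norm (of_real bump_mass * F w - c w (r j) n))\<^sup>2) * indicator (cball 0 R) w) \<longlonglongrightarrow> ennreal ((norm (of_real bump_mass * F w - of_real bump_mass * v n w))\<^sup>2) * indicator (cball 0 R) w"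
          by (cases "w \<in> cball 0 R") (auto intro!: tendsto_ennrealI tendsto_power tendsto_norm tendsto_diff)
        from lim_imp_Liminf[OF _ this]
        show "ennreal ((norm (of_real bump_mass * F w - of_real bump_mass * v n w))\<^sup>2) * indicator (cball 0 R) w = liminf (\<lambda>j. ennreal ((norm (of_real bump_mass * F w - c w (r j) n))\<^sup>2) * indicator (cball 0 R) w)"
          by simp
      qed
      also have "\<dots> \<le> liminf (\<lambda>j. \<integral>\<^sup>+w. ennreal ((norm (of_real bump_mass * F w - c w (r j) n))\<^sup>2) * indicator (cball 0 R) w \<partial>dA)"
        by (rule nn_integral_liminf) measurable
      also have "\<dots> \<le> ennreal (bump_mass\<^sup>2 * (e n / m))"
        by (rule Liminf_le) (use step2 in auto)
      finally show ?thesis .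
    qed
    have "(\<integral>\<^sup>+w. ennreal ((norm (F w - v n w))\<^sup>2) * indicator (cball 0 R) w \<partial>dA) \<le> ennreal (1 / m * e n)" for n
    proof -
      have "(\<integral>\<^sup>+w. ennreal ((norm (F w - v n w))\<^sup>2) * indicator (cball 0 R) w \<partial>dA)
         = (\<integral>\<^sup>+w. ennreal (1 / bump_mass\<^sup>2) * (ennreal ((norm (of_real bump_mass * F w - of_real bump_mass * v n w))\<^sup>2) * indicator (cball 0 R) w) \<partial>dA)"
      proof (rule nn_integral_cong)
        fix w
        have "(norm (F w - v n w))\<^sup>2 = 1 / bump_mass\<^sup>2 * (norm (of_real bump_mass * F w - of_real bump_mass * v n w))\<^sup>2"
          using bump_mass_pos by (simp add: right_diff_distrib[symmetric] norm_mult power_mult_distrib)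
        then have "ennreal ((norm (F w - v n w))\<^sup>2) = ennreal (1 / bump_mass\<^sup>2) * ennreal ((norm (of_real bump_mass * F w - of_real bump_mass * v n w))\<^sup>2)"
          by (simp only:) (rule ennreal_mult, auto)
        then show "ennreal ((norm (F w - v n w))\<^sup>2) * indicator (cball 0 R) w = ennreal (1 / bump_mass\<^sup>2) * (ennreal ((norm (of_real bump_mass * F w - of_real bump_mass * v n w))\<^sup>2) * indicator (cball 0 R) w)"
          by (simp only: mult.assoc)
      qed
      also have "\<dots> = ennreal (1 / bump_mass\<^sup>2) * (\<integral>\<^sup>+w. ennreal ((norm (of_real bump_mass * F w - of_real bump_mass * v n w))\<^sup>2) * indicator (cball 0 R) w \<partial>dA)"
        by (rule nn_integral_cmult) measurable
      also have "\<dots> \<le> ennreal (1 / bump_mass\<^sup>2) * ennreal (bump_mass\<^sup>2 * (e n / m))"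
        by (rule mult_left_mono[OF step3]) simp
      also have "\<dots> = ennreal (1 / m * e n)"
        using bump_mass_pos e0[of n] m0 by (simp add: ennreal_mult[symmetric])
      finally show ?thesis .
    qed
    then show ?thesis using m0 by (intro exI[of _ "1 / m"]) auto
  qed
  have loc2: "(\<integral>\<^sup>+w. ennreal ((norm (F w - v n w))\<^sup>2 * \<omega> w) * indicator (cball 0 R) w \<partial>dA) \<le> ennreal (2 * e n)" if R: "0 \<le> R" "R < 1" for R n
  proof -
    obtain A where A: "0 \<le> A" "\<And>n. (\<integral>\<^sup>+w. ennreal ((norm (F w - v n w))\<^sup>2) * indicator (cball 0 R) w \<partial>dA) \<le> ennreal (A * e n)"
      using loc[OF R] by blast
    have "compact (\<omega> ` cball 0 R)"
      by (intro compact_continuous_image continuous_on_subset[OF omega_cont]) (use R in auto)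
    then obtain W where W: "\<And>x. x \<in> cball 0 R \<Longrightarrow> norm (\<omega> x) \<le> W"
      by (meson bounded_iff compact_imp_bounded imageI)
    have W0: "0 \<le> W" using W[of 0] R by (force intro: order_trans[OF norm_ge_zero])
    \<comment> \<open>Passing through \<open>v k\<close> confines the constants depending on R to a
      term that vanishes as \<open>k\<close> grows. What remains is \<open>2 * e n\<close>, the 2
      coming from (a + b)^2 \<le> 2 a^2 + 2 b^2.\<close>
    have b: "(\<integral>\<^sup>+w. ennreal ((norm (F w - v n w))\<^sup>2 * \<omega> w) * indicator (cball 0 R) w \<partial>dA) \<le> ennreal (2 * W * A * e k + 2 * e n)" if nk: "n \<le> k" for k
    proof -
      have "(\<integral>\<^sup>+w. ennreal ((norm (F w - v n w))\<^sup>2 * \<omega> w) * indicator (cball 0 R) w \<partial>dA)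
        \<le> (\<integral>\<^sup>+w. ennreal (2 * W) * (ennreal ((norm (F w - v k w))\<^sup>2) * indicator (cball 0 R) w) + ennreal (2 * ((norm (v k w - v n w))\<^sup>2 * \<omega> w)) \<partial>dA)"
      proof (rule nn_integral_mono)
        fix w assume "w \<in> space dA"
        then have w: "0 < \<omega> w" using omega_pos by simp
        show "ennreal ((norm (F w - v n w))\<^sup>2 * \<omega> w) * indicator (cball 0 R) w \<le> ennreal (2 * W) * (ennreal ((norm (F w - v k w))\<^sup>2) * indicator (cball 0 R) w) + ennreal (2 * ((norm (v k w - v n w))\<^sup>2 * \<omega> w))"
        proof (cases "w \<in> cball 0 R")
          case True
          have "norm (F w - v n w) \<le> norm (F w - v k w) + norm (v k w - v n w)"
            using norm_triangle_ineq[of "F w - v k w" "v k w - v n w"] by simp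
          then have "(norm (F w - v n w))\<^sup>2 \<le> (norm (F w - v k w) + norm (v k w - v n w))\<^sup>2" by (rule power_mono) simp
          also have "\<dots> \<le> 2 * (norm (F w - v k w))\<^sup>2 + 2 * (norm (v k w - v n w))\<^sup>2"
            using sum_squares_bound[of "norm (F w - v k w)" "norm (v k w - v n w)"] by (simp add: power2_sum)
          finally have "(norm (F w - v n w))\<^sup>2 * \<omega> w \<le> (2 * (norm (F w - v k w))\<^sup>2 + 2 * (norm (v k w - v n w))\<^sup>2) * \<omega> w"
            using w by (intro mult_right_mono) auto
          also have "\<dots> = 2 * \<omega> w * (norm (F w - v k w))\<^sup>2 + 2 * ((norm (v k w - v n w))\<^sup>2 * \<omega> w)" by (simp add: algebra_simps)
          also have "\<dots> \<le> 2 * W * (norm (F w - v k w))\<^sup>2 + 2 * ((norm (v k w - v n w))\<^sup>2 * \<omega> w)"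
            using W[OF True] by (intro add_right_mono mult_right_mono) auto
          finally have "ennreal ((norm (F w - v n w))\<^sup>2 * \<omega> w) \<le> ennreal (2 * W * (norm (F w - v k w))\<^sup>2 + 2 * ((norm (v k w - v n w))\<^sup>2 * \<omega> w))"
            by (rule ennreal_leI)
          also have "\<dots> = ennreal (2 * W) * ennreal ((norm (F w - v k w))\<^sup>2) + ennreal (2 * ((norm (v k w - v n w))\<^sup>2 * \<omega> w))"
            using W0 w by (subst ennreal_plus) (auto simp: ennreal_mult)
          finally show ?thesis using True by simp
        qed simp
      qed
      also have "\<dots> = (\<integral>\<^sup>+w. ennreal (2 * W) * (ennreal ((norm (F w - v k w))\<^sup>2) * indicator (cball 0 R) w) \<partial>dA) + (\<integral>\<^sup>+w. ennreal (2 * ((norm (v k w - v n w))\<^sup>2 * \<omega> w)) \<partial>dA)"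
        by (rule nn_integral_add) measurable
      also have "(\<integral>\<^sup>+w. ennreal (2 * W) * (ennreal ((norm (F w - v k w))\<^sup>2) * indicator (cball 0 R) w) \<partial>dA) = ennreal (2 * W) * (\<integral>\<^sup>+w. ennreal ((norm (F w - v k w))\<^sup>2) * indicator (cball 0 R) w \<partial>dA)"
        by (rule nn_integral_cmult) measurable
      also have "(\<integral>\<^sup>+w. ennreal (2 * ((norm (v k w - v n w))\<^sup>2 * \<omega> w)) \<partial>dA) = ennreal (LINT w|dA. 2 * ((norm (v k w - v n w))\<^sup>2 * \<omega> w))"
        by (rule nn_integral_eq_integral)
           (use L2_diff[OF L2v L2v] in \<open>auto simp: L2_def intro!: AE_I2 mult_nonneg_nonneg less_imp_le[OF omega_pos]\<close>)
      also have "(LINT w|dA. 2 * ((norm (v k w - v n w))\<^sup>2 * \<omega> w)) = 2 * sq (\<lambda>x. v k x - v n x)" by (simp add: sq_def)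
      also have "ennreal (2 * W) * (\<integral>\<^sup>+w. ennreal ((norm (F w - v k w))\<^sup>2) * indicator (cball 0 R) w \<partial>dA) + ennreal (2 * sq (\<lambda>x. v k x - v n x)) \<le> ennreal (2 * W) * ennreal (A * e k) + ennreal (2 * e n)"
        by (intro add_mono mult_left_mono A ennreal_leI cauchy nk) auto
      also have "\<dots> = ennreal (2 * W * A * e k + 2 * e n)"
        using W0 A(1) e0[of k] e0[of n] by (subst ennreal_plus) (auto simp: ennreal_mult mult.assoc)
      finally show ?thesis .
    qed
    have "(\<lambda>k. ennreal (2 * W * A * e k + 2 * e n)) \<longlonglongrightarrow> ennreal (2 * W * A * 0 + 2 * e n)"
      by (intro tendsto_ennrealI tendsto_intros e)
    from LIMSEQ_le_const[OF this] b show ?thesis by auto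
  qed
  \<comment> \<open>The local bound no longer depends on the radius, so the disk can be
    exhausted.\<close>
  have glob: "(\<integral>\<^sup>+w. ennreal ((norm (F w - v n w))\<^sup>2 * \<omega> w) \<partial>dA) \<le> ennreal (2 * e n)" for n
  proof -
    define R where "R j = 1 - 1 / real (Suc j)" for j
    have R: "0 \<le> R j" "R j < 1" for j by (auto simp: R_def field_simps)
    have Rlim: "R \<longlonglongrightarrow> 1"
    proof -
      have "(\<lambda>j. 1 - inverse (real (Suc j))) \<longlonglongrightarrow> 1 - 0"
        by (intro tendsto_diff tendsto_const LIMSEQ_inverse_real_of_nat)
      then show ?thesis by (simp add: R_def[abs_def] inverse_eq_divide)
    qed
    have "(\<integral>\<^sup>+w. ennreal ((norm (F w - v n w))\<^sup>2 * \<omega> w) \<partial>dA) = (\<integral>\<^sup>+w. liminf (\<lambda>j. ennreal ((norm (F w - v n w))\<^sup>2 * \<omega> w) * indicator (cball 0 (R j)) w) \<partial>dA)"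
    proof (rule nn_integral_cong)
      fix w assume "w \<in> space dA"
      then have w: "norm w < 1" by simp
      have "\<forall>\<^sub>F j in sequentially. norm w < R j" by (rule order_tendstoD(1)[OF Rlim w])
      then have "(\<lambda>j. ennreal ((norm (F w - v n w))\<^sup>2 * \<omega> w) * indicator (cball 0 (R j)) w) \<longlonglongrightarrow> ennreal ((norm (F w - v n w))\<^sup>2 * \<omega> w)"
        by (intro tendsto_eventually) (auto elim!: eventually_mono)
      from lim_imp_Liminf[OF _ this] show "ennreal ((norm (F w - v n w))\<^sup>2 * \<omega> w) = liminf (\<lambda>j. ennreal ((norm (F w - v n w))\<^sup>2 * \<omega> w) * indicator (cball 0 (R j)) w)" by simp
    qed
    also have "\<dots> \<le> liminf (\<lambda>j. \<integral>\<^sup>+w. ennreal ((norm (F w - v n w))\<^sup>2 * \<omega> w) * indicator (cball 0 (R j)) w \<partial>dA)"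
      by (rule nn_integral_liminf) measurable
    also have "\<dots> \<le> ennreal (2 * e n)"
      by (rule Liminf_le) (use loc2[OF R] in auto)
    finally show ?thesis .
  qed
  have diffL2: "L2 (\<lambda>x. F x - v n x)" for n
    unfolding L2_def
  proof
    show "integrable dA (\<lambda>x. (norm (F x - v n x))\<^sup>2 * \<omega> x)"
    proof (rule integrableI_nonneg)
      show "AE x in dA. 0 \<le> (norm (F x - v n x))\<^sup>2 * \<omega> x"
        by (auto intro!: AE_I2 mult_nonneg_nonneg less_imp_le[OF omega_pos])
      show "(\<integral>\<^sup>+x. ennreal ((norm (F x - v n x))\<^sup>2 * \<omega> x) \<partial>dA) < \<infinity>"
        using glob[of n] by (rule order_le_less_trans) simp
    qed measurable
  qed measurable
  have "sq (\<lambda>x. F x - v n x) \<le> 2 * e n" for n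
  proof -
    have "ennreal (sq (\<lambda>x. F x - v n x)) = (\<integral>\<^sup>+w. ennreal ((norm (F w - v n w))\<^sup>2 * \<omega> w) \<partial>dA)"
      unfolding sq_def
      by (rule nn_integral_eq_integral[symmetric])
         (use diffL2[of n] in \<open>auto simp: L2_def intro!: AE_I2 mult_nonneg_nonneg less_imp_le[OF omega_pos]\<close>)
    then have "ennreal (sq (\<lambda>x. F x - v n x)) \<le> ennreal (2 * e n)" using glob[of n] by (simp only:)
    then show ?thesis by (rule ennreal_le_iff[THEN iffD1, rotated]) (use e0[of n] in simp)
  qed
  moreover have "L2 F" using L2_add[OF diffL2[of 0] L2v[of 0]] by simp
  ultimately show ?thesis using holo by blast
qed

end

section \<open>Estimates for the Bergman kernel\<close>

text \<open>Cauchy's estimate on circles of radius r / 4, which stay inside the disk when centred in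
  its concentric half.\<close>

lemma holomorphic_Lipschitz:
  assumes f: "f holomorphic_on ball c r" and B: "\<And>x. x \<in> ball c r \<Longrightarrow> norm (f x) \<le> B"
    and r: "0 < r" and xy: "x \<in> ball c (r / 2)" "y \<in> ball c (r / 2)"
  shows "norm (f x - f y) \<le> 4 * B / r * norm (x - y)"
proof (rule field_differentiable_bound[OF convex_ball _ _ xy])
  fix z assume z: "z \<in> ball c (r / 2)"
  have sub: "cball z (r / 4) \<subseteq> ball c r"
  proof
    fix u assume "u \<in> cball z (r / 4)"
    then have "dist c u < r" using z dist_triangle[of c u z] r by simp
    then show "u \<in> ball c r" by simp
  qed
  then have zc: "z \<in> ball c r" using r by (meson centre_in_cball in_mono less_eq_real_def divide_pos_pos zero_less_numeral)
  show "(f has_field_derivative deriv f z) (at z within ball c (r / 2))"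
    using holomorphic_derivI[OF f open_ball zc] by (rule has_field_derivative_at_within)
  have "norm ((deriv ^^ 1) f z) \<le> fact 1 * B / (r / 4) ^ 1"
  proof (rule Cauchy_inequality)
    show "f holomorphic_on ball z (r / 4)"
      by (rule holomorphic_on_subset[OF f]) (use sub in auto)
    show "continuous_on (cball z (r / 4)) f"
      by (rule continuous_on_subset[OF holomorphic_on_imp_continuous_on[OF f] sub])
    show "norm (f x) \<le> B" if "norm (z - x) = r / 4" for x
      by (rule B) (use sub that in \<open>auto simp: dist_norm\<close>)
  qed (use r in simp)
  then show "norm (deriv f z) \<le> 4 * B / r" by (simp add: field_simps)
qed

text \<open>Differentiation under the integral where a bound on the functions alone is enough:
  holomorphy turns the local majorant \<open>B\<close> into the majorant \<open>4 / r * B\<close> of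
  all nearby difference quotients.\<close>

lemma holomorphic_lebesgue_integral:
  assumes hol: "\<And>x. x \<in> space M \<Longrightarrow> f x holomorphic_on U"
    and meas: "\<And>w. w \<in> U \<Longrightarrow> (\<lambda>x. f x w) \<in> borel_measurable M"
    and dom: "\<And>w. w \<in> U \<Longrightarrow> \<exists>r>0. \<exists>B. ball w r \<subseteq> U \<and> integrable M B \<and> (\<forall>x\<in>space M. \<forall>y\<in>ball w r. norm (f x y) \<le> B x)"
    and U: "open U"
  shows "(\<lambda>w. LINT x|M. f x w :: complex) holomorphic_on U"
proof -
  have "\<exists>D. ((\<lambda>w. LINT x|M. f x w) has_field_derivative D) (at w)" if w: "w \<in> U" for w
  proof -
    obtain r B where r: "0 < r" "ball w r \<subseteq> U" and B: "integrable M B"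
      and le: "\<And>x y. x \<in> space M \<Longrightarrow> y \<in> ball w r \<Longrightarrow> norm (f x y) \<le> B x"
      using dom[OF w] by blast
    have int: "integrable M (\<lambda>x. f x y)" if y: "y \<in> ball w r" for y
      by (rule Bochner_Integration.integrable_bound[OF B meas])
         (use y r le[OF _ y] in \<open>auto intro!: AE_I2 intro: order_trans[OF _ abs_ge_self]\<close>)
    have der: "(f x has_field_derivative deriv (f x) w) (at w)" if "x \<in> space M" for x
      by (rule holomorphic_derivI[OF hol[OF that] U w])
    have seq: "((\<lambda>h. ((LINT x|M. f x (w + h)) - (LINT x|M. f x w)) / h) \<circ> X) \<longlonglongrightarrow> (LINT x|M. deriv (f x) w)"
      if X: "\<forall>i. X i \<in> UNIV - {0}" "X \<longlonglongrightarrow> 0" for X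
    proof -
      have "\<forall>\<^sub>F i in sequentially. dist (X i) 0 < r / 2" using X(2) r by (intro tendstoD) auto
      then obtain N where N: "\<And>i. i \<ge> N \<Longrightarrow> norm (X i) < r / 2" by (auto simp: eventually_sequentially)
      define Y where "Y i = X (i + N)" for i
      have Y: "norm (Y i) < r / 2" "Y i \<noteq> 0" for i using N[of "i + N"] X(1) by (auto simp: Y_def)
      have Y0: "Y \<longlonglongrightarrow> 0" unfolding Y_def using X(2) by (rule LIMSEQ_ignore_initial_segment)
      have inb: "w + Y i \<in> ball w r" "w + Y i \<in> ball w (r / 2)" "w \<in> ball w r" "w \<in> ball w (r / 2)" for i
        using Y(1)[of i] r by (auto simp: dist_norm)
      define q where "q i x = (f x (w + Y i) - f x w) / Y i" for i x
      have lim: "(\<lambda>i. q i x) \<longlonglongrightarrow> deriv (f x) w" if x: "x \<in> space M" for x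
      proof -
        have "((\<lambda>h. (f x (w + h) - f x w) / h) \<longlongrightarrow> deriv (f x) w) (at 0)"
          using der[OF x] by (simp add: DERIV_def)
        moreover have "filterlim Y (at 0) sequentially"
          using Y0 Y(2) by (simp add: filterlim_at)
        ultimately show ?thesis unfolding q_def by (rule filterlim_compose)
      qed
      have qm: "q i \<in> borel_measurable M" for i
      proof -
        have "(\<lambda>x. f x (w + Y i)) \<in> borel_measurable M" "(\<lambda>x. f x w) \<in> borel_measurable M"
          using inb r(2) w by (auto intro!: meas)
        then show ?thesis unfolding q_def[abs_def] by (intro borel_measurable_divide borel_measurable_diff) auto
      qed
      have "(\<lambda>i. LINT x|M. q i x) \<longlonglongrightarrow> (LINT x|M. deriv (f x) w)"
      proof (rule integral_dominated_convergence[where w="\<lambda>x. 4 / r * B x"])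
        show "(\<lambda>x. deriv (f x) w) \<in> borel_measurable M"
          by (rule borel_measurable_LIMSEQ_metric[OF qm lim])
        show "integrable M (\<lambda>x. 4 / r * B x)" using B by simp
        show "AE x in M. (\<lambda>i. q i x) \<longlonglongrightarrow> deriv (f x) w" using lim by (intro AE_I2)
        show "AE x in M. norm (q i x) \<le> 4 / r * B x" for i
        proof (rule AE_I2)
          fix x assume x: "x \<in> space M"
          have "norm (f x (w + Y i) - f x w) \<le> 4 * B x / r * norm (w + Y i - w)"
            by (rule holomorphic_Lipschitz[OF holomorphic_on_subset[OF hol[OF x] r(2)] le[OF x] r(1) inb(2,4)])
          then show "norm (q i x) \<le> 4 / r * B x"
            using Y(2)[of i] by (simp add: q_def norm_divide divide_le_eq)
        qed
      qed (rule qm)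
      moreover have "(LINT x|M. q i x) = ((LINT x|M. f x (w + Y i)) - (LINT x|M. f x w)) / Y i" for i
        unfolding q_def using int[OF inb(1)[of i]] int[OF inb(3)] by simp
      ultimately have "(\<lambda>i. ((\<lambda>h. ((LINT x|M. f x (w + h)) - (LINT x|M. f x w)) / h) \<circ> X) (i + N)) \<longlonglongrightarrow> (LINT x|M. deriv (f x) w)"
        by (simp add: Y_def)
      then show ?thesis by (rule LIMSEQ_offset)
    qed
    have "((\<lambda>w. LINT x|M. f x w) has_field_derivative (LINT x|M. deriv (f x) w)) (at w)"
      unfolding DERIV_def tendsto_at_iff_sequentially using seq by blast
    then show ?thesis by blast
  qed
  then show ?thesis using U by (auto simp: holomorphic_on_open)
qed

text \<open>Convexity of the power function. In the Schur test this takes the place of Hoelder's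
  inequality, so that no conjugate exponent appears and p = 1 is not a special case.\<close>

lemma powr_tangent:
  fixes x c p :: real
  assumes "1 \<le> p" "0 \<le> x" "0 < c"
  shows "c powr p + p * c powr (p - 1) * (x - c) \<le> x powr p"
proof (cases "x = 0")
  case True
  have "c powr p = c powr (p - 1) * c" using assms by (simp add: powr_diff)
  then have "c powr p + p * c powr (p - 1) * (x - c) = (1 - p) * c powr p" using True by (simp add: algebra_simps)
  also have "\<dots> \<le> 0" using assms by (simp add: mult_nonpos_nonneg)
  finally show ?thesis using True by simp
next
  case False
  have "p * c powr (p - 1) * (x - c) \<le> x powr p - c powr p"
  proof (rule convex_on_imp_above_tangent[OF powr_convex[OF assms(1)]])
    show "((\<lambda>x. x powr p) has_real_derivative p * c powr (p - 1)) (at c within {0<..})"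
      by (rule has_field_derivative_at_within[OF has_real_derivative_powr[OF assms(3)]])
    show "c \<in> interior {0<..}" using assms(3) by (simp add: interior_open)
  qed (use assms False in auto)
  then show ?thesis by simp
qed

context disk_weight
begin

lemma L2_iff_Lp: "f \<in> Lp_space 2 \<omega> \<longleftrightarrow> L2 f"
  by (simp add: Lp_space_def L2_def)

lemma Ap_iff: "f \<in> Ap_space 2 \<omega> \<longleftrightarrow> f holomorphic_on unit_disk \<and> L2 f"
  using L2_iff_Lp by (simp add: Ap_space_def)

end

context exp_weight
begin

lemma growth_pos: "0 < growth z s x"
  using growth_ge_1[of z s x] by linarith

lemma growth_nz: "growth z s x \<noteq> 0"
  using growth_pos[of z s x] by simp

text \<open>The projection theorem at the level of sequences. The parallelogram law makes
  near-minimizers of the norm of \<open>h + delta a\<close> a Cauchy sequence with explicit rate,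
  and the first variation makes them asymptotically orthogonal to every \<open>delta b\<close>. The
  limit itself is left to the Weyl lemma.\<close>

lemma minimizing_sequence:
  assumes h: "test 0 h"
  obtains a where "\<And>n. test 2 (a n)"
    "\<And>n m. n \<le> m \<Longrightarrow> sq (\<lambda>x. (h x + delta (a m) x) - (h x + delta (a n) x)) \<le> 4 / real (Suc n)"
    "\<And>b. test 2 b \<Longrightarrow> (\<lambda>n. ip (\<lambda>x. h x + delta (a n) x) (delta b)) \<longlonglongrightarrow> 0"
proof -
  define S where "S = {sq (\<lambda>x. h x + delta a x) | a. test 2 a}"
  define d where "d = Inf S"
  have bdd: "bdd_below S" by (rule bdd_belowI[of _ 0]) (auto simp: S_def sq_nonneg)
  have t0: "test 2 (\<lambda>_. 0)" using Ck_const by (auto simp: test_def vanish_def intro: exI[of _ 0] simp del: Ck.simps)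
  then have ne: "S \<noteq> {}" by (auto simp: S_def)
  have d_le: "d \<le> sq (\<lambda>x. h x + delta a x)" if "test 2 a" for a
    unfolding d_def by (rule cInf_lower[OF _ bdd]) (use that in \<open>auto simp: S_def\<close>)
  have "\<exists>a. test 2 a \<and> sq (\<lambda>x. h x + delta a x) < d + 1 / real (Suc n)" for n
  proof -
    have "\<exists>s\<in>S. s < d + 1 / real (Suc n)"
      by (rule cInf_lessD[OF ne, folded d_def]) simp
    then show ?thesis by (auto simp: S_def)
  qed
  then obtain a where a: "\<And>n. test 2 (a n)" "\<And>n. sq (\<lambda>x. h x + delta (a n) x) < d + 1 / real (Suc n)" by metis
  have a1: "test 1 (a n)" for n using test_le[OF a(1)] by simp
  define v where "v n x = h x + delta (a n) x" for n x
  have hL: "L2 h" by (rule test_L2[OF h])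
  have vL: "L2 (v n)" for n unfolding v_def[abs_def] by (rule L2_add[OF hL delta_L2[OF a1]])
  have vs: "sq (v n) < d + 1 / real (Suc n)" for n using a(2)[of n] by (simp add: v_def[abs_def])
  have cauchy: "sq (\<lambda>x. v m x - v n x) \<le> 4 / real (Suc n)" if nm: "n \<le> m" for n m
  proof -
    \<comment> \<open>The midpoint of two competitors is a competitor, so its square norm is at
      least the infimum.\<close>
    have mid: "4 * d \<le> sq (\<lambda>x. v m x + v n x)"
    proof -
      define b where "b x = of_real (1/2) * (a m x + 1 * a n x)" for x
      have b: "test 2 b" unfolding b_def[abs_def] by (intro test_mult test_add a Ck_const)
      have s1: "test 1 (\<lambda>x. a m x + 1 * a n x)" by (intro test_add test_mult a1 Ck_const)
      have "delta b x = (delta (a m) x + delta (a n) x) / 2" if x: "x \<in> unit_disk" for x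
      proof -
        have "delta b x = of_real (1/2) * delta (\<lambda>x. a m x + 1 * a n x) x - dz (\<lambda>_. of_real (1/2)) x * (a m x + 1 * a n x)"
          unfolding b_def[abs_def] by (rule delta_mult[OF s1 Ck_const x])
        then show ?thesis
          using delta_add[OF a1 a1 x, of m 1 n] has_wirtinger_imp(2)[OF has_wirtinger_const[of "of_real (1/2)" x]] by simp
      qed
      then have "sq (\<lambda>x. h x + delta b x) = sq (\<lambda>x. of_real (1/2) * (v m x + v n x))"
        by (intro sq_cong arg_cong[where f=norm]) (simp add: v_def field_simps)
      also have "\<dots> = (nrm (\<lambda>x. of_real (1/2) * (v m x + v n x)))\<^sup>2" by (simp add: nrm_sq)
      also have "\<dots> = sq (\<lambda>x. v m x + v n x) / 4" unfolding nrm_cmult by (simp add: power_mult_distrib nrm_sq power_divide)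
      finally show ?thesis using d_le[OF b] by simp
    qed
    have "sq (\<lambda>x. v m x + (- 1) * v n x) = sq (v m) + 2 * Re (ip (v m) (\<lambda>x. (- 1) * v n x)) + sq (\<lambda>x. (- 1) * v n x)"
      by (rule sq_add[OF vL L2_cmult[OF vL]])
    moreover have "sq (\<lambda>x. (- 1) * v n x) = sq (v n)" by (rule sq_cong) simp
    moreover have "ip (v m) (\<lambda>x. (- 1) * v n x) = - ip (v m) (v n)" using ip_cmult_right[of "v m" "- 1" "v n"] by simp
    moreover have "sq (\<lambda>x. v m x + v n x) = sq (v m) + 2 * Re (ip (v m) (v n)) + sq (v n)" by (rule sq_add[OF vL vL])
    ultimately have "sq (\<lambda>x. v m x - v n x) \<le> 2 * sq (v m) + 2 * sq (v n) - 4 * d" using mid by simp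
    also have "\<dots> \<le> 2 / real (Suc m) + 2 / real (Suc n)" using vs[of m] vs[of n] by simp
    also have "\<dots> \<le> 2 / real (Suc n) + 2 / real (Suc n)"
      using nm by (intro add_right_mono divide_left_mono) auto
    finally show ?thesis by simp
  qed
  have weak: "(\<lambda>n. ip (v n) (delta b)) \<longlonglongrightarrow> 0" if b: "test 2 b" for b
  proof (rule Lim_null_comparison)
    have b1: "test 1 b" using test_le[OF b] by simp
    \<comment> \<open>The step size of the variation. The summand 1 excludes division by 0, and
      \<open>s * sq (delta b) \<le> 1\<close> ensures that the quadratic term takes back at most
      half of the first-order gain.\<close>
    define s where "s = 1 / (sq (delta b) + 1)"
    have s: "0 < s" "s * sq (delta b) \<le> 1" using sq_nonneg[of "delta b"] by (auto simp: s_def field_simps)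
    have "norm (ip (v n) (delta b)) \<le> sqrt (1 / s * (1 / real (Suc n)))" for n
    proof -
      define I where "I = ip (v n) (delta b)"
      define t where "t = - of_real s * I"
      have at: "test 2 (\<lambda>x. a n x + t * b x)" by (intro test_add test_mult a b Ck_const)
      have "sq (\<lambda>x. h x + delta (\<lambda>x. a n x + t * b x) x) = sq (\<lambda>x. v n x + t * delta b x)"
        by (intro sq_cong arg_cong[where f=norm]) (simp add: v_def delta_add[OF a1 b1])
      also have "\<dots> = sq (v n) + 2 * Re (ip (v n) (\<lambda>x. t * delta b x)) + sq (\<lambda>x. t * delta b x)"
        by (rule sq_add[OF vL L2_cmult[OF delta_L2[OF b1]]])
      also have "sq (\<lambda>x. t * delta b x) = (norm t)\<^sup>2 * sq (delta b)"
        unfolding nrm_sq[symmetric] nrm_cmult by (simp add: power_mult_distrib)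
      also have "Re (ip (v n) (\<lambda>x. t * delta b x)) = - s * (norm I)\<^sup>2"
      proof -
        have "ip (v n) (\<lambda>x. t * delta b x) = cnj t * I" unfolding I_def by (rule ip_cmult_right)
        also have "\<dots> = - of_real s * (I * cnj I)" by (simp add: t_def mult_ac)
        also have "\<dots> = of_real (- s * (norm I)\<^sup>2)" by (simp only: complex_norm_square[symmetric] of_real_mult of_real_minus)
        finally show ?thesis by simp
      qed
      also have "(norm t)\<^sup>2 = s\<^sup>2 * (norm I)\<^sup>2" by (simp add: t_def norm_mult power_mult_distrib)
      finally have "d \<le> sq (v n) + 2 * (- s * (norm I)\<^sup>2) + s\<^sup>2 * (norm I)\<^sup>2 * sq (delta b)" using d_le[OF at] by simp
      moreover have "s\<^sup>2 * (norm I)\<^sup>2 * sq (delta b) \<le> s * (norm I)\<^sup>2"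
        using mult_left_mono[OF s(2), of "s * (norm I)\<^sup>2"] s(1) by (simp add: power2_eq_square mult_ac)
      ultimately have "s * (norm I)\<^sup>2 \<le> 1 / real (Suc n)" using vs[of n] by simp
      from mult_left_mono[OF this, of "1 / s"] have "(norm I)\<^sup>2 \<le> 1 / s * (1 / real (Suc n))" using s(1) by simp
      then show ?thesis unfolding I_def by (rule real_le_rsqrt)
    qed
    then show "\<forall>\<^sub>F n in sequentially. norm (ip (v n) (delta b)) \<le> sqrt (1 / s * (1 / real (Suc n)))"
      by (intro always_eventually) auto
    have "(\<lambda>n. sqrt (1 / s * inverse (real (Suc n)))) \<longlonglongrightarrow> sqrt (1 / s * 0)"
      by (intro tendsto_real_sqrt tendsto_mult tendsto_const LIMSEQ_inverse_real_of_nat)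
    then show "(\<lambda>n. sqrt (1 / s * (1 / real (Suc n)))) \<longlonglongrightarrow> 0" by (simp add: inverse_eq_divide)
  qed
  show ?thesis
    by (rule that[OF a(1)]) (use cauchy weak in \<open>simp_all add: v_def[abs_def]\<close>)
qed

text \<open>The limit of \<open>peak z + delta (a n)\<close> is holomorphic by the Weyl lemma. It
  reproduces because \<open>peak z\<close> does and every \<open>delta (a n)\<close> is orthogonal
  to holomorphic functions.\<close>

lemma kernel_exists:
  assumes z: "z \<in> unit_disk"
  obtains K a where "K holomorphic_on unit_disk" "L2 K"
    "\<And>f. f holomorphic_on unit_disk \<Longrightarrow> L2 f \<Longrightarrow> f z = ip f K"
    "\<And>n. test 2 (a n)" "(\<lambda>n. sq (\<lambda>x. K x - (peak z x + delta (a n) x))) \<longlonglongrightarrow> 0"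
proof -
  obtain a where a: "\<And>n. test 2 (a n)"
    and cauchy: "\<And>n m. n \<le> m \<Longrightarrow> sq (\<lambda>x. (peak z x + delta (a m) x) - (peak z x + delta (a n) x)) \<le> 4 / real (Suc n)"
    and weak: "\<And>b. test 2 b \<Longrightarrow> (\<lambda>n. ip (\<lambda>x. peak z x + delta (a n) x) (delta b)) \<longlonglongrightarrow> 0"
    using minimizing_sequence[OF peak_test[OF z]] by blast
  define v where "v n x = peak z x + delta (a n) x" for n x
  have a1: "test 1 (a n)" for n using test_le[OF a] by simp
  have vt: "test 0 (v n)" for n
    unfolding v_def[abs_def] by (rule test_add[OF peak_test[OF z] delta_test0[OF a1]])
  have vL: "L2 (v n)" for n by (rule test_L2[OF vt])
  have vc: "continuous_on unit_disk (v n)" for n using vt[of n] by (simp add: test_def)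
  have elim: "(\<lambda>n. 4 / real (Suc n)) \<longlonglongrightarrow> 0"
    using tendsto_mult[OF tendsto_const LIMSEQ_inverse_real_of_nat, of 4] by (simp add: divide_inverse)
  have "\<exists>F. F holomorphic_on unit_disk \<and> L2 F \<and> (\<forall>n. sq (\<lambda>x. F x - v n x) \<le> 2 * (4 / real (Suc n)))"
    by (rule weyl[OF vc vL]) (use cauchy weak elim in \<open>simp_all add: v_def[abs_def]\<close>)
  then obtain K where K: "K holomorphic_on unit_disk" "L2 K" "\<And>n. sq (\<lambda>x. K x - v n x) \<le> 2 * (4 / real (Suc n))" by blast
  have lim: "(\<lambda>n. sq (\<lambda>x. K x - v n x)) \<longlonglongrightarrow> 0"
  proof (rule tendsto_sandwich[OF _ _ tendsto_const])
    show "(\<lambda>n. 2 * (4 / real (Suc n))) \<longlonglongrightarrow> 0"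
      using tendsto_mult[OF tendsto_const elim, of 2] by simp
  qed (use K(3) sq_nonneg in auto)
  have repr: "f z = ip f K" if f: "f holomorphic_on unit_disk" "L2 f" for f
  proof -
    have "norm (ip f K - f z) \<le> nrm f * nrm (\<lambda>x. K x - v n x)" for n
    proof -
      have "ip f (v n) = ip f (peak z) + ip f (delta (a n))"
        unfolding v_def[abs_def] by (rule ip_add_right[OF peak_L2[OF z] delta_L2[OF a1] f(2)])
      then have "ip f (v n) = f z"
        using peak_reproducing[OF z f(1)] holomorphic_orthogonal[OF f(1) a1] by simp
      then have "ip f K - f z = ip f (\<lambda>x. K x - v n x)"
        using ip_diff_right[OF K(2) vL f(2)] by simp
      then show ?thesis using Cauchy_Schwarz(2)[OF f(2) L2_diff[OF K(2) vL]] by simp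
    qed
    moreover have "(\<lambda>n. nrm f * nrm (\<lambda>x. K x - v n x)) \<longlonglongrightarrow> nrm f * sqrt 0"
      unfolding nrm_def by (intro tendsto_mult tendsto_const tendsto_real_sqrt lim)
    ultimately have "norm (ip f K - f z) \<le> 0"
      by (intro LIMSEQ_le_const[of _ 0]) auto
    then show ?thesis by simp
  qed
  show ?thesis by (rule that[OF K(1,2) repr a]) (use lim in \<open>simp_all add: v_def[abs_def]\<close>)
qed

section \<open>The Bergman kernel: reproducing property, approximation and symmetry\<close>

abbreviation ker_at :: "complex \<Rightarrow> complex \<Rightarrow> complex" where
  "ker_at \<equiv> bergman_kernel \<omega>"

lemma bergman_kernel:
  assumes z: "z \<in> unit_disk"
  shows "ker_at z holomorphic_on unit_disk" "L2 (ker_at z)"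
    "\<And>f. f holomorphic_on unit_disk \<Longrightarrow> L2 f \<Longrightarrow> f z = ip f (ker_at z)"
proof -
  obtain K a where "K holomorphic_on unit_disk" "L2 K"
    "\<And>f. f holomorphic_on unit_disk \<Longrightarrow> L2 f \<Longrightarrow> f z = ip f K"
    using kernel_exists[OF z] by metis
  then have "\<exists>K. K \<in> Ap_space 2 \<omega> \<and> (\<forall>f\<in>Ap_space 2 \<omega>. f z = A2_inner \<omega> f K)"
    by (auto simp: Ap_iff)
  then have "ker_at z \<in> Ap_space 2 \<omega> \<and> (\<forall>f\<in>Ap_space 2 \<omega>. f z = A2_inner \<omega> f (ker_at z))"
    unfolding bergman_kernel_def by (rule someI_ex)
  then have K: "ker_at z \<in> Ap_space 2 \<omega>" and r: "\<forall>f\<in>Ap_space 2 \<omega>. f z = A2_inner \<omega> f (ker_at z)"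
    by (rule conjunct1, rule conjunct2)
  show "ker_at z holomorphic_on unit_disk" "L2 (ker_at z)"
    using K by (simp_all only: Ap_iff)
  show "f z = ip f (ker_at z)" if "f holomorphic_on unit_disk" "L2 f" for f
    by (rule bspec[OF r]) (simp only: Ap_iff that simp_thms)
qed

text \<open>Reproducing kernels are unique on the disk, so the approximation found for the
  constructed kernel transfers to the one chosen by \<open>SOME\<close>.\<close>

lemma kernel_approx:
  assumes z: "z \<in> unit_disk"
  obtains a where "\<And>n. test 2 (a n)" "(\<lambda>n. sq (\<lambda>x. ker_at z x - (peak z x + delta (a n) x))) \<longlonglongrightarrow> 0"
proof -
  obtain K a where K: "K holomorphic_on unit_disk" "L2 K"
    "\<And>f. f holomorphic_on unit_disk \<Longrightarrow> L2 f \<Longrightarrow> f z = ip f K"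
    and a: "\<And>n. test 2 (a n)" "(\<lambda>n. sq (\<lambda>x. K x - (peak z x + delta (a n) x))) \<longlonglongrightarrow> 0"
    using kernel_exists[OF z] by blast
  note B = bergman_kernel[OF z]
  define D where "D x = K x - ker_at z x" for x
  have D: "D holomorphic_on unit_disk" "L2 D"
    unfolding D_def[abs_def] by (intro holomorphic_intros K B L2_diff)+
  \<comment> \<open>Both inner products equal \<open>D z\<close>, as both functions
    reproduce.\<close>
  have "complex_of_real (sq D) = ip D K - ip D (ker_at z)"
    using ip_diff_right[OF K(2) B(2) D(2)] by (simp add: ip_self[symmetric] D_def[abs_def])
  also have "\<dots> = 0" using K(3)[OF D] B(3)[OF D] by simp
  finally have "nrm D = 0" by (simp add: nrm_def)
  \<comment> \<open>Norm 0 is turned into pointwise vanishing by evaluating with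
    \<open>peak x\<close>.\<close>
  have "D x = 0" if x: "x \<in> unit_disk" for x
  proof -
    have "norm (D x) \<le> nrm D * nrm (peak x)"
      using Cauchy_Schwarz(2)[OF D(2) peak_L2[OF x]] peak_reproducing[OF x D(1)] by simp
    then show ?thesis using \<open>nrm D = 0\<close> by simp
  qed
  then have "sq (\<lambda>x. ker_at z x - (peak z x + delta (a n) x)) = sq (\<lambda>x. K x - (peak z x + delta (a n) x))" for n
    by (intro sq_cong) (simp add: D_def)
  with a show ?thesis by (intro that[of a]) auto
qed

lemma kernel_sym:
  assumes "z \<in> unit_disk" "x \<in> unit_disk"
  shows "ker_at z x = cnj (ker_at x z)"
proof -
  have "ker_at z x = ip (ker_at z) (ker_at x)"
    using bergman_kernel(3)[OF assms(2) bergman_kernel(1,2)[OF assms(1)]] .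
  also have "\<dots> = cnj (ip (ker_at x) (ker_at z))" by (simp add: ip_cnj)
  also have "ip (ker_at x) (ker_at z) = ker_at x z"
    using bergman_kernel(3)[OF assms(1) bergman_kernel(1,2)[OF assms(2)]] by simp
  finally show ?thesis .
qed

section \<open>The weighted norm of the kernel\<close>

definition scale :: real where
  "scale = (SOME B. B > 0 \<and> (\<forall>z\<in>unit_disk. \<forall>x\<in>unit_disk. \<tau> x * norm (x - z) \<le> 1 / (16 * C) * ((B * \<tau> z)\<^sup>2 + (norm (x - z))\<^sup>2)))"

lemma scale:
  "0 < scale"
  "z \<in> unit_disk \<Longrightarrow> x \<in> unit_disk \<Longrightarrow> \<tau> x * norm (x - z) \<le> 1 / (16 * C) * ((scale * \<tau> z)\<^sup>2 + (norm (x - z))\<^sup>2)"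
proof -
  have "\<exists>B. B > 0 \<and> (\<forall>z\<in>unit_disk. \<forall>x\<in>unit_disk. \<tau> x * norm (x - z) \<le> 1 / (16 * C) * ((B * \<tau> z)\<^sup>2 + (norm (x - z))\<^sup>2))"
    using tau_slow[of "1 / (16 * C)"] C_pos by simp
  then have S: "scale > 0 \<and> (\<forall>z\<in>unit_disk. \<forall>x\<in>unit_disk. \<tau> x * norm (x - z) \<le> 1 / (16 * C) * ((scale * \<tau> z)\<^sup>2 + (norm (x - z))\<^sup>2))"
    unfolding scale_def by (rule someI_ex)
  then show "0 < scale" by (rule conjunct1)
  show "\<tau> x * norm (x - z) \<le> 1 / (16 * C) * ((scale * \<tau> z)\<^sup>2 + (norm (x - z))\<^sup>2)" if "z \<in> unit_disk" "x \<in> unit_disk"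
    by (rule bspec[OF bspec[OF conjunct2[OF S] that(1)] that(2)])
qed

abbreviation wgt :: "complex \<Rightarrow> complex \<Rightarrow> real" where
  "wgt z \<equiv> growth z (scale * \<tau> z)"

text \<open>The 4 comes from \<open>weighted_estimate\<close>; the bracket bounds the weight on the
  support of \<open>peak\<close>, where |x - z| \<le> \<open>dlt * \<tau> z\<close>.\<close>

definition CK :: real where
  "CK = 4 * (1 + dlt\<^sup>2 / scale\<^sup>2) * CH"

lemma CK_pos: "0 < CK"
  using CH_pos by (simp add: CK_def add_pos_nonneg)

text \<open>The weighted estimate holds for each approximant with \<open>K - delta a\<close> on the
  right, which is close to \<open>peak z\<close>. On the support of \<open>peak z\<close> the weight
  is bounded, so its norm controls everything.\<close>

lemma kernel_weighted:
  assumes z: "z \<in> unit_disk"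
  shows "nrm (\<lambda>x. of_real (wgt z x) * ker_at z x) \<le> CK / (sqrt (\<omega> z) * \<tau> z)"
proof -
  define s where "s = scale * \<tau> z"
  have s: "0 < s" using scale(1) tau_pos[OF z] by (simp add: s_def)
  let ?X = "\<lambda>x. complex_of_real (growth z s x)"
  obtain a where a: "\<And>n. test 2 (a n)" "(\<lambda>n. sq (\<lambda>x. ker_at z x - (peak z x + delta (a n) x))) \<longlonglongrightarrow> 0"
    using kernel_approx[OF z] by blast
  note K = bergman_kernel[OF z]
  define u where "u n x = ker_at z x - (peak z x + delta (a n) x)" for n x
  have a1: "test 1 (a n)" for n using test_le[OF a(1)] by simp
  have uL: "L2 (u n)" for n
    unfolding u_def[abs_def] by (intro L2_diff L2_add K peak_L2 z delta_L2 a1)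
  \<comment> \<open>A crude bound with a constant depending on \<open>z\<close>; it multiplies an
    error that tends to 0 and leaves no trace in the limit.\<close>
  have X: "nrm (\<lambda>x. ?X x * u n x) \<le> (1 + 4 / s\<^sup>2) * nrm (u n)" for n
  proof -
    have "sq (\<lambda>x. ?X x * u n x) \<le> (1 + 4 / s\<^sup>2)\<^sup>2 * sq (u n)"
    proof (rule L2_mult_bounded(2)[OF _ uL])
      show "(\<lambda>x. ?X x) \<in> borel_measurable dA"
        by (intro continuous_imp_measurable_dA continuous_intros growth_cont)
      show "\<And>x. x \<in> unit_disk \<Longrightarrow> norm (?X x) \<le> 1 + 4 / s\<^sup>2"
        using growth_bounded[OF _ z] growth_ge_1 by (simp add: order_trans[OF zero_le_one])
    qed
    also have "\<dots> = ((1 + 4 / s\<^sup>2) * nrm (u n))\<^sup>2" by (simp add: power_mult_distrib nrm_sq)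
    finally have "(nrm (\<lambda>x. ?X x * u n x))\<^sup>2 \<le> ((1 + 4 / s\<^sup>2) * nrm (u n))\<^sup>2" by (simp add: nrm_sq)
    then show ?thesis by (rule power2_le_imp_le) (simp add: nrm_nonneg)
  qed
  have P: "nrm (\<lambda>x. ?X x * peak z x) \<le> (1 + dlt\<^sup>2 / scale\<^sup>2) * nrm (peak z)"
  proof -
    have "nrm (\<lambda>x. ?X x * peak z x) \<le> nrm (\<lambda>x. of_real (1 + dlt\<^sup>2 / scale\<^sup>2) * peak z x)"
    proof (rule L2_mono(3)[OF L2_meas[OF growth_L2[OF peak_L2[OF z] z]] L2_cmult[OF peak_L2[OF z]]])
      fix x assume x: "x \<in> unit_disk"
      show "norm (?X x * peak z x) \<le> norm (of_real (1 + dlt\<^sup>2 / scale\<^sup>2) * peak z x)"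
      proof (cases "norm (x - z) < rad z")
        case True
        have "(norm (x - z))\<^sup>2 \<le> (rad z)\<^sup>2" using True by (intro power_mono) auto
        then have "(norm (x - z))\<^sup>2 / s\<^sup>2 \<le> (rad z)\<^sup>2 / s\<^sup>2" by (rule divide_right_mono) simp
        also have "\<dots> = dlt\<^sup>2 / scale\<^sup>2" using tau_pos[OF z] by (simp add: rad_def s_def power_mult_distrib)
        finally have "growth z s x \<le> 1 + dlt\<^sup>2 / scale\<^sup>2" by (simp add: growth_def)
        then show ?thesis unfolding norm_mult norm_of_real
          using growth_ge_1[of z s x] by (intro mult_right_mono) auto
      qed (use peak_vanish[OF z x] in simp)
    qed
    then show ?thesis unfolding nrm_cmult norm_of_real by (simp add: abs_of_nonneg)
  qed
  have "nrm (\<lambda>x. ?X x * ker_at z x) \<le> 4 * ((1 + 4 / s\<^sup>2) * nrm (u n) + (1 + dlt\<^sup>2 / scale\<^sup>2) * nrm (peak z))" for n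
  proof -
    have "nrm (\<lambda>x. ?X x * ker_at z x) \<le> 4 * nrm (\<lambda>x. ?X x * (ker_at z x - delta (a n) x))"
      by (rule weighted_estimate[OF z s _ K(1,2) a(1)]) (use scale(2)[OF z] in \<open>simp add: s_def\<close>)
    also have "nrm (\<lambda>x. ?X x * (ker_at z x - delta (a n) x)) = nrm (\<lambda>x. ?X x * u n x + ?X x * peak z x)"
      by (rule nrm_cong) (simp add: u_def algebra_simps)
    also have "\<dots> \<le> nrm (\<lambda>x. ?X x * u n x) + nrm (\<lambda>x. ?X x * peak z x)"
      by (rule nrm_triangle[OF growth_L2[OF uL z] growth_L2[OF peak_L2[OF z] z]])
    also have "\<dots> \<le> (1 + 4 / s\<^sup>2) * nrm (u n) + (1 + dlt\<^sup>2 / scale\<^sup>2) * nrm (peak z)"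
      by (rule add_mono[OF X P])
    finally show ?thesis by simp
  qed
  moreover have "(\<lambda>n. 4 * ((1 + 4 / s\<^sup>2) * nrm (u n) + (1 + dlt\<^sup>2 / scale\<^sup>2) * nrm (peak z))) \<longlonglongrightarrow> 4 * ((1 + 4 / s\<^sup>2) * sqrt 0 + (1 + dlt\<^sup>2 / scale\<^sup>2) * nrm (peak z))"
  proof -
    have "(\<lambda>n. nrm (u n)) \<longlonglongrightarrow> sqrt 0" unfolding nrm_def u_def[abs_def] by (intro tendsto_real_sqrt a(2))
    then show ?thesis by (intro tendsto_intros)
  qed
  ultimately have "nrm (\<lambda>x. ?X x * ker_at z x) \<le> 4 * ((1 + 4 / s\<^sup>2) * sqrt 0 + (1 + dlt\<^sup>2 / scale\<^sup>2) * nrm (peak z))"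
    by (intro LIMSEQ_le_const) auto
  also have "\<dots> = 4 * (1 + dlt\<^sup>2 / scale\<^sup>2) * nrm (peak z)" by simp
  also have "\<dots> \<le> 4 * (1 + dlt\<^sup>2 / scale\<^sup>2) * (CH / (sqrt (\<omega> z) * \<tau> z))"
    by (rule mult_left_mono[OF peak_nrm[OF z]]) simp
  finally show ?thesis by (simp add: CK_def s_def)
qed

section \<open>Integral and pointwise bounds for the normalized kernel\<close>

lemma growth_integral:
  assumes s: "0 < s"
  shows "(LINT x|dA. 1 / (growth z s x)\<^sup>2) \<le> 22 * s\<^sup>2"
proof -
  define A where "A k = cball z (s * 2 ^ k) \<inter> unit_disk" for k :: nat
  have Am: "A k \<in> sets dA" for k by (simp add: A_def sets_dA sets_restrict_space_iff)
  \<comment> \<open>Outside radius s 2^(k-1) the weight is at least 4^(k-1), so its inverse square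
    is at most 16^(1-k). Against areas s^2 4^k the sum is 16 s^2 * 4/3 = 64/3 s^2, rounded up to 22
    s^2.\<close>
  define c :: "nat \<Rightarrow> real" where "c k = 16 * (1 / 16) ^ k" for k
  have c0: "0 \<le> c k" for k by (simp add: c_def)
  have pt: "ennreal (1 / (growth z s x)\<^sup>2) \<le> (\<Sum>k. ennreal (c k) * indicator (A k) x)" if x: "x \<in> unit_disk" for x
  proof -
    \<comment> \<open>Minimality places \<open>x\<close> in the dyadic ring with outer radius s 2^k,
      and for k = 0 in the central disk, where the trivial bound 1 is enough.\<close>
    define k where "k = (LEAST k. norm (x - z) \<le> s * 2 ^ k)"
    have ex: "\<exists>k. norm (x - z) \<le> s * 2 ^ k"
    proof -
      obtain k where "norm (x - z) / s < 2 ^ k" using real_arch_pow[of 2 "norm (x - z) / s"] by auto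
      then show ?thesis using s by (intro exI[of _ k]) (simp add: field_simps)
    qed
    have k: "norm (x - z) \<le> s * 2 ^ k" unfolding k_def by (rule LeastI_ex[OF ex])
    have "1 / (growth z s x)\<^sup>2 \<le> c k"
    proof (cases k)
      case 0
      have "1 \<le> (growth z s x)\<^sup>2" using growth_ge_1 by (simp add: one_le_power)
      then show ?thesis using 0 by (simp add: c_def divide_le_eq)
    next
      case (Suc j)
      have "\<not> norm (x - z) \<le> s * 2 ^ j" using not_less_Least[of j "\<lambda>k. norm (x - z) \<le> s * 2 ^ k"] Suc by (simp add: k_def)
      then have "(s * 2 ^ j)\<^sup>2 \<le> (norm (x - z))\<^sup>2" using s by (intro power_mono) auto
      moreover have "((2::real) ^ j)\<^sup>2 = 4 ^ j" by (simp add: power2_eq_square power_mult_distrib[symmetric])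
      ultimately have "4 ^ j * s\<^sup>2 \<le> (norm (x - z))\<^sup>2" by (simp add: power_mult_distrib mult.commute)
      then have "4 ^ j \<le> (norm (x - z))\<^sup>2 / s\<^sup>2" using s by (simp add: pos_le_divide_eq)
      then have "4 ^ j \<le> growth z s x" by (simp add: growth_def)
      then have "(4 ^ j)\<^sup>2 \<le> (growth z s x)\<^sup>2" by (intro power_mono) auto
      then have g: "16 ^ j \<le> (growth z s x)\<^sup>2" by (simp add: power2_eq_square power_mult_distrib[symmetric])
      have "1 / (growth z s x)\<^sup>2 \<le> 1 / 16 ^ j" by (rule divide_left_mono[OF g]) (use g in \<open>auto intro!: mult_pos_pos order_less_le_trans[OF _ g]\<close>)
      also have "\<dots> = c k" using Suc by (simp add: c_def power_divide)
      finally show ?thesis .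
    qed
    then have "ennreal (1 / (growth z s x)\<^sup>2) \<le> ennreal (c k) * indicator (A k) x"
      using k x by (simp add: A_def dist_norm norm_minus_commute ennreal_leI)
    also have "\<dots> = (\<Sum>i\<in>{k}. ennreal (c i) * indicator (A i) x)"
      by (simp only: sum.insert[OF finite.emptyI] empty_iff not_False_eq_True sum.empty add_0_right)
    also have "\<dots> \<le> (\<Sum>k. ennreal (c k) * indicator (A k) x)"
      by (rule sum_le_suminf) (auto intro!: summableI)
    finally show ?thesis .
  qed
  have m: "(\<lambda>x. ennreal (c k) * indicator (A k) x) \<in> borel_measurable dA" for k
    using Am by (intro borel_measurable_times_ennreal borel_measurable_indicator) auto
  have "(\<integral>\<^sup>+x. ennreal (1 / (growth z s x)\<^sup>2) \<partial>dA) \<le> (\<integral>\<^sup>+x. (\<Sum>k. ennreal (c k) * indicator (A k) x) \<partial>dA)"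
    by (rule nn_integral_mono) (use pt in simp)
  also have "\<dots> = (\<Sum>k. \<integral>\<^sup>+x. ennreal (c k) * indicator (A k) x \<partial>dA)"
    by (rule nn_integral_suminf[OF m])
  also have "\<dots> \<le> (\<Sum>k. ennreal (16 * s\<^sup>2 * (1 / 4) ^ k))"
  proof (rule suminf_le)
    fix k
    have "(\<integral>\<^sup>+x. ennreal (c k) * indicator (A k) x \<partial>dA) = ennreal (c k) * emeasure dA (A k)"
      by (rule nn_integral_cmult_indicator[OF Am])
    also have "\<dots> \<le> ennreal (c k) * ennreal ((s * 2 ^ k)\<^sup>2)"
      unfolding A_def using s by (intro mult_left_mono emeasure_dA_le) auto
    also have "\<dots> = ennreal (c k * (s * 2 ^ k)\<^sup>2)" using c0 by (simp add: ennreal_mult)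
    also have "c k * (s * 2 ^ k)\<^sup>2 = 16 * s\<^sup>2 * (1 / 4) ^ k"
    proof -
      have "((2::real) ^ k)\<^sup>2 = 4 ^ k" by (simp add: power2_eq_square power_mult_distrib[symmetric])
      moreover have "(1 / 16 :: real) ^ k * 4 ^ k = (1 / 4) ^ k" by (simp add: power_mult_distrib[symmetric])
      ultimately show ?thesis by (simp add: c_def power_mult_distrib mult_ac)
    qed
    finally show "(\<integral>\<^sup>+x. ennreal (c k) * indicator (A k) x \<partial>dA) \<le> ennreal (16 * s\<^sup>2 * (1 / 4) ^ k)" .
  qed (auto intro!: summableI)
  also have "\<dots> = ennreal (\<Sum>k. 16 * s\<^sup>2 * (1 / 4) ^ k)"
    by (rule suminf_ennreal2) (auto intro!: summable_mult summable_geometric)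
  also have "(\<Sum>k. 16 * s\<^sup>2 * (1 / 4 :: real) ^ k) = 16 * s\<^sup>2 * (4 / 3)"
    by (subst suminf_mult) (auto intro!: summable_geometric simp: suminf_geometric)
  finally have le: "(\<integral>\<^sup>+x. ennreal (1 / (growth z s x)\<^sup>2) \<partial>dA) \<le> ennreal (16 * s\<^sup>2 * (4 / 3))" .
  have gm: "growth z s \<in> borel_measurable dA" by (rule continuous_imp_measurable_dA[OF growth_cont])
  have "integrable dA (\<lambda>x. 1 / (growth z s x)\<^sup>2)"
  proof (rule dA.integrable_const_bound[where B=1])
    show "AE x in dA. norm (1 / (growth z s x)\<^sup>2) \<le> 1"
      using growth_ge_1 by (auto intro!: AE_I2 simp: divide_le_eq one_le_power)
  qed (use gm in measurable)
  then have "ennreal (LINT x|dA. 1 / (growth z s x)\<^sup>2) = (\<integral>\<^sup>+x. ennreal (1 / (growth z s x)\<^sup>2) \<partial>dA)"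
    by (intro nn_integral_eq_integral[symmetric]) auto
  then have "ennreal (LINT x|dA. 1 / (growth z s x)\<^sup>2) \<le> ennreal (16 * s\<^sup>2 * (4 / 3))" using le by (simp only:)
  then have "(LINT x|dA. 1 / (growth z s x)\<^sup>2) \<le> 16 * s\<^sup>2 * (4 / 3)"
    by (rule ennreal_le_iff[THEN iffD1, rotated]) simp
  also have "\<dots> \<le> 22 * s\<^sup>2" by simp
  finally show ?thesis .
qed

text \<open>The square roots of \<omega> conjugate the projection on
  L^p(\<open>\<omega>\<^sup>p\<^sup>/\<^sup>2\<close>) to an integral operator on unweighted L^p;
  this is the modulus of its kernel.\<close>

definition nkernel :: "complex \<Rightarrow> complex \<Rightarrow> real" where
  "nkernel z x = norm (ker_at z x) * sqrt (\<omega> z) * sqrt (\<omega> x)"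

lemma kk_nonneg: "z \<in> unit_disk \<Longrightarrow> x \<in> unit_disk \<Longrightarrow> 0 \<le> nkernel z x"
  using omega_pos[of z] omega_pos[of x] by (simp add: nkernel_def)

lemma kk_sym: "z \<in> unit_disk \<Longrightarrow> x \<in> unit_disk \<Longrightarrow> nkernel z x = nkernel x z"
  by (simp add: nkernel_def kernel_sym[of z x] mult_ac)

definition KB :: real where
  "KB = 5 * CK * scale"

lemma KB_pos: "0 < KB"
  using CK_pos scale(1) by (simp add: KB_def)

text \<open>Cauchy-Schwarz with the weight on the kernel and its inverse on the other factor. The
  weighted kernel norm has \<tau>(z) and the root of \<omega>(z) in the denominator; the inverse
  weight supplies a multiple of \<tau>(z), and the normalization supplies the root.\<close>

lemma kk_integral:
  assumes z: "z \<in> unit_disk"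
  shows "integrable dA (nkernel z)" "(LINT x|dA. nkernel z x) \<le> KB"
proof -
  define s where "s = scale * \<tau> z"
  have s: "0 < s" using scale(1) tau_pos[OF z] by (simp add: s_def)
  have wz: "0 < \<omega> z" by (rule omega_pos[OF z])
  \<comment> \<open>The root of \<omega> is included so that the weighted square norm of
    \<open>G\<close> is the unweighted integral of 1 / growth^2. It is at most 22 s^2, hence the
    norm at most 5 s.\<close>
  define G where "G x = complex_of_real (1 / (growth z s x * sqrt (\<omega> x)))" for x
  have Gm: "G \<in> borel_measurable dA"
  proof (rule continuous_imp_measurable_dA)
    show "continuous_on unit_disk G" unfolding G_def
      by (intro continuous_intros growth_cont omega_cont) (simp add: growth_nz omega_nz)
  qed
  have Gsq: "(norm (G x))\<^sup>2 * \<omega> x = 1 / (growth z s x)\<^sup>2" if "x \<in> unit_disk" for x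
    using omega_pos[OF that] by (simp add: G_def norm_divide norm_mult power_divide power_mult_distrib)
  have gm: "growth z s \<in> borel_measurable dA" by (rule continuous_imp_measurable_dA[OF growth_cont])
  have gi: "integrable dA (\<lambda>x. 1 / (growth z s x)\<^sup>2)"
  proof (rule dA.integrable_const_bound[where B=1])
    show "AE x in dA. norm (1 / (growth z s x)\<^sup>2) \<le> 1"
      using growth_ge_1 by (auto intro!: AE_I2 simp: divide_le_eq one_le_power)
  qed (use gm in measurable)
  have "integrable dA (\<lambda>x. (norm (G x))\<^sup>2 * \<omega> x) \<longleftrightarrow> integrable dA (\<lambda>x. 1 / (growth z s x)\<^sup>2)"
    by (rule Bochner_Integration.integrable_cong) (simp_all add: Gsq)
  then have GL: "L2 G" using Gm gi by (simp add: L2_def)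
  have Gs: "sq G = (LINT x|dA. 1 / (growth z s x)\<^sup>2)"
    unfolding sq_def by (rule Bochner_Integration.integral_cong) (simp_all add: Gsq)
  have Gn: "nrm G \<le> 5 * s"
  proof -
    have "nrm G \<le> sqrt ((5 * s)\<^sup>2)"
      unfolding nrm_def Gs using growth_integral[OF s, of z] by (intro real_sqrt_le_mono) (simp add: power_mult_distrib, smt (verit) zero_le_power2)
    then show ?thesis using s by (simp only: real_sqrt_abs)
  qed
  define F where "F x = complex_of_real (growth z s x) * ker_at z x" for x
  have FL: "L2 F" unfolding F_def[abs_def] by (rule growth_L2[OF bergman_kernel(2)[OF z] z])
  have e: "norm (F x) * norm (G x) * \<omega> x = norm (ker_at z x) * sqrt (\<omega> x)" if x: "x \<in> unit_disk" for x
  proof -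
    have w: "0 < \<omega> x" by (rule omega_pos[OF x])
    have g: "0 < growth z s x" using growth_ge_1[of z s x] by linarith
    have "norm (F x) * norm (G x) * \<omega> x = norm (ker_at z x) * (\<omega> x / sqrt (\<omega> x))"
      using g w by (simp add: F_def G_def norm_mult norm_divide)
    then show ?thesis using w by (simp add: real_div_sqrt)
  qed
  have e2: "nkernel z x = sqrt (\<omega> z) * (norm (F x) * norm (G x) * \<omega> x)" if "x \<in> unit_disk" for x
    unfolding e[OF that] by (simp add: nkernel_def)
  have "integrable dA (nkernel z) \<longleftrightarrow> integrable dA (\<lambda>x. sqrt (\<omega> z) * (norm (F x) * norm (G x) * \<omega> x))"
    by (rule Bochner_Integration.integrable_cong) (simp_all add: e2)
  then show "integrable dA (nkernel z)" using ip_integrable(1)[OF FL GL] by simp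
  have "(LINT x|dA. nkernel z x) = (LINT x|dA. sqrt (\<omega> z) * (norm (F x) * norm (G x) * \<omega> x))"
    by (rule Bochner_Integration.integral_cong) (simp_all add: e2)
  also have "\<dots> = sqrt (\<omega> z) * (LINT x|dA. norm (F x) * norm (G x) * \<omega> x)" by (rule integral_mult_right_zero)
  also have "\<dots> \<le> sqrt (\<omega> z) * (nrm F * nrm G)"
    using wz by (intro mult_left_mono Cauchy_Schwarz FL GL) auto
  also have "\<dots> \<le> sqrt (\<omega> z) * ((CK / (sqrt (\<omega> z) * \<tau> z)) * (5 * s))"
  proof (rule mult_left_mono[OF mult_mono])
    show "nrm F \<le> CK / (sqrt (\<omega> z) * \<tau> z)" using kernel_weighted[OF z] by (simp add: F_def[abs_def] s_def)
    show "0 \<le> CK / (sqrt (\<omega> z) * \<tau> z)" using CK_pos wz tau_pos[OF z] by simp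
  qed (use Gn nrm_nonneg wz in auto)
  also have "\<dots> = KB" using wz tau_pos[OF z] by (simp add: s_def KB_def)
  finally show "(LINT x|dA. nkernel z x) \<le> KB" .
qed

definition kap :: real where
  "kap = min (1 / 2) (1 / (2 * (1 + \<bar>c2\<bar>)\<^sup>2 * scale\<^sup>2))"

lemma kap_pos: "0 < kap"
  using scale(1) by (simp add: kap_def)

text \<open>If \<tau>(x) is much smaller than \<tau>(y), the Lipschitz condition forces the points
  to be at least a multiple of \<tau>(y) apart, so the weight is of order (\<tau>(y) / \<tau>(x))^2,
  more than the linear loss requires.\<close>

lemma tau_growth:
  assumes x: "x \<in> unit_disk" and y: "y \<in> unit_disk"
  shows "kap * \<tau> y \<le> \<tau> x * wgt x y"
proof (cases "\<tau> y / 2 \<le> \<tau> x")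
  case True
  have "kap * \<tau> y \<le> 1 / 2 * \<tau> y"
    using tau_pos[OF y] by (intro mult_right_mono) (auto simp: kap_def)
  also have "\<dots> \<le> \<tau> x * 1" using True by simp
  also have "\<dots> \<le> \<tau> x * wgt x y"
    using tau_pos[OF x] growth_ge_1 by (intro mult_left_mono) auto
  finally show ?thesis .
next
  case False
  define c where "c = 1 + \<bar>c2\<bar>"
  have c: "0 < c" by (simp add: c_def)
  have t: "0 < \<tau> x" "0 < \<tau> y" using tau_pos x y by auto
  have "\<tau> y / 2 \<le> \<tau> y - \<tau> x" using False by simp
  also have "\<dots> \<le> c2 * norm (y - x)" using tau_lip[OF y x] by simp
  also have "\<dots> \<le> c * norm (y - x)" by (intro mult_right_mono) (auto simp: c_def)
  finally have "\<tau> y / (2 * c) \<le> norm (y - x)" using c by (simp add: field_simps)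
  then have "(\<tau> y / (2 * c))\<^sup>2 \<le> (norm (y - x))\<^sup>2" using t c by (intro power_mono) auto
  then have 1: "(\<tau> y / (2 * c))\<^sup>2 / (scale * \<tau> x)\<^sup>2 \<le> wgt x y"
  proof -
    assume "(\<tau> y / (2 * c))\<^sup>2 \<le> (norm (y - x))\<^sup>2"
    then have "(\<tau> y / (2 * c))\<^sup>2 / (scale * \<tau> x)\<^sup>2 \<le> (norm (y - x))\<^sup>2 / (scale * \<tau> x)\<^sup>2"
      by (rule divide_right_mono) simp
    then show ?thesis by (simp add: growth_def)
  qed
  have "kap * \<tau> y \<le> 1 / (2 * c\<^sup>2 * scale\<^sup>2) * \<tau> y"
    using t by (intro mult_right_mono) (auto simp: kap_def c_def)
  also have "\<dots> = (\<tau> y)\<^sup>2 / (4 * c\<^sup>2 * scale\<^sup>2) * (2 / \<tau> y)"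
    using t by (simp add: power2_eq_square)
  also have "\<dots> \<le> (\<tau> y)\<^sup>2 / (4 * c\<^sup>2 * scale\<^sup>2) * (1 / \<tau> x)"
    using t False by (intro mult_left_mono) (auto simp: field_simps)
  also have "\<dots> = \<tau> x * ((\<tau> y / (2 * c))\<^sup>2 / (scale * \<tau> x)\<^sup>2)"
    using t by (simp add: power_divide power_mult_distrib power2_eq_square)
  also have "\<dots> \<le> \<tau> x * wgt x y" using 1 t by (intro mult_left_mono) auto
  finally show ?thesis .
qed

definition CP :: real where
  "CP = 2 * CK * CH / kap"

text \<open>Evaluation at \<open>z\<close> is written as a pairing with \<open>peak z\<close>, and
  the weight centred at \<open>x\<close> is shifted from the kernel to \<open>peak\<close>. The
  bound involves \<tau>(z) alone and is thus uniform in the variable of integration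
  \<open>x\<close>, which makes the projection converge on all the spaces considered.\<close>

lemma kk_pointwise:
  assumes z: "z \<in> unit_disk" and x: "x \<in> unit_disk"
  shows "nkernel z x \<le> CP / (\<tau> z)\<^sup>2"
proof -
  have t: "0 < \<tau> x" "0 < \<tau> z" and w: "0 < \<omega> x" "0 < \<omega> z" using tau_pos omega_pos x z by auto
  let ?X = "\<lambda>y. complex_of_real (wgt x y)"
  note K = bergman_kernel[OF x]
  \<comment> \<open>A bound for the inverse weight on the support of \<open>peak z\<close>, by
    \<open>tau_growth\<close> and \<tau> \<ge> \<tau>(z) / 2 there. Its factor \<tau>(x) cancels the
    one in the kernel norm.\<close>
  define c where "c = 2 * \<tau> x / (kap * \<tau> z)"
  have c: "0 \<le> c" using t kap_pos by (simp add: c_def)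
  define Q where "Q y = inverse (?X y) * peak z y" for y
  have g0: "0 < wgt x y" for y using growth_ge_1[of x _ y] less_le_trans[OF zero_less_one] by blast
  have Qm: "Q \<in> borel_measurable dA"
  proof -
    have "continuous_on unit_disk (\<lambda>y. inverse (?X y))"
      using g0 by (intro continuous_intros growth_cont) (simp add: growth_nz)
    then show ?thesis unfolding Q_def[abs_def]
      using continuous_imp_measurable_dA L2_meas[OF peak_L2[OF z]] by (intro borel_measurable_times) auto
  qed
  have Qle: "norm (Q y) \<le> norm (of_real c * peak z y)" if y: "y \<in> unit_disk" for y
  proof (cases "norm (y - z) < rad z")
    case True
    have "\<tau> z / 2 \<le> \<tau> y" using rad(4)[OF z, of y] True by simp
    then have "kap * (\<tau> z / 2) \<le> kap * \<tau> y" using kap_pos by (intro mult_left_mono) auto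
    also have "\<dots> \<le> \<tau> x * wgt x y" by (rule tau_growth[OF x y])
    finally have "kap * (\<tau> z / 2) \<le> \<tau> x * wgt x y" .
    then have "inverse (wgt x y) \<le> c"
      using t kap_pos g0[of y] by (simp add: c_def field_simps)
    then show ?thesis unfolding Q_def norm_mult norm_inverse norm_of_real
      using g0[of y] c by (intro mult_right_mono) auto
  qed (use peak_vanish[OF z y] in \<open>simp add: Q_def\<close>)
  note Q = L2_mono[OF Qm L2_cmult[OF peak_L2[OF z]] Qle]
  have Qn: "nrm Q \<le> c * nrm (peak z)" using Q(3) c unfolding nrm_cmult norm_of_real by simp
  define F where "F y = ?X y * ker_at x y" for y
  have FL: "L2 F" unfolding F_def[abs_def] by (rule growth_L2[OF K(2) x])
  have "ker_at x z = ip (ker_at x) (peak z)" using peak_reproducing[OF z K(1)] by simp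
  also have "\<dots> = ip F Q"
    unfolding A2_inner_def using g0
    by (intro Bochner_Integration.integral_cong) (simp_all add: F_def Q_def growth_nz)
  finally have "norm (ker_at x z) \<le> nrm F * nrm Q" using Cauchy_Schwarz(2)[OF FL Q(1)] by simp
  also have "\<dots> \<le> (CK / (sqrt (\<omega> x) * \<tau> x)) * (c * (CH / (sqrt (\<omega> z) * \<tau> z)))"
  proof (rule mult_mono)
    show "nrm F \<le> CK / (sqrt (\<omega> x) * \<tau> x)" using kernel_weighted[OF x] by (simp add: F_def[abs_def])
    show "nrm Q \<le> c * (CH / (sqrt (\<omega> z) * \<tau> z))"
      by (rule order_trans[OF Qn mult_left_mono[OF peak_nrm[OF z] c]])
    show "0 \<le> CK / (sqrt (\<omega> x) * \<tau> x)" using CK_pos w t by simp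
  qed (rule nrm_nonneg)
  also have "\<dots> = CP / (\<tau> z)\<^sup>2 / (sqrt (\<omega> x) * sqrt (\<omega> z))"
    using t w kap_pos by (simp add: c_def CP_def power2_eq_square field_simps)
  finally have "norm (ker_at x z) \<le> CP / (\<tau> z)\<^sup>2 / (sqrt (\<omega> x) * sqrt (\<omega> z))" .
  then have "norm (ker_at x z) * (sqrt (\<omega> x) * sqrt (\<omega> z)) \<le> CP / (\<tau> z)\<^sup>2"
    using w by (subst (asm) pos_le_divide_eq) simp_all
  then show ?thesis unfolding kk_sym[OF z x] by (simp add: nkernel_def mult.assoc)
qed

end

section \<open>The Schur test\<close>

text \<open>The factors carry completed Lebesgue sigma-algebras, whose product still contains the
  Borel sets of the product. Extending by zero reduces the claim to Borel measurability on the whole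
  space.\<close>

lemma continuous_imp_measurable_pair_dA:
  fixes f :: "complex \<times> complex \<Rightarrow> 'a::{real_normed_vector,second_countable_topology}"
  assumes "continuous_on (unit_disk \<times> unit_disk) f"
  shows "f \<in> borel_measurable (dA \<Otimes>\<^sub>M dA)"
proof -
  define F where "F p = indicator (unit_disk \<times> unit_disk) p *\<^sub>R f p" for p
  have F: "F \<in> borel_measurable borel"
    unfolding F_def[abs_def]
    by (rule borel_measurable_continuous_on_indicator[OF _ assms]) (intro borel_open open_Times open_ball)
  have "(\<lambda>p. (fst p, snd p)) \<in> dA \<Otimes>\<^sub>M dA \<rightarrow>\<^sub>M borel \<Otimes>\<^sub>M borel"
    by (intro measurable_Pair measurable_compose[OF measurable_fst measurable_id_dA] measurable_compose[OF measurable_snd measurable_id_dA])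
  then have "(\<lambda>p. p) \<in> dA \<Otimes>\<^sub>M dA \<rightarrow>\<^sub>M (borel :: (complex \<times> complex) measure)"
    by (simp add: borel_prod)
  from measurable_compose[OF this F] have "F \<in> borel_measurable (dA \<Otimes>\<^sub>M dA)" .
  moreover have "f \<in> borel_measurable (dA \<Otimes>\<^sub>M dA) \<longleftrightarrow> F \<in> borel_measurable (dA \<Otimes>\<^sub>M dA)"
    by (rule measurable_cong) (simp add: F_def space_pair_measure)
  ultimately show ?thesis by simp
qed

context exp_weight
begin

section \<open>Local bounds and joint continuity of the kernel\<close>

lemma kernel_bound:
  assumes "z \<in> unit_disk" "x \<in> unit_disk"
  shows "norm (ker_at z x) * sqrt (\<omega> x) \<le> CP / ((\<tau> z)\<^sup>2 * sqrt (\<omega> z))"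
proof -
  have w: "0 < sqrt (\<omega> z)" using omega_pos[OF assms(1)] by simp
  have "norm (ker_at z x) * sqrt (\<omega> x) * sqrt (\<omega> z) \<le> CP / (\<tau> z)\<^sup>2"
    using kk_pointwise[OF assms] by (simp add: nkernel_def mult_ac)
  then have "norm (ker_at z x) * sqrt (\<omega> x) \<le> CP / (\<tau> z)\<^sup>2 / sqrt (\<omega> z)"
    by (simp only: pos_le_divide_eq[OF w])
  then show ?thesis by simp
qed

lemma local_bound:
  fixes g :: "complex \<Rightarrow> real"
  assumes w: "w \<in> unit_disk" and g: "continuous_on unit_disk g"
  obtains r B where "0 < r" "cball w r \<subseteq> unit_disk" "0 \<le> B" "\<And>z. z \<in> cball w r \<Longrightarrow> g z \<le> B"
proof -
  obtain r where r: "0 < r" "cball w r \<subseteq> unit_disk" using bspec[OF iffD1[OF open_contains_cball open_ball] w] by auto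
  have "compact (g ` cball w r)"
    by (intro compact_continuous_image continuous_on_subset[OF g r(2)] compact_cball)
  then obtain B where "\<And>z. z \<in> cball w r \<Longrightarrow> norm (g z) \<le> B"
    by (meson bounded_iff compact_imp_bounded imageI)
  then have "g z \<le> max 0 B" if "z \<in> cball w r" for z using that by force
  with r show ?thesis by (intro that[of r "max 0 B"]) auto
qed

lemma kernel_bound_cont:
  "continuous_on unit_disk (\<lambda>z. CP / ((\<tau> z)\<^sup>2 * sqrt (\<omega> z)))"
  "continuous_on unit_disk (\<lambda>z. 1 / sqrt (\<omega> z))"
  using tau_pos omega_pos by (intro continuous_intros tau_cont omega_cont; force)+

text \<open>A locally bounded kernel, holomorphic in one variable and antiholomorphic in the other,
  is locally Lipschitz in each with a uniform constant. Joint continuity is what makes the kernel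
  measurable on the product, as Fubini demands.\<close>

lemma kernel_continuous: "continuous_on (unit_disk \<times> unit_disk) (\<lambda>p. ker_at (fst p) (snd p))"
proof -
  have "isCont (\<lambda>p. ker_at (fst p) (snd p)) p0" if "p0 \<in> unit_disk \<times> unit_disk" for p0
  proof -
    obtain z0 x0 where p0: "p0 = (z0, x0)" "z0 \<in> unit_disk" "x0 \<in> unit_disk" using \<open>p0 \<in> unit_disk \<times> unit_disk\<close> by auto
    obtain r1 B1 where 1: "0 < r1" "cball z0 r1 \<subseteq> unit_disk" "0 \<le> B1" "\<And>z. z \<in> cball z0 r1 \<Longrightarrow> CP / ((\<tau> z)\<^sup>2 * sqrt (\<omega> z)) \<le> B1"
      using local_bound[OF p0(2) kernel_bound_cont(1)] by blast
    obtain r2 B2 where 2: "0 < r2" "cball x0 r2 \<subseteq> unit_disk" "0 \<le> B2" "\<And>z. z \<in> cball x0 r2 \<Longrightarrow> 1 / sqrt (\<omega> z) \<le> B2"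
      using local_bound[OF p0(3) kernel_bound_cont(2)] by blast
    define r where "r = min r1 r2"
    define B where "B = B1 * B2"
    have r: "0 < r" and B0: "0 \<le> B" using 1 2 by (auto simp: r_def B_def)
    have sub: "ball z0 r \<subseteq> unit_disk" "ball x0 r \<subseteq> unit_disk"
      using 1(2) 2(2) by (auto simp: r_def subset_iff)
    have B: "norm (ker_at z x) \<le> B" if "z \<in> ball z0 r" "x \<in> ball x0 r" for z x
    proof -
      have d: "z \<in> unit_disk" "x \<in> unit_disk" and c: "z \<in> cball z0 r1" "x \<in> cball x0 r2" using that sub by (auto simp: r_def)
      have w: "0 < sqrt (\<omega> x)" using omega_pos[OF d(2)] by simp
      have "norm (ker_at z x) = (norm (ker_at z x) * sqrt (\<omega> x)) * (1 / sqrt (\<omega> x))" using w by simp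
      also have "\<dots> \<le> B1 * B2"
        using w by (intro mult_mono order_trans[OF kernel_bound[OF d] 1(4)[OF c(1)]] 2(4)[OF c(2)] 1(3)) auto
      finally show ?thesis by (simp add: B_def)
    qed
    define L where "L = 4 * B / r"
    have L0: "0 \<le> L" using B0 r by (simp add: L_def)
    have lip: "norm (ker_at z x - ker_at z0 x0) \<le> L * norm (x - x0) + L * norm (z - z0)" if z: "z \<in> ball z0 (r / 2)" and x: "x \<in> ball x0 (r / 2)" for z x
    proof -
      have zr: "z \<in> ball z0 r" and zd: "z \<in> unit_disk" using z r sub by (auto simp: subset_iff)
      have c: "x0 \<in> ball x0 (r / 2)" "z0 \<in> ball z0 (r / 2)" "x0 \<in> ball x0 r" using r by auto
      have "norm (ker_at z x - ker_at z x0) \<le> 4 * B / r * norm (x - x0)"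
        by (rule holomorphic_Lipschitz[OF holomorphic_on_subset[OF bergman_kernel(1)[OF zd] sub(2)] B[OF zr] r x c(1)])
      moreover have "norm (ker_at x0 z - ker_at x0 z0) \<le> 4 * B / r * norm (z - z0)"
      proof (rule holomorphic_Lipschitz[OF holomorphic_on_subset[OF bergman_kernel(1)[OF p0(3)] sub(1)] _ r z c(2)])
        show "norm (ker_at x0 u) \<le> B" if "u \<in> ball z0 r" for u
          using B[OF that c(3)] kernel_sym[of u x0] that sub(1) p0(3) by auto
      qed
      \<comment> \<open>The symmetry turns a move of the index \<open>z\<close> into a move of the
        argument of a holomorphic function.\<close>
      moreover have "ker_at z x0 - ker_at z0 x0 = cnj (ker_at x0 z - ker_at x0 z0)"
        using kernel_sym[OF zd p0(3)] kernel_sym[OF p0(2,3)] by simp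
      ultimately have "norm (ker_at z x - ker_at z x0) \<le> L * norm (x - x0)" "norm (ker_at z x0 - ker_at z0 x0) \<le> L * norm (z - z0)"
        by (simp_all add: L_def del: complex_cnj_diff)
      then show ?thesis
        using norm_triangle_ineq[of "ker_at z x - ker_at z x0" "ker_at z x0 - ker_at z0 x0"] by simp
    qed
    show ?thesis
      unfolding continuous_at_eps_delta
    proof (intro allI impI)
      fix e :: real assume e: "0 < e"
      \<comment> \<open>Two Lipschitz moves cost \<open>2 * L\<close>; the summand 1 keeps the
        quotient meaningful when \<open>L\<close> is 0.\<close>
      define d where "d = min (r / 2) (e / (2 * L + 1))"
      have d: "0 < d" using e r L0 by (simp add: d_def)
      have "dist (ker_at (fst p) (snd p)) (ker_at (fst p0) (snd p0)) < e" if p: "dist p p0 < d" for p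
      proof -
        have f: "norm (fst p - z0) \<le> dist p p0" "norm (snd p - x0) \<le> dist p p0"
          using dist_fst_le[of p p0] dist_snd_le[of p p0] by (simp_all add: p0 dist_norm)
        have "fst p \<in> ball z0 (r / 2)" "snd p \<in> ball x0 (r / 2)"
          using f p by (auto simp: d_def dist_norm norm_minus_commute)
        then have "norm (ker_at (fst p) (snd p) - ker_at z0 x0) \<le> L * norm (snd p - x0) + L * norm (fst p - z0)" by (rule lip)
        also have "\<dots> \<le> L * dist p p0 + L * dist p p0" using f L0 by (intro add_mono mult_left_mono) auto
        also have "\<dots> \<le> (2 * L + 1) * dist p p0" by (simp add: algebra_simps)
        also have "\<dots> < (2 * L + 1) * (e / (2 * L + 1))"
          using p L0 by (intro mult_strict_left_mono) (auto simp: d_def)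
        also have "\<dots> = e" using L0 by simp
        finally show ?thesis by (simp add: dist_norm p0)
      qed
      with d show "\<exists>d>0. \<forall>x'. dist x' p0 < d \<longrightarrow> dist (ker_at (fst x') (snd x')) (ker_at (fst p0) (snd p0)) < e" by blast
    qed
  qed
  then show ?thesis by (simp add: continuous_at_imp_continuous_on)
qed

lemma kk_measurable [measurable]: "(\<lambda>(z, x). nkernel z x) \<in> borel_measurable (dA \<Otimes>\<^sub>M dA)"
proof -
  have "continuous_on (unit_disk \<times> unit_disk) (\<lambda>p. norm (ker_at (fst p) (snd p)) * sqrt (\<omega> (fst p)) * sqrt (\<omega> (snd p)))"
    by (intro continuous_intros kernel_continuous continuous_on_compose2[OF omega_cont]) auto
  from continuous_imp_measurable_pair_dA[OF this] show ?thesis by (simp add: nkernel_def split_def)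
qed

section \<open>Passage to unweighted L^p and the Schur test\<close>

definition amp :: "(complex \<Rightarrow> complex) \<Rightarrow> complex \<Rightarrow> real" where
  "amp f x = norm (f x) * sqrt (\<omega> x)"

lemma amp_nonneg: "x \<in> unit_disk \<Longrightarrow> 0 \<le> amp f x"
  using omega_pos[of x] by (simp add: amp_def)

lemma amp_powr:
  assumes "x \<in> unit_disk"
  shows "norm (f x) powr p * \<omega> x powr (p / 2) = amp f x powr p"
  using omega_pos[OF assms] by (simp add: amp_def powr_mult powr_half_sqrt[symmetric] powr_powr)

lemma amp_meas [measurable]: "f \<in> borel_measurable dA \<Longrightarrow> amp f \<in> borel_measurable dA"
  unfolding amp_def[abs_def]
  by (intro borel_measurable_times measurable_compose[OF _ borel_measurable_norm]
      continuous_imp_measurable_dA[of "\<lambda>x. sqrt (\<omega> x)"] continuous_intros omega_cont)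

lemma Lp_iff:
  "f \<in> Lp_space p (\<lambda>x. \<omega> x powr (p / 2)) \<longleftrightarrow> f \<in> borel_measurable dA \<and> integrable dA (\<lambda>x. amp f x powr p)"
proof -
  have "integrable dA (\<lambda>x. norm (f x) powr p * \<omega> x powr (p / 2)) \<longleftrightarrow> integrable dA (\<lambda>x. amp f x powr p)"
    by (rule Bochner_Integration.integrable_cong) (simp_all add: amp_powr)
  then show ?thesis by (simp add: Lp_space_def)
qed

lemma Lp_norm_eq:
  "Lp_norm p (\<lambda>x. \<omega> x powr (p / 2)) f = (LINT x|dA. amp f x powr p) powr (1 / p)"
proof -
  have "(LINT x|dA. norm (f x) powr p * \<omega> x powr (p / 2)) = (LINT x|dA. amp f x powr p)"
    by (rule Bochner_Integration.integral_cong) (simp_all add: amp_powr)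
  then show ?thesis by (simp add: Lp_norm_def)
qed

text \<open>The measure is finite and t \<le> 1 + t^p for t \<ge> 0 and p \<ge> 1, so all exponents
  reduce to L^1, where the bounded kernel can be paired.\<close>

lemma amp_integrable:
  assumes p: "1 \<le> p" and f: "f \<in> Lp_space p (\<lambda>x. \<omega> x powr (p / 2))"
  shows "integrable dA (amp f)"
proof (rule Bochner_Integration.integrable_bound[where f="\<lambda>x. 1 + amp f x powr p"])
  show "integrable dA (\<lambda>x. 1 + amp f x powr p)" using f by (simp add: Lp_iff)
  show "amp f \<in> borel_measurable dA" using f by (intro amp_meas) (simp add: Lp_iff)
  have "norm (amp f x) \<le> norm (1 + amp f x powr p)" if "x \<in> unit_disk" for x
  proof (cases "amp f x \<le> 1")
    case True
    moreover have "0 \<le> amp f x powr p" by simp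
    ultimately show ?thesis using amp_nonneg[OF that, of f] by (simp only: real_norm_def)
  next
    case False
    then have "amp f x powr 1 \<le> amp f x powr p" using p by (intro powr_mono) auto
    then show ?thesis using False by simp
  qed
  then show "AE x in dA. norm (amp f x) \<le> norm (1 + amp f x powr p)" by (intro AE_I2) simp
qed

lemma kernel_meas: "z \<in> unit_disk \<Longrightarrow> ker_at z \<in> borel_measurable dA"
  by (intro continuous_imp_measurable_dA holomorphic_on_imp_continuous_on bergman_kernel(1))

lemma integrand_bound:
  assumes z: "z \<in> unit_disk" and x: "x \<in> unit_disk"
  shows "norm (f x * cnj (ker_at z x) * of_real (\<omega> x)) = amp f x * (norm (ker_at z x) * sqrt (\<omega> x))"
    and "amp f x * (norm (ker_at z x) * sqrt (\<omega> x)) \<le> amp f x * (CP / ((\<tau> z)\<^sup>2 * sqrt (\<omega> z)))"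
proof -
  have w: "0 < \<omega> x" by (rule omega_pos[OF x])
  have "\<omega> x = sqrt (\<omega> x) * sqrt (\<omega> x)" using w by simp
  then show "norm (f x * cnj (ker_at z x) * of_real (\<omega> x)) = amp f x * (norm (ker_at z x) * sqrt (\<omega> x))"
    using w by (simp add: amp_def norm_mult)
  show "amp f x * (norm (ker_at z x) * sqrt (\<omega> x)) \<le> amp f x * (CP / ((\<tau> z)\<^sup>2 * sqrt (\<omega> z)))"
    by (rule mult_left_mono[OF kernel_bound[OF z x] amp_nonneg[OF x]])
qed

lemma projection_integrable:
  assumes p: "1 \<le> p" and f: "f \<in> Lp_space p (\<lambda>x. \<omega> x powr (p / 2))" and z: "z \<in> unit_disk"
  shows "integrable dA (\<lambda>x. f x * cnj (ker_at z x) * complex_of_real (\<omega> x))"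
proof (rule Bochner_Integration.integrable_bound)
  show "integrable dA (\<lambda>x. amp f x * (CP / ((\<tau> z)\<^sup>2 * sqrt (\<omega> z))))"
    using amp_integrable[OF p f] by (rule integrable_mult_left)
  have [measurable]: "f \<in> borel_measurable dA" "ker_at z \<in> borel_measurable dA"
    using f kernel_meas[OF z] by (auto simp: Lp_iff)
  show "(\<lambda>x. f x * cnj (ker_at z x) * complex_of_real (\<omega> x)) \<in> borel_measurable dA" by measurable
  show "AE x in dA. norm (f x * cnj (ker_at z x) * complex_of_real (\<omega> x)) \<le> norm (amp f x * (CP / ((\<tau> z)\<^sup>2 * sqrt (\<omega> z))))"
  proof (rule AE_I2)
    fix x assume "x \<in> space dA"
    then have x: "x \<in> unit_disk" by simp
    show "norm (f x * cnj (ker_at z x) * complex_of_real (\<omega> x)) \<le> norm (amp f x * (CP / ((\<tau> z)\<^sup>2 * sqrt (\<omega> z))))"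
      using integrand_bound[OF z x, of f] by (simp only: real_norm_def)
  qed
qed

text \<open>By symmetry \<open>cnj (ker_at z x)\<close> equals \<open>ker_at x z\<close>, which is
  holomorphic in \<open>z\<close>. The pointwise kernel bound is locally uniform in \<open>z\<close>
  and provides the integrable majorant.\<close>

lemma projection_holomorphic:
  assumes p: "1 \<le> p" and f: "f \<in> Lp_space p (\<lambda>x. \<omega> x powr (p / 2))"
  shows "bergman_projection \<omega> f holomorphic_on unit_disk"
proof -
  have hol: "(\<lambda>z. LINT x|dA. f x * ker_at x z * of_real (\<omega> x)) holomorphic_on unit_disk"
  proof (rule holomorphic_lebesgue_integral)
    show "(\<lambda>z. f x * ker_at x z * of_real (\<omega> x)) holomorphic_on unit_disk" if "x \<in> space dA" for x
      using that by (intro holomorphic_intros bergman_kernel(1)) simp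
    show "(\<lambda>x. f x * ker_at x z * of_real (\<omega> x)) \<in> borel_measurable dA" if z: "z \<in> unit_disk" for z
    proof -
      have "(\<lambda>x. f x * cnj (ker_at z x) * of_real (\<omega> x)) \<in> borel_measurable dA"
        using projection_integrable[OF p f z] by (rule borel_measurable_integrable)
      then show ?thesis
      proof (rule measurable_cong[THEN iffD1, rotated])
        fix x assume "x \<in> space dA"
        then have x: "x \<in> unit_disk" by simp
        show "f x * cnj (ker_at z x) * of_real (\<omega> x) = f x * ker_at x z * of_real (\<omega> x)"
          unfolding kernel_sym[OF z x] by simp
      qed
    qed
    show "\<exists>r>0. \<exists>B. ball w r \<subseteq> unit_disk \<and> integrable dA B \<and> (\<forall>x\<in>space dA. \<forall>y\<in>ball w r. norm (f x * ker_at x y * of_real (\<omega> x)) \<le> B x)"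
      if w: "w \<in> unit_disk" for w
    proof -
      obtain r B where r: "0 < r" "cball w r \<subseteq> unit_disk" "0 \<le> B" "\<And>z. z \<in> cball w r \<Longrightarrow> CP / ((\<tau> z)\<^sup>2 * sqrt (\<omega> z)) \<le> B"
        using local_bound[OF w kernel_bound_cont(1)] by blast
      have "norm (f x * ker_at x y * of_real (\<omega> x)) \<le> amp f x * B" if x: "x \<in> unit_disk" and y: "y \<in> ball w r" for x y
      proof -
        have yc: "y \<in> cball w r" using y by simp
        have yd: "y \<in> unit_disk" by (rule subsetD[OF r(2) yc])
        have "norm (f x * ker_at x y * of_real (\<omega> x)) = norm (f x * cnj (ker_at y x) * of_real (\<omega> x))"
          unfolding kernel_sym[OF yd x] by simp
        also have "\<dots> \<le> amp f x * (CP / ((\<tau> y)\<^sup>2 * sqrt (\<omega> y)))"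
          using integrand_bound[OF yd x, of f] by (simp only:)
        also have "\<dots> \<le> amp f x * B" by (rule mult_left_mono[OF r(4)[OF yc] amp_nonneg[OF x]])
        finally show ?thesis .
      qed
      then have "\<forall>x\<in>space dA. \<forall>y\<in>ball w r. norm (f x * ker_at x y * of_real (\<omega> x)) \<le> amp f x * B" by simp
      moreover have "integrable dA (\<lambda>x. amp f x * B)"
        using amp_integrable[OF p f] by (rule integrable_mult_left)
      moreover have "ball w r \<subseteq> unit_disk" using r(2) ball_subset_cball by (rule order_trans[rotated])
      ultimately show ?thesis using r(1) by blast
    qed
  qed simp
  have "bergman_projection \<omega> f z = (LINT x|dA. f x * ker_at x z * of_real (\<omega> x))" if z: "z \<in> unit_disk" for z
    unfolding bergman_projection_def
  proof (rule Bochner_Integration.integral_cong[OF refl])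
    fix x assume "x \<in> space dA"
    then have x: "x \<in> unit_disk" by simp
    show "f x * cnj (ker_at z x) * of_real (\<omega> x) = f x * ker_at x z * of_real (\<omega> x)"
      unfolding kernel_sym[OF z x] by simp
  qed
  then show ?thesis by (intro holomorphic_transform[OF hol]) simp
qed

text \<open>Jensen's inequality for the measure \<open>nkernel z\<close>, whose mass is at most
  \<open>KB\<close> but need not equal it. The tangent inequality handles the missing mass
  directly.\<close>

lemma schur_pointwise:
  assumes p: "1 \<le> p" and f: "f \<in> Lp_space p (\<lambda>x. \<omega> x powr (p / 2))" and z: "z \<in> unit_disk"
  shows "amp (bergman_projection \<omega> f) z powr p \<le> KB powr (p - 1) * (LINT x|dA. amp f x powr p * nkernel z x)"
    and "integrable dA (\<lambda>x. amp f x powr p * nkernel z x)"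
proof -
  have fm [measurable]: "f \<in> borel_measurable dA" and fi: "integrable dA (\<lambda>x. amp f x powr p)" using f by (auto simp: Lp_iff)
  have wz: "0 < sqrt (\<omega> z)" using omega_pos[OF z] by simp
  define b where "b = CP / (\<tau> z)\<^sup>2"
  have kb: "norm (nkernel z x) \<le> b" if "x \<in> unit_disk" for x
    using kk_pointwise[OF z that] kk_nonneg[OF z that] by (simp add: b_def)
  have kz [measurable]: "nkernel z \<in> borel_measurable dA" using kk_integral(1)[OF z] by (rule borel_measurable_integrable)
  have mult: "integrable dA (\<lambda>x. g x * nkernel z x)" if g: "integrable dA g" for g :: "complex \<Rightarrow> real"
  proof (rule Bochner_Integration.integrable_bound)
    show "integrable dA (\<lambda>x. g x * b)" using g by (rule integrable_mult_left)
    have [measurable]: "g \<in> borel_measurable dA" using g by (rule borel_measurable_integrable)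
    show "(\<lambda>x. g x * nkernel z x) \<in> borel_measurable dA" by measurable
    have "0 \<le> b" using kb[OF z] norm_ge_zero order_trans by blast
    then show "AE x in dA. norm (g x * nkernel z x) \<le> norm (g x * b)"
      using kb by (intro AE_I2) (simp add: abs_mult mult_left_mono)
  qed
  show i2: "integrable dA (\<lambda>x. amp f x powr p * nkernel z x)" by (rule mult[OF fi])
  have i1: "integrable dA (\<lambda>x. amp f x * nkernel z x)" by (rule mult[OF amp_integrable[OF p f]])
  have ik: "integrable dA (nkernel z)" by (rule kk_integral(1)[OF z])
  define U where "U = (LINT x|dA. amp f x * nkernel z x)"
  have U0: "0 \<le> U" unfolding U_def
    by (rule Bochner_Integration.integral_nonneg_AE) (auto intro!: AE_I2 mult_nonneg_nonneg amp_nonneg kk_nonneg z)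
  have "amp (bergman_projection \<omega> f) z \<le> U"
  proof -
    have "norm (bergman_projection \<omega> f z) \<le> (LINT x|dA. norm (f x * cnj (ker_at z x) * of_real (\<omega> x)))"
      unfolding bergman_projection_def by (rule integral_norm_bound)
    also have "\<dots> = (LINT x|dA. amp f x * nkernel z x / sqrt (\<omega> z))"
    proof (rule Bochner_Integration.integral_cong[OF refl])
      fix x assume "x \<in> space dA"
      then have x: "x \<in> unit_disk" by simp
      show "norm (f x * cnj (ker_at z x) * of_real (\<omega> x)) = amp f x * nkernel z x / sqrt (\<omega> z)"
        unfolding integrand_bound(1)[OF z x] using wz by (simp add: nkernel_def)
    qed
    also have "\<dots> = U / sqrt (\<omega> z)" by (simp add: U_def)
    finally have "norm (bergman_projection \<omega> f z) * sqrt (\<omega> z) \<le> U" by (simp only: pos_le_divide_eq[OF wz])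
    then show ?thesis by (simp add: amp_def)
  qed
  then have "amp (bergman_projection \<omega> f) z powr p \<le> U powr p"
    using p amp_nonneg[OF z] by (intro powr_mono2) auto
  also have "\<dots> \<le> KB powr (p - 1) * (LINT x|dA. amp f x powr p * nkernel z x)"
  proof (cases "U = 0")
    case True
    have "0 \<le> (LINT x|dA. amp f x powr p * nkernel z x)"
      by (rule Bochner_Integration.integral_nonneg_AE) (auto intro!: AE_I2 mult_nonneg_nonneg kk_nonneg z)
    then show ?thesis using True by simp
  next
    case False
    \<comment> \<open>The tangent point is the mean that would result if the mass were exactly
      \<open>KB\<close>; the true mass could be smaller.\<close>
    define c where "c = U / KB"
    have c: "0 < c" using False U0 KB_pos by (simp add: c_def)
    have Uc: "U = c * KB" using KB_pos by (simp add: c_def)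
    define S where "S = (LINT x|dA. nkernel z x)"
    have S: "S \<le> KB" unfolding S_def by (rule kk_integral(2)[OF z])
    have cp: "c powr (p - 1) * c = c powr p" using c by (simp add: powr_diff)
    have eq: "(c powr p + p * c powr (p - 1) * (amp f x - c)) * nkernel z x
        = (c powr p - p * c powr (p - 1) * c) * nkernel z x + p * c powr (p - 1) * (amp f x * nkernel z x)" for x
      by (simp add: algebra_simps)
    \<comment> \<open>The missing mass \<open>KB - S\<close> works in the right direction because p
      \<ge> 1.\<close>
    have "c powr p * KB \<le> c powr p * S + p * c powr p * (KB - S)"
    proof -
      have "0 \<le> (p - 1) * (c powr p * (KB - S))" using p S by (intro mult_nonneg_nonneg) auto
      then show ?thesis by (simp add: algebra_simps)
    qed
    also have "\<dots> = (c powr p - p * c powr (p - 1) * c) * S + p * c powr (p - 1) * U"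
      unfolding Uc cp[symmetric] by (simp add: algebra_simps)
    also have "\<dots> = (LINT x|dA. (c powr p + p * c powr (p - 1) * (amp f x - c)) * nkernel z x)"
      unfolding eq S_def U_def using ik i1 by simp
    also have "\<dots> \<le> (LINT x|dA. amp f x powr p * nkernel z x)"
    proof (rule integral_mono[OF _ i2])
      show "integrable dA (\<lambda>x. (c powr p + p * c powr (p - 1) * (amp f x - c)) * nkernel z x)"
        unfolding eq using ik i1 by simp
      show "(c powr p + p * c powr (p - 1) * (amp f x - c)) * nkernel z x \<le> amp f x powr p * nkernel z x" if "x \<in> space dA" for x
        using that by (intro mult_right_mono powr_tangent p c amp_nonneg kk_nonneg z) auto
    qed
    finally have "KB powr (p - 1) * (c powr p * KB) \<le> KB powr (p - 1) * (LINT x|dA. amp f x powr p * nkernel z x)"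
      by (rule mult_left_mono) simp
    moreover have "KB powr (p - 1) * (c powr p * KB) = U powr p"
      using c KB_pos by (simp add: Uc powr_mult powr_diff)
    ultimately show ?thesis by simp
  qed
  finally show "amp (bergman_projection \<omega> f) z powr p \<le> KB powr (p - 1) * (LINT x|dA. amp f x powr p * nkernel z x)" .
qed

text \<open>Integrating the pointwise Schur bound and exchanging the integrals leaves the integral
  of the kernel in its first variable, which by symmetry is again at most \<open>KB\<close>. The
  powers p - 1 and 1 of \<open>KB\<close> combine.\<close>

lemma projection_Lp:
  assumes p: "1 \<le> p" and f: "f \<in> Lp_space p (\<lambda>x. \<omega> x powr (p / 2))"
  shows "bergman_projection \<omega> f \<in> Lp_space p (\<lambda>x. \<omega> x powr (p / 2))"
    and "(LINT x|dA. amp (bergman_projection \<omega> f) x powr p) \<le> KB powr p * (LINT x|dA. amp f x powr p)"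
proof -
  interpret pair_sigma_finite dA dA ..
  have fm: "f \<in> borel_measurable dA" and fi: "integrable dA (\<lambda>x. amp f x powr p)" using f by (auto simp: Lp_iff)
  have [measurable]: "amp f \<in> borel_measurable dA" by (rule amp_meas[OF fm])
  have Pm: "bergman_projection \<omega> f \<in> borel_measurable dA"
    by (intro continuous_imp_measurable_dA holomorphic_on_imp_continuous_on projection_holomorphic[OF p f])
  have [measurable]: "amp (bergman_projection \<omega> f) \<in> borel_measurable dA" by (rule amp_meas[OF Pm])
  define I where "I = (LINT x|dA. amp f x powr p)"
  have nI: "(\<integral>\<^sup>+x. ennreal (amp f x powr p) \<partial>dA) = ennreal I"
    unfolding I_def by (rule nn_integral_eq_integral[OF fi]) simp
  have pt: "ennreal (amp (bergman_projection \<omega> f) z powr p) \<le> ennreal (KB powr (p - 1)) * (\<integral>\<^sup>+x. ennreal (amp f x powr p * nkernel z x) \<partial>dA)" if z: "z \<in> unit_disk" for z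
  proof -
    have "ennreal (amp (bergman_projection \<omega> f) z powr p) \<le> ennreal (KB powr (p - 1) * (LINT x|dA. amp f x powr p * nkernel z x))"
      by (rule ennreal_leI[OF schur_pointwise(1)[OF p f z]])
    also have "\<dots> = ennreal (KB powr (p - 1)) * ennreal (LINT x|dA. amp f x powr p * nkernel z x)"
      by (rule ennreal_mult') simp
    also have "ennreal (LINT x|dA. amp f x powr p * nkernel z x) = (\<integral>\<^sup>+x. ennreal (amp f x powr p * nkernel z x) \<partial>dA)"
      by (rule nn_integral_eq_integral[symmetric, OF schur_pointwise(2)[OF p f z]])
         (auto intro!: AE_I2 mult_nonneg_nonneg kk_nonneg z)
    finally show ?thesis .
  qed
  have km: "(\<lambda>(z, x). ennreal (amp f x powr p * nkernel z x)) \<in> borel_measurable (dA \<Otimes>\<^sub>M dA)" by measurable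
  have inner: "(\<integral>\<^sup>+z. ennreal (amp f x powr p * nkernel z x) \<partial>dA) \<le> ennreal KB * ennreal (amp f x powr p)" if x: "x \<in> unit_disk" for x
  proof -
    have "(\<integral>\<^sup>+z. ennreal (amp f x powr p * nkernel z x) \<partial>dA) = (\<integral>\<^sup>+z. ennreal (amp f x powr p) * ennreal (nkernel x z) \<partial>dA)"
    proof (rule nn_integral_cong)
      fix z assume "z \<in> space dA"
      then have z: "z \<in> unit_disk" by simp
      show "ennreal (amp f x powr p * nkernel z x) = ennreal (amp f x powr p) * ennreal (nkernel x z)"
        unfolding kk_sym[OF z x] by (rule ennreal_mult') simp
    qed
    also have "\<dots> = ennreal (amp f x powr p) * (\<integral>\<^sup>+z. ennreal (nkernel x z) \<partial>dA)"
      by (rule nn_integral_cmult) (use kk_integral(1)[OF x] in measurable)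
    also have "(\<integral>\<^sup>+z. ennreal (nkernel x z) \<partial>dA) = ennreal (LINT z|dA. nkernel x z)"
      by (rule nn_integral_eq_integral[OF kk_integral(1)[OF x]]) (auto intro!: AE_I2 kk_nonneg x)
    also have "ennreal (amp f x powr p) * ennreal (LINT z|dA. nkernel x z) \<le> ennreal (amp f x powr p) * ennreal KB"
      by (intro mult_left_mono ennreal_leI kk_integral(2) x) simp
    finally show ?thesis by (simp add: mult.commute)
  qed
  have "(\<integral>\<^sup>+z. ennreal (amp (bergman_projection \<omega> f) z powr p) \<partial>dA)
      \<le> (\<integral>\<^sup>+z. ennreal (KB powr (p - 1)) * (\<integral>\<^sup>+x. ennreal (amp f x powr p * nkernel z x) \<partial>dA) \<partial>dA)"
    by (rule nn_integral_mono) (use pt in simp)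
  also have "\<dots> = ennreal (KB powr (p - 1)) * (\<integral>\<^sup>+z. (\<integral>\<^sup>+x. ennreal (amp f x powr p * nkernel z x) \<partial>dA) \<partial>dA)"
    by (rule nn_integral_cmult) measurable
  also have "(\<integral>\<^sup>+z. (\<integral>\<^sup>+x. ennreal (amp f x powr p * nkernel z x) \<partial>dA) \<partial>dA) = (\<integral>\<^sup>+x. (\<integral>\<^sup>+z. ennreal (amp f x powr p * nkernel z x) \<partial>dA) \<partial>dA)"
    using Fubini'[OF km] by simp
  also have "\<dots> \<le> (\<integral>\<^sup>+x. ennreal KB * ennreal (amp f x powr p) \<partial>dA)"
    by (rule nn_integral_mono) (use inner in simp)
  also have "\<dots> = ennreal KB * ennreal I" unfolding nI[symmetric] by (rule nn_integral_cmult) measurable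
  also have "ennreal (KB powr (p - 1)) * (ennreal KB * ennreal I) = ennreal (KB powr (p - 1) * (KB * I))"
  proof -
    have "0 \<le> I" unfolding I_def by simp
    then show ?thesis using KB_pos by (simp add: ennreal_mult)
  qed
  also have "KB powr (p - 1) * (KB * I) = KB powr p * I"
    using KB_pos by (simp add: powr_diff)
  finally have le: "(\<integral>\<^sup>+z. ennreal (amp (bergman_projection \<omega> f) z powr p) \<partial>dA) \<le> ennreal (KB powr p * I)"
    by (simp add: mult_left_mono)
  have int: "integrable dA (\<lambda>z. amp (bergman_projection \<omega> f) z powr p)"
  proof (rule integrableI_nonneg)
    show "(\<integral>\<^sup>+z. ennreal (amp (bergman_projection \<omega> f) z powr p) \<partial>dA) < \<infinity>"
      using le by (rule order_le_less_trans) simp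
    show "AE x in dA. 0 \<le> amp (bergman_projection \<omega> f) x powr p" by simp
  qed measurable
  then show "bergman_projection \<omega> f \<in> Lp_space p (\<lambda>x. \<omega> x powr (p / 2))" using Pm by (simp add: Lp_iff)
  have "ennreal (LINT x|dA. amp (bergman_projection \<omega> f) x powr p) = (\<integral>\<^sup>+z. ennreal (amp (bergman_projection \<omega> f) z powr p) \<partial>dA)"
    by (rule nn_integral_eq_integral[symmetric, OF int]) simp
  then have "ennreal (LINT x|dA. amp (bergman_projection \<omega> f) x powr p) \<le> ennreal (KB powr p * I)" using le by (simp only:)
  then show "(LINT x|dA. amp (bergman_projection \<omega> f) x powr p) \<le> KB powr p * (LINT x|dA. amp f x powr p)"
    unfolding I_def[symmetric] by (rule ennreal_le_iff[THEN iffD1, rotated]) (simp add: I_def)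
qed

lemma projection_bounded:
  assumes p: "1 \<le> p"
  shows "bounded_operator_Lp_Ap p (\<lambda>x. \<omega> x powr (p / 2)) (bergman_projection \<omega>)"
  unfolding bounded_operator_Lp_Ap_def
proof (intro conjI ballI allI exI)
  fix f assume f: "f \<in> Lp_space p (\<lambda>x. \<omega> x powr (p / 2))"
  show "bergman_projection \<omega> f \<in> Ap_space p (\<lambda>x. \<omega> x powr (p / 2))"
    using projection_holomorphic[OF p f] projection_Lp(1)[OF p f] by (simp add: Ap_space_def)
  have "(LINT x|dA. amp (bergman_projection \<omega> f) x powr p) powr (1 / p) \<le> (KB powr p * (LINT x|dA. amp f x powr p)) powr (1 / p)"
    using p by (intro powr_mono2 projection_Lp(2) f) auto
  also have "\<dots> = KB * (LINT x|dA. amp f x powr p) powr (1 / p)"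
    using p KB_pos by (simp add: powr_mult powr_powr)
  finally show "Lp_norm p (\<lambda>x. \<omega> x powr (p / 2)) (bergman_projection \<omega> f) \<le> KB * Lp_norm p (\<lambda>x. \<omega> x powr (p / 2)) f"
    by (simp only: Lp_norm_eq)
next
  fix f g a b z
  assume f: "f \<in> Lp_space p (\<lambda>x. \<omega> x powr (p / 2))" and g: "g \<in> Lp_space p (\<lambda>x. \<omega> x powr (p / 2))" and z: "z \<in> unit_disk"
  have "bergman_projection \<omega> (\<lambda>x. a * f x + b * g x) z
      = (LINT x|dA. a * (f x * cnj (ker_at z x) * of_real (\<omega> x)) + b * (g x * cnj (ker_at z x) * of_real (\<omega> x)))"
    unfolding bergman_projection_def by (rule Bochner_Integration.integral_cong) (simp_all add: algebra_simps)
  also have "\<dots> = a * bergman_projection \<omega> f z + b * bergman_projection \<omega> g z"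
    using projection_integrable[OF p f z] projection_integrable[OF p g z] by (simp add: bergman_projection_def)
  finally show "bergman_projection \<omega> (\<lambda>x. a * f x + b * g x) z = a * bergman_projection \<omega> f z + b * bergman_projection \<omega> g z" .
qed

end

text \<open>The integral of a non-integrable function is 0 by convention, so boundedness alone would
  not show that the projection is given by convergent integrals; absolute convergence is therefore
  asserted as well.\<close>

theorem theorem4p1:
  fixes p :: real and \<omega> :: "complex \<Rightarrow> real"
  assumes "1 \<le> p"
    and "\<omega> \<in> class_E"
  shows "(\<forall>f\<in>Lp_space p (\<lambda>z. \<omega> z powr (p / 2)). \<forall>z\<in>unit_disk.
            integrable dA (\<lambda>\<xi>. f \<xi> * cnj (bergman_kernel \<omega> z \<xi>) * complex_of_real (\<omega> \<xi>))) \<and>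
         bounded_operator_Lp_Ap p (\<lambda>z. \<omega> z powr (p / 2)) (bergman_projection \<omega>)"
proof -
  \<comment> \<open>The associated function must be the one supplied by \<open>class_E\<close>:
    membership in \<open>class_Lstar\<close> only yields some \<tau>, possibly without the
    additional property.\<close>
  obtain \<tau> where w: "weight \<omega>" and a: "associated_function \<omega> \<tau>"
    and E: "\<And>m::nat. 1 \<le> m \<Longrightarrow> \<exists>b t. 0 < b \<and> 0 < t \<and> t < 1 / real m \<and>
        (\<forall>z\<in>unit_disk. \<forall>\<xi>\<in>unit_disk. b * \<tau> \<xi> < norm (z - \<xi>) \<longrightarrow> \<tau> z \<le> \<tau> \<xi> + t * norm (z - \<xi>))"
  proof -
    have "\<omega> \<in> class_Lstar" using assms(2) by (simp add: class_E_def)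
    then have w: "weight \<omega>" by (simp add: class_Lstar_def)
    have "\<exists>\<tau>. associated_function \<omega> \<tau> \<and> (\<forall>m::nat. 1 \<le> m \<longrightarrow> (\<exists>b t. 0 < b \<and> 0 < t \<and> t < 1 / real m \<and>
        (\<forall>z\<in>unit_disk. \<forall>\<xi>\<in>unit_disk. b * \<tau> \<xi> < norm (z - \<xi>) \<longrightarrow> \<tau> z \<le> \<tau> \<xi> + t * norm (z - \<xi>))))"
      using assms(2) unfolding class_E_def mem_Collect_eq by (rule conjunct2)
    then show ?thesis using w that by (elim exE conjE) simp
  qed
  obtain \<phi> where phi: "\<tau> \<in> class_L" "\<And>z. z \<in> unit_disk \<Longrightarrow> \<omega> z = exp (- 2 * \<phi> z)" "C_on 2 unit_disk \<phi>"
    "\<And>z. z \<in> unit_disk \<Longrightarrow> 0 < laplacian \<phi> z" "comparable_on unit_disk (\<lambda>z. laplacian \<phi> z powr (- 1 / 2)) \<tau>"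
    using a unfolding associated_function_def by blast
  obtain C where C: "0 < C" "\<And>z. z \<in> unit_disk \<Longrightarrow> inverse C * \<tau> z \<le> laplacian \<phi> z powr (- 1 / 2)"
      "\<And>z. z \<in> unit_disk \<Longrightarrow> laplacian \<phi> z powr (- 1 / 2) \<le> C * \<tau> z"
    using phi(5) unfolding comparable_on_def by blast
  obtain c1 c2 where c: "\<And>z. z \<in> unit_disk \<Longrightarrow> 0 < \<tau> z" "\<And>z. z \<in> unit_disk \<Longrightarrow> \<tau> z \<le> c1 * (1 - norm z)"
      "\<And>z \<zeta>. z \<in> unit_disk \<Longrightarrow> \<zeta> \<in> unit_disk \<Longrightarrow> \<bar>\<tau> z - \<tau> \<zeta>\<bar> \<le> c2 * norm (z - \<zeta>)"
    using phi(1) unfolding class_L_def by blast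
  have i: "integrable dA \<omega>" using w by (simp add: weight_def)
  interpret exp_weight \<phi> \<omega> \<tau> C c1 c2
    by (rule exp_weight.intro) (fact phi(3) phi(2) i C(1) phi(4) C(2) C(3) c(1) c(2) c(3) E)+
  show ?thesis
    using projection_integrable[OF assms(1)] projection_bounded[OF assms(1)] by blast
qed

end
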